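(* Let $\Lambda$ be an artin algebra, let $\Phi:\mathrm{maps}(\mathrm{mod}\,\Lambda)\to\mathrm{mod}(\mathrm{mod}\,\Lambda)$ be the functor $\Phi(A_1\xrightarrow{f}A_0)=\mathrm{Coker}\big((-,A_1)\xrightarrow{(-,f)}(-,A_0)\big)$, and let $\mathscr{C}\subset\mathrm{maps}(\mathrm{mod}\,\Lambda)$ be a subcategory. Then: (a) if $\mathscr{C}$ is contravariantly finite in $\mathrm{maps}(\mathrm{mod}\,\Lambda)$, then $\Phi(\mathscr{C})$ is a contravariantly finite subcategory of $\mathrm{mod}(\mathrm{mod}\,\Lambda)$; (b) if $\mathscr{C}$ is covariantly finite in $\mathrm{maps}(\mathrm{mod}\,\Lambda)$, then $\Phi(\mathscr{C})$ is a covariantly finite subcategory of $\mathrm{mod}(\mathrm{mod}\,\Lambda)$; (c) if $\mathscr{C}$ is functorially finite in $\mathrm{maps}(\mathrm{mod}\,\Lambda)$, then $\Phi(\mathscr{C})$ is a functorially finite subcategory of $\mathrm{mod}(\mathrm{mod}\,\Lambda)$.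
   Context: $\mathrm{mod}\,\Lambda$: finitely generated left $\Lambda$-modules. $\mathrm{mod}(\mathrm{mod}\,\Lambda)$: finitely presented contravariant functors from $\mathrm{mod}\,\Lambda$ to abelian groups; $(-,X)=\mathrm{Hom}_\Lambda(-,X)$. $\mathrm{maps}(\mathrm{mod}\,\Lambda)$: objects are maps $f:A_1\to A_0$ of finitely generated $\Lambda$-modules, also written $(A_1,A_0,f)$; morphisms are commutative squares. Subcategories are full and closed under isomorphisms and direct summands; $\Phi(\mathscr{C})$ is the full subcategory of functors isomorphic to $\Phi(X)$ for some $X\in\mathscr{C}$. For a subcategory $\mathscr{X}$ of a category $\mathcal{B}$, a right $\mathscr{X}$-approximation of $M\in\mathcal{B}$ is a morphism $X\to M$ with $X\in\mathscr{X}$ through which every morphism $X'\to M$ with $X'\in\mathscr{X}$ factors; left $\mathscr{X}$-approximations are defined dually. $\mathscr{X}$ is contravariantly (covariantly) finite in $\mathcal{B}$ if every object of $\mathcal{B}$ has a right (left) $\mathscr{X}$-approximation, and functorially finite if it is both. *)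

theory Defs
  imports "HOL-Algebra.Module" "HOL-Algebra.Coset" "HOL-Algebra.Ideal"
begin

section \<open>Artin algebras and finitely generated left modules\<close>

text \<open>The library locale \<open>module\<close> asks for a commutative ring of scalars; this is the
  same axiom list over an arbitrary ring. As there, the fields \<open>mult\<close> and \<open>one\<close> of
  the record of a module are irrelevant.\<close>

locale left_module = R?: ring R + M?: abelian_group M
  for R :: "('r, 'k) ring_scheme" (structure) and M :: "('r, 'b, 'l) module_scheme" (structure) +
  assumes smult_closed:
      "\<lbrakk>a \<in> carrier R; x \<in> carrier M\<rbrakk> \<Longrightarrow> a \<odot>\<^bsub>M\<^esub> x \<in> carrier M"
    and smult_l_distr:
      "\<lbrakk>a \<in> carrier R; b \<in> carrier R; x \<in> carrier M\<rbrakk> \<Longrightarrow>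
      (a \<oplus>\<^bsub>R\<^esub> b) \<odot>\<^bsub>M\<^esub> x = a \<odot>\<^bsub>M\<^esub> x \<oplus>\<^bsub>M\<^esub> b \<odot>\<^bsub>M\<^esub> x"
    and smult_r_distr:
      "\<lbrakk>a \<in> carrier R; x \<in> carrier M; y \<in> carrier M\<rbrakk> \<Longrightarrow>
      a \<odot>\<^bsub>M\<^esub> (x \<oplus>\<^bsub>M\<^esub> y) = a \<odot>\<^bsub>M\<^esub> x \<oplus>\<^bsub>M\<^esub> a \<odot>\<^bsub>M\<^esub> y"
    and smult_assoc1:
      "\<lbrakk>a \<in> carrier R; b \<in> carrier R; x \<in> carrier M\<rbrakk> \<Longrightarrow>
      (a \<otimes>\<^bsub>R\<^esub> b) \<odot>\<^bsub>M\<^esub> x = a \<odot>\<^bsub>M\<^esub> (b \<odot>\<^bsub>M\<^esub> x)"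
    and smult_one: "x \<in> carrier M \<Longrightarrow> \<one>\<^bsub>R\<^esub> \<odot>\<^bsub>M\<^esub> x = x"

definition fin_gen :: "('r, 'k) ring_scheme \<Rightarrow> ('r, 'b, 'l) module_scheme \<Rightarrow> bool" where
  "fin_gen R M \<longleftrightarrow> (\<exists>S. finite S \<and> S \<subseteq> carrier M \<and>
     (\<forall>m\<in>carrier M. \<exists>c\<in>S \<rightarrow> carrier R. m = (\<Oplus>\<^bsub>M\<^esub>s\<in>S. c s \<odot>\<^bsub>M\<^esub> s)))"

definition artinian_cring :: "('r, 'k) ring_scheme \<Rightarrow> bool" where
  "artinian_cring R \<longleftrightarrow> cring R \<and>
     (\<forall>I :: nat \<Rightarrow> 'r set. (\<forall>n. ideal (I n) R \<and> I (Suc n) \<subseteq> I n) \<longrightarrow>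
        (\<exists>n. \<forall>m\<ge>n. I m = I n))"

text \<open>The record of \<open>\<Lambda>\<close> carries both its ring structure and the scalar action of \<open>R\<close>.
  The two equations in the last conjunct say that the structure map
  \<open>r \<mapsto> r \<odot> \<one>\<close> is a ring homomorphism from \<open>R\<close> to the centre of \<open>\<Lambda>\<close>.\<close>

definition artin_algebra :: "('r, 'k) ring_scheme \<Rightarrow> ('r, 'a, 'l) module_scheme \<Rightarrow> bool" where
  "artin_algebra R \<Lambda> \<longleftrightarrow> artinian_cring R \<and> ring \<Lambda> \<and> module R \<Lambda> \<and> fin_gen R \<Lambda> \<and>
     (\<forall>r\<in>carrier R. \<forall>a\<in>carrier \<Lambda>. \<forall>b\<in>carrier \<Lambda>.
        (r \<odot>\<^bsub>\<Lambda>\<^esub> a) \<otimes>\<^bsub>\<Lambda>\<^esub> b = r \<odot>\<^bsub>\<Lambda>\<^esub> (a \<otimes>\<^bsub>\<Lambda>\<^esub> b) \<and>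
        a \<otimes>\<^bsub>\<Lambda>\<^esub> (r \<odot>\<^bsub>\<Lambda>\<^esub> b) = r \<odot>\<^bsub>\<Lambda>\<^esub> (a \<otimes>\<^bsub>\<Lambda>\<^esub> b))"


section \<open>Preadditive categories and their subcategories\<close>

text \<open>The hom-sets carry their addition, so a hom-object is an abelian group. Groups are
  written multiplicatively, as everywhere in the library: \<open>\<otimes>\<^bsub>Hom C X Y\<^esub>\<close> is the sum of
  two morphisms and \<open>\<one>\<^bsub>Hom C X Y\<^esub>\<close> is the zero morphism. Morphisms will be extensional
  functions, whose composite depends on the source; \<open>Comp C X g f\<close> is the composite
  \<open>g \<circ> f\<close> of \<open>f : X \<rightarrow> Y\<close> and \<open>g : Y \<rightarrow> Z\<close>.\<close>

record ('o, 'm) precat =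
  Ob :: "'o set"
  Hom :: "'o \<Rightarrow> 'o \<Rightarrow> 'm monoid"
  Comp :: "'o \<Rightarrow> 'm \<Rightarrow> 'm \<Rightarrow> 'm"
  Ident :: "'o \<Rightarrow> 'm"

abbreviation arrows :: "('o, 'm) precat \<Rightarrow> 'o \<Rightarrow> 'o \<Rightarrow> 'm set" where
  "arrows C X Y \<equiv> carrier (Hom C X Y)"

definition isomorphic :: "('o, 'm) precat \<Rightarrow> 'o \<Rightarrow> 'o \<Rightarrow> bool" where
  "isomorphic C X Y \<longleftrightarrow> (\<exists>f\<in>arrows C X Y. \<exists>g\<in>arrows C Y X.
     Comp C X g f = Ident C X \<and> Comp C Y f g = Ident C Y)"

text \<open>\<open>Y\<close> is a biproduct of \<open>X\<close> and some \<open>Z\<close>.\<close>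

definition direct_summand :: "('o, 'm) precat \<Rightarrow> 'o \<Rightarrow> 'o \<Rightarrow> bool" where
  "direct_summand C X Y \<longleftrightarrow> (\<exists>Z\<in>Ob C.
     \<exists>i\<in>arrows C X Y. \<exists>p\<in>arrows C Y X. \<exists>j\<in>arrows C Z Y. \<exists>q\<in>arrows C Y Z.
       Comp C X p i = Ident C X \<and> Comp C Z q j = Ident C Z \<and>
       Comp C Z p j = \<one>\<^bsub>Hom C Z X\<^esub> \<and> Comp C X q i = \<one>\<^bsub>Hom C X Z\<^esub> \<and>
       Comp C Y i p \<otimes>\<^bsub>Hom C Y Y\<^esub> Comp C Y j q = Ident C Y)"

text \<open>Subcategories are full, hence given by their objects.\<close>

definition subcategory :: "('o, 'm) precat \<Rightarrow> 'o set \<Rightarrow> bool" where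
  "subcategory C \<X> \<longleftrightarrow> \<X> \<subseteq> Ob C \<and>
     (\<forall>X\<in>\<X>. \<forall>Y\<in>Ob C. isomorphic C Y X \<longrightarrow> Y \<in> \<X>) \<and>
     (\<forall>X\<in>\<X>. \<forall>Y\<in>Ob C. direct_summand C Y X \<longrightarrow> Y \<in> \<X>)"

definition right_approximation :: "('o, 'm) precat \<Rightarrow> 'o set \<Rightarrow> 'o \<Rightarrow> 'o \<Rightarrow> 'm \<Rightarrow> bool" where
  "right_approximation C \<X> M X f \<longleftrightarrow> X \<in> \<X> \<and> f \<in> arrows C X M \<and>
     (\<forall>X'\<in>\<X>. \<forall>g\<in>arrows C X' M. \<exists>h\<in>arrows C X' X. g = Comp C X' f h)"

definition left_approximation :: "('o, 'm) precat \<Rightarrow> 'o set \<Rightarrow> 'o \<Rightarrow> 'o \<Rightarrow> 'm \<Rightarrow> bool" where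
  "left_approximation C \<X> M X f \<longleftrightarrow> X \<in> \<X> \<and> f \<in> arrows C M X \<and>
     (\<forall>X'\<in>\<X>. \<forall>g\<in>arrows C M X'. \<exists>h\<in>arrows C X X'. g = Comp C M h f)"

definition contravariantly_finite :: "('o, 'm) precat \<Rightarrow> 'o set \<Rightarrow> bool" where
  "contravariantly_finite C \<X> \<longleftrightarrow> (\<forall>M\<in>Ob C. \<exists>X f. right_approximation C \<X> M X f)"

definition covariantly_finite :: "('o, 'm) precat \<Rightarrow> 'o set \<Rightarrow> bool" where
  "covariantly_finite C \<X> \<longleftrightarrow> (\<forall>M\<in>Ob C. \<exists>X f. left_approximation C \<X> M X f)"

definition functorially_finite :: "('o, 'm) precat \<Rightarrow> 'o set \<Rightarrow> bool" where
  "functorially_finite C \<X> \<longleftrightarrow> contravariantly_finite C \<X> \<and> covariantly_finite C \<X>"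


section \<open>The category of finitely generated left modules\<close>

definition hom_module ::
  "('r, 'k) ring_scheme \<Rightarrow> ('r, 'b) module \<Rightarrow> ('r, 'c) module \<Rightarrow> ('b \<Rightarrow> 'c) set" where
  "hom_module R M N = {f \<in> hom (add_monoid M) (add_monoid N) \<inter> extensional (carrier M).
     \<forall>a\<in>carrier R. \<forall>x\<in>carrier M. f (a \<odot>\<^bsub>M\<^esub> x) = a \<odot>\<^bsub>N\<^esub> f x}"

text \<open>The objects are the finitely generated modules whose elements have type
  \<open>(nat \<Rightarrow> 'a) set\<close>, where \<open>'a\<close> is the type of the elements of \<open>\<Lambda>\<close>. Nothing is
  lost: lemma \<open>fin_gen_realizable\<close> below shows that every finitely generated left
  \<open>\<Lambda>\<close>-module, on whatever type, is isomorphic to one of them.\<close>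

type_synonym 'a elt = "(nat \<Rightarrow> 'a) set"

definition mod_cat ::
  "('a, 'k) ring_scheme \<Rightarrow> (('a, 'a elt) module, 'a elt \<Rightarrow> 'a elt) precat" where
  "mod_cat \<Lambda> =
    \<lparr>Ob = {M. left_module \<Lambda> M \<and> fin_gen \<Lambda> M},
     Hom = (\<lambda>M N. \<lparr>carrier = hom_module \<Lambda> M N,
        monoid.mult = (\<lambda>f g. \<lambda>x\<in>carrier M. f x \<oplus>\<^bsub>N\<^esub> g x),
        one = (\<lambda>x\<in>carrier M. \<zero>\<^bsub>N\<^esub>)\<rparr>),
     Comp = (\<lambda>M g f. compose (carrier M) g f),
     Ident = (\<lambda>M. \<lambda>x\<in>carrier M. x)\<rparr>"


lemma transport_module:
  fixes M :: "('a, 'b, 'l) module_scheme" and \<kappa> :: "'b \<Rightarrow> 'c"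
  assumes M: "left_module \<Lambda> M" and fg: "fin_gen \<Lambda> M" and inj: "inj_on \<kappa> (carrier M)"
  shows "\<exists>N :: ('a, 'c) module. left_module \<Lambda> N \<and> fin_gen \<Lambda> N \<and>
    bij_betw \<kappa> (carrier M) (carrier N) \<and> \<kappa> \<in> hom (add_monoid M) (add_monoid N) \<and>
    (\<forall>a\<in>carrier \<Lambda>. \<forall>x\<in>carrier M. \<kappa> (a \<odot>\<^bsub>M\<^esub> x) = a \<odot>\<^bsub>N\<^esub> \<kappa> x)"
proof -
  interpret M: left_module \<Lambda> M by (rule M)
  define g where "g = inv_into (carrier M) \<kappa>"
  have g [simp]: "g (\<kappa> x) = x" if "x \<in> carrier M" for x
    using that inj by (simp add: g_def)
  define N :: "('a, 'c) module" where
    "N = \<lparr>carrier = \<kappa> ` carrier M, mult = undefined, one = undefined, zero = \<kappa> \<zero>\<^bsub>M\<^esub>,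
          add = (\<lambda>x y. \<kappa> (g x \<oplus>\<^bsub>M\<^esub> g y)), smult = (\<lambda>a x. \<kappa> (a \<odot>\<^bsub>M\<^esub> g x))\<rparr>"
  have [simp]: "carrier N = \<kappa> ` carrier M" "\<zero>\<^bsub>N\<^esub> = \<kappa> \<zero>\<^bsub>M\<^esub>"
    "x \<oplus>\<^bsub>N\<^esub> y = \<kappa> (g x \<oplus>\<^bsub>M\<^esub> g y)" "a \<odot>\<^bsub>N\<^esub> x = \<kappa> (a \<odot>\<^bsub>M\<^esub> g x)" for a x y
    by (simp_all add: N_def)
  have agN: "abelian_group N"
  proof (rule abelian_groupI)
    fix x assume "x \<in> carrier N"
    then obtain u where u: "u \<in> carrier M" "x = \<kappa> u" by auto
    have "\<kappa> (\<ominus>\<^bsub>M\<^esub> u) \<in> carrier N" "\<kappa> (\<ominus>\<^bsub>M\<^esub> u) \<oplus>\<^bsub>N\<^esub> x = \<zero>\<^bsub>N\<^esub>"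
      using u by (auto simp: M.M.l_neg)
    then show "\<exists>y\<in>carrier N. y \<oplus>\<^bsub>N\<^esub> x = \<zero>\<^bsub>N\<^esub>" by blast
  qed (auto simp: M.M.a_ac)
  interpret N: abelian_group N by (rule agN)
  have lN: "left_module \<Lambda> N"
    by unfold_locales
      (auto simp: M.smult_closed M.smult_l_distr M.smult_r_distr M.smult_assoc1 M.smult_one)
  obtain S where S: "finite S" "S \<subseteq> carrier M"
    "\<And>m. m \<in> carrier M \<Longrightarrow> \<exists>c\<in>S \<rightarrow> carrier \<Lambda>. m = (\<Oplus>\<^bsub>M\<^esub>s\<in>S. c s \<odot>\<^bsub>M\<^esub> s)"
    using fg unfolding fin_gen_def by blast
  have sum: "\<kappa> (\<Oplus>\<^bsub>M\<^esub>s\<in>T. c s \<odot>\<^bsub>M\<^esub> s) = (\<Oplus>\<^bsub>N\<^esub>s\<in>T. c s \<odot>\<^bsub>N\<^esub> \<kappa> s)"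
    if "finite T" "T \<subseteq> S" "c \<in> S \<rightarrow> carrier \<Lambda>" for T c
    using that
  proof (induction T rule: finite_induct)
    case empty
    then show ?case by simp
  next
    case (insert t T)
    have t: "t \<in> carrier M" "c t \<in> carrier \<Lambda>" using insert S by auto
    have T: "(\<lambda>s. c s \<odot>\<^bsub>M\<^esub> s) \<in> T \<rightarrow> carrier M" using insert.prems S by (auto intro!: M.smult_closed)
    have T': "(\<lambda>s. c s \<odot>\<^bsub>N\<^esub> \<kappa> s) \<in> T \<rightarrow> carrier N"
      using T insert.prems S by (auto simp: subset_iff Pi_iff)
    have t': "c t \<odot>\<^bsub>N\<^esub> \<kappa> t \<in> carrier N"
      using t M.smult_closed by auto
    have "(\<Oplus>\<^bsub>N\<^esub>s\<in>insert t T. c s \<odot>\<^bsub>N\<^esub> \<kappa> s) = c t \<odot>\<^bsub>N\<^esub> \<kappa> t \<oplus>\<^bsub>N\<^esub> (\<Oplus>\<^bsub>N\<^esub>s\<in>T. c s \<odot>\<^bsub>N\<^esub> \<kappa> s)"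
      by (rule N.finsum_insert[OF insert(1,2) T' t'])
    also have "(\<Oplus>\<^bsub>N\<^esub>s\<in>T. c s \<odot>\<^bsub>N\<^esub> \<kappa> s) = \<kappa> (\<Oplus>\<^bsub>M\<^esub>s\<in>T. c s \<odot>\<^bsub>M\<^esub> s)"
      using insert by simp
    also have "c t \<odot>\<^bsub>N\<^esub> \<kappa> t \<oplus>\<^bsub>N\<^esub> \<kappa> (\<Oplus>\<^bsub>M\<^esub>s\<in>T. c s \<odot>\<^bsub>M\<^esub> s) = \<kappa> (c t \<odot>\<^bsub>M\<^esub> t \<oplus>\<^bsub>M\<^esub> (\<Oplus>\<^bsub>M\<^esub>s\<in>T. c s \<odot>\<^bsub>M\<^esub> s))"
      using t T M.smult_closed by (simp add: M.M.finsum_closed)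
    also have "\<dots> = \<kappa> (\<Oplus>\<^bsub>M\<^esub>s\<in>insert t T. c s \<odot>\<^bsub>M\<^esub> s)"
      using insert(1,2) T t M.smult_closed by (subst M.M.finsum_insert) auto
    finally show ?case by simp
  qed
  have "fin_gen \<Lambda> N"
    unfolding fin_gen_def
  proof (intro exI[of _ "\<kappa> ` S"] conjI ballI)
    fix n assume "n \<in> carrier N"
    then obtain m where m: "m \<in> carrier M" "n = \<kappa> m" by auto
    from S(3)[OF m(1)] obtain c where c: "c \<in> S \<rightarrow> carrier \<Lambda>" "m = (\<Oplus>\<^bsub>M\<^esub>s\<in>S. c s \<odot>\<^bsub>M\<^esub> s)" by blast
    have cg: "c \<circ> g \<in> \<kappa> ` S \<rightarrow> carrier \<Lambda>" using c S by (auto simp: subset_iff Pi_iff)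
    have inS: "inj_on \<kappa> S" using inj S(2) inj_on_subset by blast
    have "(\<Oplus>\<^bsub>N\<^esub>s\<in>\<kappa> ` S. (c \<circ> g) s \<odot>\<^bsub>N\<^esub> s) = (\<Oplus>\<^bsub>N\<^esub>s\<in>S. (c \<circ> g) (\<kappa> s) \<odot>\<^bsub>N\<^esub> \<kappa> s)"
      using cg S inS M.smult_closed by (intro N.add.finprod_reindex) (auto simp: subset_iff Pi_iff)
    also have "\<dots> = (\<Oplus>\<^bsub>N\<^esub>s\<in>S. c s \<odot>\<^bsub>N\<^esub> \<kappa> s)"
      using c S M.smult_closed by (intro N.finsum_cong') (auto simp: subset_iff Pi_iff)
    also have "\<dots> = n" using sum[of S c] c S m by simp
    finally show "\<exists>c\<in>\<kappa> ` S \<rightarrow> carrier \<Lambda>. n = (\<Oplus>\<^bsub>N\<^esub>s\<in>\<kappa> ` S. c s \<odot>\<^bsub>N\<^esub> s)" using cg by metis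
  qed (use S in auto)
  with lN show ?thesis
    using inj by (intro exI[of _ N]) (auto simp: bij_betw_def hom_def)
qed

lemma fin_gen_realizable:
  fixes M :: "('a, 'b, 'l) module_scheme"
  assumes M: "left_module \<Lambda> M" and fg: "fin_gen \<Lambda> M"
  shows "\<exists>N\<in>Ob (mod_cat \<Lambda>). \<exists>\<kappa>. bij_betw \<kappa> (carrier M) (carrier N) \<and>
    \<kappa> \<in> hom (add_monoid M) (add_monoid N) \<and>
    (\<forall>a\<in>carrier \<Lambda>. \<forall>x\<in>carrier M. \<kappa> (a \<odot>\<^bsub>M\<^esub> x) = a \<odot>\<^bsub>N\<^esub> \<kappa> x)"
proof -
  interpret M: left_module \<Lambda> M by (rule M)
  obtain S where S: "finite S" "S \<subseteq> carrier M"
    "\<And>m. m \<in> carrier M \<Longrightarrow> \<exists>c\<in>S \<rightarrow> carrier \<Lambda>. m = (\<Oplus>\<^bsub>M\<^esub>s\<in>S. c s \<odot>\<^bsub>M\<^esub> s)"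
    using fg unfolding fin_gen_def by blast
  obtain idx :: "'b \<Rightarrow> nat" where idx: "inj_on idx S"
    using finite_imp_inj_to_nat_seg[OF S(1)] by blast
  define \<kappa> where "\<kappa> m = {d :: nat \<Rightarrow> 'a. m = (\<Oplus>\<^bsub>M\<^esub>s\<in>S. d (idx s) \<odot>\<^bsub>M\<^esub> s)}" for m
  have "inj_on \<kappa> (carrier M)"
  proof (rule inj_onI)
    fix x y assume xy: "x \<in> carrier M" "y \<in> carrier M" "\<kappa> x = \<kappa> y"
    obtain c where c: "c \<in> S \<rightarrow> carrier \<Lambda>" "x = (\<Oplus>\<^bsub>M\<^esub>s\<in>S. c s \<odot>\<^bsub>M\<^esub> s)" using S(3) xy(1) by blast
    have "(\<Oplus>\<^bsub>M\<^esub>s\<in>S. (c \<circ> inv_into S idx) (idx s) \<odot>\<^bsub>M\<^esub> s) = x"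
      unfolding c(2) using c(1) S(2) idx M.smult_closed
      by (intro M.M.finsum_cong') (auto simp: subset_iff Pi_iff)
    then have "c \<circ> inv_into S idx \<in> \<kappa> x" by (simp add: \<kappa>_def)
    then show "x = y" using xy(3) by (auto simp: \<kappa>_def)
  qed
  from transport_module[OF M fg this] show ?thesis
    unfolding mod_cat_def by auto
qed


section \<open>The category of maps\<close>

text \<open>An object \<open>(A1, A0, f)\<close> is a map \<open>f : A1 \<rightarrow> A0\<close>; a morphism \<open>(u1, u0)\<close> is a
  commutative square.\<close>

definition maps_cat :: "('o, 'm) precat \<Rightarrow> ('o \<times> 'o \<times> 'm, 'm \<times> 'm) precat" where
  "maps_cat C =
    \<lparr>Ob = {(A1, A0, f). A1 \<in> Ob C \<and> A0 \<in> Ob C \<and> f \<in> arrows C A1 A0},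
     Hom = (\<lambda>(A1, A0, f) (B1, B0, g).
       \<lparr>carrier = {(u1, u0). u1 \<in> arrows C A1 B1 \<and> u0 \<in> arrows C A0 B0 \<and>
          Comp C A1 g u1 = Comp C A1 u0 f},
        monoid.mult = (\<lambda>(u1, u0) (v1, v0). (u1 \<otimes>\<^bsub>Hom C A1 B1\<^esub> v1, u0 \<otimes>\<^bsub>Hom C A0 B0\<^esub> v0)),
        one = (\<one>\<^bsub>Hom C A1 B1\<^esub>, \<one>\<^bsub>Hom C A0 B0\<^esub>)\<rparr>),
     Comp = (\<lambda>(A1, A0, f) (v1, v0) (u1, u0). (Comp C A1 v1 u1, Comp C A0 v0 u0)),
     Ident = (\<lambda>(A1, A0, f). (Ident C A1, Ident C A0))\<rparr>"


section \<open>Finitely presented contravariant functors to abelian groups\<close>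

text \<open>For \<open>h : X \<rightarrow> Y\<close>, \<open>act F X Y h\<close> is the homomorphism \<open>F Y \<rightarrow> F X\<close>.\<close>

record ('o, 'm, 'g) cfunctor =
  val :: "'o \<Rightarrow> 'g monoid"
  act :: "'o \<Rightarrow> 'o \<Rightarrow> 'm \<Rightarrow> 'g \<Rightarrow> 'g"

definition contravariant_functor ::
  "('o, 'm) precat \<Rightarrow> ('o, 'm, 'g) cfunctor \<Rightarrow> bool" where
  "contravariant_functor C F \<longleftrightarrow>
     (\<forall>X\<in>Ob C. comm_group (val F X)) \<and>
     (\<forall>X\<in>Ob C. \<forall>Y\<in>Ob C. \<forall>h\<in>arrows C X Y. act F X Y h \<in> hom (val F Y) (val F X)) \<and>
     (\<forall>X\<in>Ob C. \<forall>x\<in>carrier (val F X). act F X X (Ident C X) x = x) \<and>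
     (\<forall>X\<in>Ob C. \<forall>Y\<in>Ob C. \<forall>Z\<in>Ob C. \<forall>h\<in>arrows C X Y. \<forall>k\<in>arrows C Y Z.
        \<forall>z\<in>carrier (val F Z). act F X Z (Comp C X k h) z = act F X Y h (act F Y Z k z))"

definition nat_trans ::
  "('o, 'm) precat \<Rightarrow> ('o, 'm, 'g) cfunctor \<Rightarrow> ('o, 'm, 'h) cfunctor \<Rightarrow> ('o \<Rightarrow> 'g \<Rightarrow> 'h) set"
  where
  "nat_trans C F G =
     {\<eta> \<in> (\<Pi>\<^sub>E X\<in>Ob C. hom (val F X) (val G X) \<inter> extensional (carrier (val F X))).
        \<forall>X\<in>Ob C. \<forall>Y\<in>Ob C. \<forall>h\<in>arrows C X Y. \<forall>y\<in>carrier (val F Y).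
          \<eta> X (act F X Y h y) = act G X Y h (\<eta> Y y)}"

text \<open>The representable functor \<open>(-, A)\<close> and the transformation
  \<open>(-, f) : (-, A1) \<rightarrow> (-, A0)\<close>.\<close>

definition rep :: "('o, 'm) precat \<Rightarrow> 'o \<Rightarrow> ('o, 'm, 'm) cfunctor" where
  "rep C A = \<lparr>val = (\<lambda>X. Hom C X A), act = (\<lambda>X Y h g. Comp C X g h)\<rparr>"

definition rep_map :: "('o, 'm) precat \<Rightarrow> 'o \<Rightarrow> 'm \<Rightarrow> 'o \<Rightarrow> 'm \<Rightarrow> 'm" where
  "rep_map C A1 f = (\<lambda>X\<in>Ob C. \<lambda>g\<in>arrows C X A1. Comp C X f g)"

text \<open>\<open>F\<close> is finitely presented if there is an exact sequence
  \<open>(-, A1) \<rightarrow> (-, A0) \<rightarrow> F \<rightarrow> 0\<close>.\<close>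

definition finitely_presented :: "('o, 'm) precat \<Rightarrow> ('o, 'm, 'g) cfunctor \<Rightarrow> bool" where
  "finitely_presented C F \<longleftrightarrow> contravariant_functor C F \<and>
     (\<exists>A1\<in>Ob C. \<exists>A0\<in>Ob C. \<exists>\<eta>\<in>nat_trans C (rep C A1) (rep C A0). \<exists>\<epsilon>\<in>nat_trans C (rep C A0) F.
        \<forall>X\<in>Ob C.
          \<eta> X ` carrier (val (rep C A1) X) = kernel (val (rep C A0) X) (val F X) (\<epsilon> X) \<and>
          \<epsilon> X ` carrier (val (rep C A0) X) = carrier (val F X))"

text \<open>The category \<open>mod(C)\<close>. The values of its objects are groups whose elements have type
  \<open>'m set\<close>, sets of morphisms of \<open>C\<close>, the type in which cokernels of maps between
  representable functors live. Again nothing is lost: lemma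
  \<open>finitely_presented_realizable\<close> below shows that a finitely presented functor with
  values on any other type is isomorphic to one of these.\<close>

definition fp_cat :: "('o, 'm) precat \<Rightarrow>
    (('o, 'm, 'm set) cfunctor, 'o \<Rightarrow> 'm set \<Rightarrow> 'm set) precat" where
  "fp_cat C =
    \<lparr>Ob = {F. finitely_presented C F},
     Hom = (\<lambda>F G. \<lparr>carrier = nat_trans C F G,
        monoid.mult = (\<lambda>\<eta> \<theta>. \<lambda>X\<in>Ob C. \<lambda>x\<in>carrier (val F X). \<eta> X x \<otimes>\<^bsub>val G X\<^esub> \<theta> X x),
        one = (\<lambda>X\<in>Ob C. \<lambda>x\<in>carrier (val F X). \<one>\<^bsub>val G X\<^esub>)\<rparr>),
     Comp = (\<lambda>F \<theta> \<eta>. \<lambda>X\<in>Ob C. compose (carrier (val F X)) (\<theta> X) (\<eta> X)),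
     Ident = (\<lambda>F. \<lambda>X\<in>Ob C. \<lambda>x\<in>carrier (val F X). x)\<rparr>"


lemma finitely_presented_realizable:
  fixes F :: "('o, 'm, 'g) cfunctor"
  assumes "finitely_presented C F"
    and mult: "\<And>X Y f g. \<lbrakk>X \<in> Ob C; Y \<in> Ob C; f \<in> arrows C X Y; g \<in> arrows C X Y\<rbrakk> \<Longrightarrow>
      f \<otimes>\<^bsub>Hom C X Y\<^esub> g \<in> arrows C X Y"
    and comp: "\<And>X Y Z f g. \<lbrakk>X \<in> Ob C; Y \<in> Ob C; Z \<in> Ob C; f \<in> arrows C X Y; g \<in> arrows C Y Z\<rbrakk> \<Longrightarrow>
      Comp C X g f \<in> arrows C X Z"
  shows "\<exists>G\<in>Ob (fp_cat C). \<exists>\<theta>\<in>nat_trans C F G.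
    \<forall>X\<in>Ob C. bij_betw (\<theta> X) (carrier (val F X)) (carrier (val G X))"
proof -
  obtain A1 A0 \<eta> \<epsilon> where A: "A1 \<in> Ob C" "A0 \<in> Ob C" "\<eta> \<in> nat_trans C (rep C A1) (rep C A0)"
    and \<epsilon>: "\<epsilon> \<in> nat_trans C (rep C A0) F"
    and all: "\<forall>X\<in>Ob C.
      \<eta> X ` carrier (val (rep C A1) X) = kernel (val (rep C A0) X) (val F X) (\<epsilon> X) \<and>
      \<epsilon> X ` carrier (val (rep C A0) X) = carrier (val F X)"
    using assms(1) unfolding finitely_presented_def by (elim conjE bexE) (rule that)
  have ex: "\<eta> X ` carrier (val (rep C A1) X) = kernel (val (rep C A0) X) (val F X) (\<epsilon> X)"
    and sur: "\<epsilon> X ` carrier (val (rep C A0) X) = carrier (val F X)" if "X \<in> Ob C" for X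
    using bspec[OF all that] by (rule conjunct1, rule conjunct2)
  have F: "contravariant_functor C F"
    using assms(1) unfolding finitely_presented_def by (rule conjunct1)
  define \<kappa> where "\<kappa> X x = {a \<in> arrows C X A0. \<epsilon> X a = x}" for X x
  have inj: "inj_on (\<kappa> X) (carrier (val F X))" if X: "X \<in> Ob C" for X
  proof (rule inj_onI)
    fix x y assume xy: "x \<in> carrier (val F X)" "y \<in> carrier (val F X)" "\<kappa> X x = \<kappa> X y"
    obtain a where "a \<in> arrows C X A0" "\<epsilon> X a = x"
      using sur[OF X] xy(1) unfolding rep_def by force
    then show "x = y" using xy(3) unfolding \<kappa>_def by blast
  qed
  define g where "g X = inv_into (carrier (val F X)) (\<kappa> X)" for X
  have g [simp]: "g X (\<kappa> X x) = x" if "X \<in> Ob C" "x \<in> carrier (val F X)" for X x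
    using that inj by (simp add: g_def)
  define G :: "('o, 'm, 'm set) cfunctor" where
    "G = \<lparr>val = (\<lambda>X. \<lparr>carrier = \<kappa> X ` carrier (val F X),
            monoid.mult = (\<lambda>x y. \<kappa> X (g X x \<otimes>\<^bsub>val F X\<^esub> g X y)), one = \<kappa> X \<one>\<^bsub>val F X\<^esub>\<rparr>),
          act = (\<lambda>X Y h y. \<kappa> X (act F X Y h (g Y y)))\<rparr>"
  have [simp]: "carrier (val G X) = \<kappa> X ` carrier (val F X)" "\<one>\<^bsub>val G X\<^esub> = \<kappa> X \<one>\<^bsub>val F X\<^esub>"
    "x \<otimes>\<^bsub>val G X\<^esub> y = \<kappa> X (g X x \<otimes>\<^bsub>val F X\<^esub> g X y)"
    "act G X Y h u = \<kappa> X (act F X Y h (g Y u))" for X Y h x y u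
    by (simp_all add: G_def)
  have cgF: "comm_group (val F X)" if "X \<in> Ob C" for X
    using F that unfolding contravariant_functor_def by blast
  have actF: "act F X Y h \<in> hom (val F Y) (val F X)"
    if "X \<in> Ob C" "Y \<in> Ob C" "h \<in> arrows C X Y" for X Y h
    using F that unfolding contravariant_functor_def by blast
  have actc: "act F X Y h y \<in> carrier (val F X)"
    if "X \<in> Ob C" "Y \<in> Ob C" "h \<in> arrows C X Y" "y \<in> carrier (val F Y)" for X Y h y
    using actF[OF that(1-3)] that(4) by (auto simp: hom_def)
  have cgG: "comm_group (val G X)" if X: "X \<in> Ob C" for X
  proof -
    interpret F: comm_group "val F X" by (rule cgF[OF X])
    show ?thesis
    proof (rule comm_groupI)
      fix x assume "x \<in> carrier (val G X)"
      then obtain u where u: "u \<in> carrier (val F X)" "x = \<kappa> X u" by auto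
      have "\<kappa> X (inv\<^bsub>val F X\<^esub> u) \<in> carrier (val G X)"
        "\<kappa> X (inv\<^bsub>val F X\<^esub> u) \<otimes>\<^bsub>val G X\<^esub> x = \<one>\<^bsub>val G X\<^esub>"
        using u X by auto
      then show "\<exists>y\<in>carrier (val G X). y \<otimes>\<^bsub>val G X\<^esub> x = \<one>\<^bsub>val G X\<^esub>" by blast
    qed (use X in \<open>auto simp: F.m_ac\<close>)
  qed
  have G: "contravariant_functor C G"
    unfolding contravariant_functor_def
  proof (intro conjI ballI)
    fix X Y h assume *: "X \<in> Ob C" "Y \<in> Ob C" "h \<in> arrows C X Y"
    interpret F: comm_group "val F Y" by (rule cgF[OF *(2)])
    show "act G X Y h \<in> hom (val G Y) (val G X)"
      using * actc[OF *] actF[OF *] by (auto simp: hom_def)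
  next
    fix X x assume "X \<in> Ob C" "x \<in> carrier (val G X)"
    then show "act G X X (Ident C X) x = x"
      using F unfolding contravariant_functor_def by auto
  next
    fix X Y Z h k z assume *: "X \<in> Ob C" "Y \<in> Ob C" "Z \<in> Ob C"
      "h \<in> arrows C X Y" "k \<in> arrows C Y Z" "z \<in> carrier (val G Z)"
    then obtain u where u: "u \<in> carrier (val F Z)" "z = \<kappa> Z u" by auto
    have "act F X Z (Comp C X k h) u = act F X Y h (act F Y Z k u)"
      using F * u unfolding contravariant_functor_def by blast
    then show "act G X Z (Comp C X k h) z = act G X Y h (act G Y Z k z)"
      using * u actc[OF *(2,3,5)] by simp
  qed (rule cgG)
  define \<theta> where "\<theta> = (\<lambda>X\<in>Ob C. \<lambda>x\<in>carrier (val F X). \<kappa> X x)"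
  have \<theta>: "\<theta> \<in> nat_trans C F G"
    unfolding nat_trans_def \<theta>_def using actc cgF
    by (auto simp: hom_def comm_group_def group.is_monoid monoid.m_closed)
  define \<epsilon>' where "\<epsilon>' = (\<lambda>X\<in>Ob C. \<lambda>x\<in>arrows C X A0. \<kappa> X (\<epsilon> X x))"
  have \<epsilon>c: "\<epsilon> X a \<in> carrier (val F X)" if "X \<in> Ob C" "a \<in> arrows C X A0" for X a
    using sur[OF that(1)] that(2) unfolding rep_def by auto
  have "\<epsilon>' \<in> nat_trans C (rep C A0) G"
  proof -
    have e: "\<epsilon> X \<in> hom (Hom C X A0) (val F X)" if "X \<in> Ob C" for X
      using \<epsilon> that unfolding nat_trans_def rep_def by (auto simp: PiE_iff)
    have n: "\<epsilon> X (Comp C X y h) = act F X Y h (\<epsilon> Y y)"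
      if "X \<in> Ob C" "Y \<in> Ob C" "h \<in> arrows C X Y" "y \<in> arrows C Y A0" for X Y h y
      using \<epsilon> that unfolding nat_trans_def rep_def by auto
    have m: "x \<otimes>\<^bsub>Hom C X A0\<^esub> y \<in> arrows C X A0"
      if "X \<in> Ob C" "x \<in> arrows C X A0" "y \<in> arrows C X A0" for X x y
      using mult that A(2) by blast
    show ?thesis
      unfolding nat_trans_def \<epsilon>'_def using e n m comp A(2) \<epsilon>c
      by (auto simp: rep_def hom_def)
  qed
  moreover have "\<epsilon>' X ` carrier (val (rep C A0) X) = carrier (val G X)" if X: "X \<in> Ob C" for X
    using sur[OF X] X unfolding \<epsilon>'_def rep_def
    by (simp add: image_image[symmetric, of "\<kappa> X" "\<epsilon> X"])
  moreover have "kernel (val (rep C A0) X) (val G X) (\<epsilon>' X) =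
      kernel (val (rep C A0) X) (val F X) (\<epsilon> X)" if X: "X \<in> Ob C" for X
  proof -
    interpret F: comm_group "val F X" by (rule cgF[OF X])
    show ?thesis
      using X inj[OF X] \<epsilon>c[OF X] unfolding kernel_def \<epsilon>'_def rep_def
      by (auto simp: inj_on_eq_iff)
  qed
  ultimately have fp: "finitely_presented C G"
    unfolding finitely_presented_def using G A ex by metis
  have bij: "bij_betw (\<theta> X) (carrier (val F X)) (carrier (val G X))" if "X \<in> Ob C" for X
    using inj[OF that] that unfolding \<theta>_def bij_betw_def by (auto simp: inj_on_def)
  show ?thesis
    by (intro bexI[of _ G] bexI[of _ \<theta>] ballI bij \<theta>) (simp_all add: fp_cat_def fp)
qed


section \<open>The functor \<open>\<Phi>\<close>\<close>

text \<open>Full subcategories only depend on the object map of \<open>\<Phi>\<close>, which is all that is defined.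
  The cokernel of \<open>\<eta> : F \<rightarrow> G\<close> is computed objectwise, as the group of cosets of the
  image; \<open>act\<close> sends the coset of \<open>g\<close> to the coset of \<open>act G X Y h g\<close>.\<close>

definition coker ::
  "('o, 'm, 'g) cfunctor \<Rightarrow> ('o, 'm, 'h) cfunctor \<Rightarrow> ('o \<Rightarrow> 'g \<Rightarrow> 'h) \<Rightarrow> ('o, 'm, 'h set) cfunctor"
  where
  "coker F G \<eta> =
    \<lparr>val = (\<lambda>X. val G X Mod (\<eta> X ` carrier (val F X))),
     act = (\<lambda>X Y h c. \<Union>g\<in>c. (\<eta> X ` carrier (val F X)) #>\<^bsub>val G X\<^esub> act G X Y h g)\<rparr>"

definition Phi :: "('o, 'm) precat \<Rightarrow> 'o \<times> 'o \<times> 'm \<Rightarrow> ('o, 'm, 'm set) cfunctor" where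
  "Phi C = (\<lambda>(A1, A0, f). coker (rep C A1) (rep C A0) (rep_map C A1 f))"

definition Phi_image :: "('o, 'm) precat \<Rightarrow> ('o \<times> 'o \<times> 'm) set \<Rightarrow> ('o, 'm, 'm set) cfunctor set"
  where
  "Phi_image C \<C> = {F \<in> Ob (fp_cat C). \<exists>A\<in>\<C>. isomorphic (fp_cat C) F (Phi C A)}"

end

theory Submission
  imports Defs
begin

text \<open>
  Write \<open>C\<close> for \<open>mod \<Lambda>\<close> and \<open>A = (A1, A0, f)\<close> for an object of \<open>maps(C)\<close>. The functor
  \<open>\<Phi>(A)\<close> is the one presented by the exact sequence \<open>(-, A1) \<rightarrow> (-, A0) \<rightarrow> \<Phi>(A) \<rightarrow> 0\<close>, and
  everything rests on how maps of presentations relate to maps of the presented functors. A square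
  \<open>A \<rightarrow> B\<close> induces a transformation \<open>\<Phi>(A) \<rightarrow> \<Phi>(B)\<close>, uniquely because \<open>(-, A0) \<rightarrow> \<Phi>(A)\<close> is
  onto (\<open>induced_nat_trans\<close>, \<open>induces_unique\<close>); and because representable functors are projective,
  every transformation arises in this way (\<open>nat_trans_lift\<close>), so \<open>\<Phi>\<close> is full. As every finitely
  presented functor is presented by some object of \<open>maps(C)\<close>, \<open>\<Phi>\<close> is also dense.

  Fullness and density already give the approximations. If \<open>M\<close> is presented by \<open>B\<close>, a right
  \<open>\<C>\<close>-approximation \<open>A \<rightarrow> B\<close> induces \<open>\<Phi>(A) \<rightarrow> M\<close>; a transformation \<open>\<Phi>(D) \<rightarrow> M\<close> with \<open>D \<in> \<C>\<close>
  lifts to a square \<open>D \<rightarrow> B\<close>, which factors through \<open>A\<close>. Left approximations are dual.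

  That \<open>\<Phi>(\<C>)\<close> is closed under direct summands is the part that needs \<open>\<Lambda>\<close> to be an artin algebra.
  A summand \<open>Y\<close> of \<open>\<Phi>(A)\<close> is the image of an idempotent \<open>e\<close> of \<open>\<Phi>(A)\<close>. By fullness \<open>e\<close> is
  induced by an endomorphism \<open>x\<close> of \<open>A\<close>, which need not be idempotent. But some power \<open>w = x\<^sup>k\<close>,
  \<open>k > 0\<close>, admits \<open>y\<close> such that \<open>p = w y\<close> is idempotent and \<open>w p = w\<close>. As \<open>w\<close> induces
  \<open>e\<^sup>k = e\<close>, the second equation gives \<open>e = e (e \<eta>) = e \<eta>\<close>, where \<open>\<eta>\<close> is induced by \<open>y\<close>: so \<open>p\<close>
  induces \<open>e\<close> (\<open>idempotent_lifts\<close>). Idempotents split in \<open>mod \<Lambda>\<close>, hence in \<open>maps(mod \<Lambda>)\<close>;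
  the image \<open>B\<close> of \<open>p\<close> is a direct summand of \<open>A\<close>, so \<open>B \<in> \<C>\<close>, and \<open>\<Phi>(B) \<cong> Y\<close>.

  The power \<open>w\<close> is found by an elementary form of Fitting's lemma. Finitely generated \<open>\<Lambda>\<close>-modules
  satisfy the descending chain condition on \<open>R\<close>-submodules (\<open>artin_algebra_op_artinian\<close>). Let \<open>P\<close> be
  the bicommutant of \<open>x\<close> in \<open>End(A)\<close>, a commutative ring that contains \<open>x\<close> and the scalars from
  \<open>R\<close>. For each element \<open>m\<close> of \<open>A1\<close> or \<open>A0\<close> the chain \<open>x\<^sup>n P m\<close> becomes stationary, so some
  \<open>x\<^sup>n (1 - x q)\<close> with \<open>q \<in> P\<close> kills \<open>m\<close>. Such elements commute and are closed under products, so one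
  of them kills all the finitely many generators and is zero: \<open>x\<^sup>n = x\<^bsup>n+1\<^esup> q\<close>. Then
  \<open>k = n + 1\<close> and \<open>y = q\<^sup>k\<close> work.
\<close>

section \<open>Chain conditions for modules over an artin algebra\<close>

text \<open>Descending chain condition on the additive subgroups stable under a family of operators. The family
  is indexed by \<open>T\<close>, so that one set of scalars can act on the ring \<open>\<Lambda>\<close> and on a \<open>\<Lambda>\<close>-module at the
  same time.\<close>

definition op_artinian :: "'t set \<Rightarrow> ('t \<Rightarrow> 'b \<Rightarrow> 'b) \<Rightarrow> ('b, 'l) ring_scheme \<Rightarrow> bool" where
  "op_artinian T \<beta> M \<longleftrightarrow> (\<forall>N :: nat \<Rightarrow> 'b set.
     (\<forall>n. additive_subgroup (N n) M \<and> (\<forall>t\<in>T. \<forall>x\<in>N n. \<beta> t x \<in> N n) \<and> N (Suc n) \<subseteq> N n) \<longrightarrow>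
     (\<exists>n. \<forall>m\<ge>n. N m = N n))"

lemma op_artinianI:
  assumes "\<And>N :: nat \<Rightarrow> 'b set. \<lbrakk>\<And>n. additive_subgroup (N n) M;
     \<And>n t x. \<lbrakk>t \<in> T; x \<in> N n\<rbrakk> \<Longrightarrow> \<beta> t x \<in> N n; \<And>m n. n \<le> m \<Longrightarrow> N m \<subseteq> N n\<rbrakk>
     \<Longrightarrow> \<exists>n. \<forall>m\<ge>n. N n \<subseteq> N m"
  shows "op_artinian T \<beta> M"
  unfolding op_artinian_def
proof (intro allI impI)
  fix N :: "nat \<Rightarrow> 'b set"
  assume N: "\<forall>n. additive_subgroup (N n) M \<and> (\<forall>t\<in>T. \<forall>x\<in>N n. \<beta> t x \<in> N n) \<and> N (Suc n) \<subseteq> N n"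
  have dec: "N m \<subseteq> N n" if "n \<le> m" for m n
    using that
  proof (induction m rule: dec_induct)
    case (step m)
    then show ?case using N by blast
  qed simp
  have "\<exists>n. \<forall>m\<ge>n. N n \<subseteq> N m" by (rule assms[OF _ _ dec]) (use N in simp_all)
  then show "\<exists>n. \<forall>m\<ge>n. N m = N n" using dec by (meson subset_antisym)
qed

lemma op_artinianD:
  assumes "op_artinian T \<beta> M" and "\<And>n. additive_subgroup (N n) M"
    and "\<And>n t x. \<lbrakk>t \<in> T; x \<in> N n\<rbrakk> \<Longrightarrow> \<beta> t x \<in> N n" and "\<And>n. N (Suc n) \<subseteq> N n"
  obtains n where "\<And>m. n \<le> m \<Longrightarrow> N m = N n"
proof -
  have "\<exists>n. \<forall>m\<ge>n. N m = N n"
    by (rule assms(1)[unfolded op_artinian_def, rule_format]) (simp add: assms(2-))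
  then show ?thesis using that by blast
qed

lemma (in abelian_group) additive_subgroupI:
  assumes "N \<subseteq> carrier G" "\<zero> \<in> N" "\<And>x y. \<lbrakk>x \<in> N; y \<in> N\<rbrakk> \<Longrightarrow> x \<oplus> y \<in> N"
    "\<And>x. x \<in> N \<Longrightarrow> \<ominus> x \<in> N"
  shows "additive_subgroup N G"
  using assms by (intro additive_subgroup.intro add.subgroupI) (auto simp: a_inv_def)

context left_module
begin

lemma smult_l_null:
  assumes x: "x \<in> carrier M"
  shows "\<zero> \<odot>\<^bsub>M\<^esub> x = \<zero>\<^bsub>M\<^esub>"
proof -
  have "\<zero> \<odot>\<^bsub>M\<^esub> x \<oplus>\<^bsub>M\<^esub> \<zero> \<odot>\<^bsub>M\<^esub> x = \<zero> \<odot>\<^bsub>M\<^esub> x"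
    using smult_l_distr[of \<zero> \<zero> x] x by simp
  then show ?thesis using x by (simp add: smult_closed)
qed

lemma smult_r_null:
  assumes a: "a \<in> carrier R"
  shows "a \<odot>\<^bsub>M\<^esub> \<zero>\<^bsub>M\<^esub> = \<zero>\<^bsub>M\<^esub>"
proof -
  have "a \<odot>\<^bsub>M\<^esub> \<zero>\<^bsub>M\<^esub> \<oplus>\<^bsub>M\<^esub> a \<odot>\<^bsub>M\<^esub> \<zero>\<^bsub>M\<^esub> = a \<odot>\<^bsub>M\<^esub> \<zero>\<^bsub>M\<^esub>"
    using smult_r_distr[of a "\<zero>\<^bsub>M\<^esub>" "\<zero>\<^bsub>M\<^esub>"] a by simp
  then show ?thesis using a by (simp add: smult_closed)
qed

lemma smult_l_minus:
  assumes "a \<in> carrier R" "x \<in> carrier M"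
  shows "(\<ominus> a) \<odot>\<^bsub>M\<^esub> x = \<ominus>\<^bsub>M\<^esub> (a \<odot>\<^bsub>M\<^esub> x)"
  using assms smult_l_distr[of "\<ominus> a" a x]
  by (intro M.minus_equality[symmetric]) (auto simp: smult_closed R.l_neg smult_l_null)

lemma left_submoduleI:
  assumes sub: "W \<subseteq> carrier M" and zero: "\<zero>\<^bsub>M\<^esub> \<in> W"
    and add: "\<And>x y. \<lbrakk>x \<in> W; y \<in> W\<rbrakk> \<Longrightarrow> x \<oplus>\<^bsub>M\<^esub> y \<in> W"
    and smult: "\<And>a x. \<lbrakk>a \<in> carrier R; x \<in> W\<rbrakk> \<Longrightarrow> a \<odot>\<^bsub>M\<^esub> x \<in> W"
  shows "submodule W R M"
proof (intro submodule.intro submodule_axioms.intro smult)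
  have "\<ominus>\<^bsub>M\<^esub> x \<in> W" if x: "x \<in> W" for x
  proof -
    have "x \<in> carrier M" using x sub by blast
    then have "\<ominus>\<^bsub>M\<^esub> x = (\<ominus> \<one>) \<odot>\<^bsub>M\<^esub> x" by (simp add: smult_l_minus smult_one)
    then show ?thesis using smult[of "\<ominus> \<one>" x] x by simp
  qed
  then have "additive_subgroup W M" using sub zero add by (intro M.additive_subgroupI)
  then show "subgroup W (add_monoid M)" by (simp add: additive_subgroup_def)
qed

lemma submodule_closed:
  assumes "submodule W R M"
  shows "W \<subseteq> carrier M" "\<zero>\<^bsub>M\<^esub> \<in> W" "\<And>x y. \<lbrakk>x \<in> W; y \<in> W\<rbrakk> \<Longrightarrow> x \<oplus>\<^bsub>M\<^esub> y \<in> W"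
    "\<And>a x. \<lbrakk>a \<in> carrier R; x \<in> W\<rbrakk> \<Longrightarrow> a \<odot>\<^bsub>M\<^esub> x \<in> W"
  using subgroup.subset[OF submodule.axioms(1)[OF assms]] subgroup.one_closed[OF submodule.axioms(1)[OF assms]]
    subgroup.m_closed[OF submodule.axioms(1)[OF assms]] submodule.smult_closed[OF assms] by auto

lemma submodule_left_module:
  assumes W: "submodule W R M"
  shows "left_module R (M\<lparr>carrier := W\<rparr>)"
proof -
  note W' = submodule_closed[OF W]
  have in_M: "x \<in> carrier M" if "x \<in> W" for x using that W'(1) by blast
  have "abelian_group (M\<lparr>carrier := W\<rparr>)"
  proof (rule abelian_groupI)
    fix x assume "x \<in> carrier (M\<lparr>carrier := W\<rparr>)"
    then have x: "x \<in> W" by simp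
    have "(\<ominus> \<one>) \<odot>\<^bsub>M\<^esub> x \<oplus>\<^bsub>M\<^esub> x = \<zero>\<^bsub>M\<^esub>"
      using in_M[OF x] by (simp add: smult_l_minus smult_one M.l_neg)
    moreover have "(\<ominus> \<one>) \<odot>\<^bsub>M\<^esub> x \<in> W" using W'(4)[of "\<ominus> \<one>" x] x by simp
    ultimately show "\<exists>y\<in>carrier (M\<lparr>carrier := W\<rparr>). y \<oplus>\<^bsub>M\<lparr>carrier := W\<rparr>\<^esub> x = \<zero>\<^bsub>M\<lparr>carrier := W\<rparr>\<^esub>"
      by (intro bexI[of _ "(\<ominus> \<one>) \<odot>\<^bsub>M\<^esub> x"]) simp_all
  qed (simp_all add: W' in_M M.a_ac)
  then show ?thesis
    by (intro left_module.intro left_module_axioms.intro R.ring_axioms)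
      (simp_all add: W' in_M smult_l_distr smult_r_distr smult_assoc1 smult_one)
qed

lemma linear_combination_in_submodule:
  assumes W: "submodule W R M" and S: "finite S" "S \<subseteq> W" and c: "c \<in> S \<rightarrow> carrier R"
  shows "(\<Oplus>\<^bsub>M\<^esub>s\<in>S. c s \<odot>\<^bsub>M\<^esub> s) \<in> W"
  using S c
proof (induction S rule: finite_induct)
  case (insert s S)
  note W' = submodule_closed[OF W]
  have "(\<Oplus>\<^bsub>M\<^esub>s\<in>insert s S. c s \<odot>\<^bsub>M\<^esub> s) = c s \<odot>\<^bsub>M\<^esub> s \<oplus>\<^bsub>M\<^esub> (\<Oplus>\<^bsub>M\<^esub>s\<in>S. c s \<odot>\<^bsub>M\<^esub> s)"
    using insert.hyps insert.prems W'(1)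
    by (intro M.finsum_insert) (auto intro!: smult_closed simp: Pi_iff subset_iff)
  moreover have "c s \<odot>\<^bsub>M\<^esub> s \<in> W" "(\<Oplus>\<^bsub>M\<^esub>s\<in>S. c s \<odot>\<^bsub>M\<^esub> s) \<in> W"
    using insert W'(4) by (auto simp: Pi_iff)
  ultimately show ?case using W'(3) by simp
qed (simp add: submodule_closed[OF W])

text \<open>The span of a finite set is a submodule: with the previous lemma it is the least one containing the
  set, which replaces explicit linear combinations by an induction principle.\<close>

lemma linear_combinations_submodule:
  assumes S: "finite S" "S \<subseteq> carrier M"
  shows "submodule {\<Oplus>\<^bsub>M\<^esub>s\<in>S. c s \<odot>\<^bsub>M\<^esub> s | c. c \<in> S \<rightarrow> carrier R} R M" (is "submodule ?V R M")
proof (rule left_submoduleI)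
  have cl: "(\<lambda>s. c s \<odot>\<^bsub>M\<^esub> s) \<in> S \<rightarrow> carrier M" if "c \<in> S \<rightarrow> carrier R" for c
    using that S(2) by (auto intro!: smult_closed simp: Pi_iff subset_iff)
  show "?V \<subseteq> carrier M" using cl by (auto intro!: M.finsum_closed)
  have "(\<Oplus>\<^bsub>M\<^esub>s\<in>S. \<zero> \<odot>\<^bsub>M\<^esub> s) = \<zero>\<^bsub>M\<^esub>"
    using S(2) by (intro M.add.finprod_one_eqI) (auto simp: smult_l_null)
  then show "\<zero>\<^bsub>M\<^esub> \<in> ?V" by (auto intro!: exI[of _ "\<lambda>_. \<zero>"])
next
  fix x y assume "x \<in> ?V" "y \<in> ?V"
  then obtain c d where c: "c \<in> S \<rightarrow> carrier R" "x = (\<Oplus>\<^bsub>M\<^esub>s\<in>S. c s \<odot>\<^bsub>M\<^esub> s)"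
    and d: "d \<in> S \<rightarrow> carrier R" "y = (\<Oplus>\<^bsub>M\<^esub>s\<in>S. d s \<odot>\<^bsub>M\<^esub> s)" by auto
  have "x \<oplus>\<^bsub>M\<^esub> y = (\<Oplus>\<^bsub>M\<^esub>s\<in>S. c s \<odot>\<^bsub>M\<^esub> s \<oplus>\<^bsub>M\<^esub> d s \<odot>\<^bsub>M\<^esub> s)"
    unfolding c(2) d(2) using c(1) d(1) S(2)
    by (intro M.finsum_addf[symmetric]) (auto intro!: smult_closed simp: Pi_iff subset_iff)
  also have "\<dots> = (\<Oplus>\<^bsub>M\<^esub>s\<in>S. (c s \<oplus> d s) \<odot>\<^bsub>M\<^esub> s)"
    using c(1) d(1) S(2)
    by (intro M.finsum_cong') (auto simp: smult_l_distr smult_closed Pi_iff subset_iff)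
  finally show "x \<oplus>\<^bsub>M\<^esub> y \<in> ?V" using c d by (auto intro!: exI[of _ "\<lambda>s. c s \<oplus> d s"] simp: Pi_iff)
next
  fix a x assume a: "a \<in> carrier R" and "x \<in> ?V"
  then obtain c where c: "c \<in> S \<rightarrow> carrier R" "x = (\<Oplus>\<^bsub>M\<^esub>s\<in>S. c s \<odot>\<^bsub>M\<^esub> s)" by auto
  have "a \<odot>\<^bsub>M\<^esub> (\<Oplus>\<^bsub>M\<^esub>s\<in>S. c s \<odot>\<^bsub>M\<^esub> s) = (\<Oplus>\<^bsub>M\<^esub>s\<in>S. (a \<otimes> c s) \<odot>\<^bsub>M\<^esub> s)"
    using S c(1)
  proof (induction S rule: finite_induct)
    case (insert s S)
    then have cl: "(\<lambda>s. c s \<odot>\<^bsub>M\<^esub> s) \<in> S \<rightarrow> carrier M" "(\<lambda>s. (a \<otimes> c s) \<odot>\<^bsub>M\<^esub> s) \<in> S \<rightarrow> carrier M"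
      "c s \<in> carrier R" "s \<in> carrier M"
      using a by (auto intro!: smult_closed simp: Pi_iff subset_iff)
    then show ?case
      using insert a by (simp add: M.finsum_closed smult_closed smult_r_distr smult_assoc1)
  qed (use a in \<open>simp add: smult_r_null\<close>)
  then show "a \<odot>\<^bsub>M\<^esub> x \<in> ?V"
    unfolding c(2) using a c(1) by (auto intro!: exI[of _ "\<lambda>s. a \<otimes> c s"] simp: Pi_iff)
qed

lemma fin_gen_iff:
  "fin_gen R M \<longleftrightarrow> (\<exists>S. finite S \<and> S \<subseteq> carrier M \<and>
     (\<forall>W. submodule W R M \<longrightarrow> S \<subseteq> W \<longrightarrow> carrier M \<subseteq> W))"
proof
  assume "fin_gen R M"
  then obtain S where S: "finite S" "S \<subseteq> carrier M"
    "\<forall>m\<in>carrier M. \<exists>c\<in>S \<rightarrow> carrier R. m = (\<Oplus>\<^bsub>M\<^esub>s\<in>S. c s \<odot>\<^bsub>M\<^esub> s)"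
    unfolding fin_gen_def by blast
  have "carrier M \<subseteq> W" if W: "submodule W R M" "S \<subseteq> W" for W
    using S(3) linear_combination_in_submodule[OF W(1) S(1) W(2)] by (metis subsetI)
  then show "\<exists>S. finite S \<and> S \<subseteq> carrier M \<and> (\<forall>W. submodule W R M \<longrightarrow> S \<subseteq> W \<longrightarrow> carrier M \<subseteq> W)"
    using S(1,2) by blast
next
  assume "\<exists>S. finite S \<and> S \<subseteq> carrier M \<and> (\<forall>W. submodule W R M \<longrightarrow> S \<subseteq> W \<longrightarrow> carrier M \<subseteq> W)"
  then obtain S where S: "finite S" "S \<subseteq> carrier M"
    and gen: "\<And>W. \<lbrakk>submodule W R M; S \<subseteq> W\<rbrakk> \<Longrightarrow> carrier M \<subseteq> W" by blast
  let ?V = "{\<Oplus>\<^bsub>M\<^esub>s\<in>S. c s \<odot>\<^bsub>M\<^esub> s | c. c \<in> S \<rightarrow> carrier R}"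
  have "t \<in> ?V" if t: "t \<in> S" for t
  proof -
    have "(\<Oplus>\<^bsub>M\<^esub>s\<in>S. (if t = s then \<one> else \<zero>) \<odot>\<^bsub>M\<^esub> s) = (\<Oplus>\<^bsub>M\<^esub>s\<in>S. if t = s then s else \<zero>\<^bsub>M\<^esub>)"
      using S(2) by (intro M.finsum_cong') (auto simp: smult_one smult_l_null)
    also have "\<dots> = t" using t S by (intro M.add.finprod_singleton) auto
    finally show ?thesis by (auto intro!: exI[of _ "\<lambda>s. if t = s then \<one> else \<zero>"])
  qed
  then have "carrier M \<subseteq> ?V" by (intro gen linear_combinations_submodule[OF S]) blast
  then show "fin_gen R M" unfolding fin_gen_def using S by blast
qed

text \<open>The chain condition passes from the ring to finitely generated modules, for operators \<open>\<beta>\<close> on the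
  module that move a scalar by \<open>\<alpha>\<close>. Adjoin the generators one at a time. A chain \<open>N n\<close> that is
  stationary on a submodule \<open>B\<close> is stationary on \<open>B + R s\<close> once the coefficients of \<open>s\<close> in elements of
  \<open>N n\<close>, modulo \<open>B\<close>, are: these form a descending chain of \<open>\<alpha>\<close>-stable subgroups of the ring.\<close>

lemma fin_gen_op_artinian:
  assumes fg: "fin_gen R M" and art: "op_artinian T \<alpha> R"
    and \<alpha>: "\<And>t a. \<lbrakk>t \<in> T; a \<in> carrier R\<rbrakk> \<Longrightarrow> \<alpha> t a \<in> carrier R"
    and \<beta>_add: "\<And>t x y. \<lbrakk>t \<in> T; x \<in> carrier M; y \<in> carrier M\<rbrakk> \<Longrightarrow> \<beta> t (x \<oplus>\<^bsub>M\<^esub> y) = \<beta> t x \<oplus>\<^bsub>M\<^esub> \<beta> t y"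
    and \<beta>_smult: "\<And>t a x. \<lbrakk>t \<in> T; a \<in> carrier R; x \<in> carrier M\<rbrakk> \<Longrightarrow> \<beta> t (a \<odot>\<^bsub>M\<^esub> x) = \<alpha> t a \<odot>\<^bsub>M\<^esub> x"
  shows "op_artinian T \<beta> M"
proof (rule op_artinianI)
  fix N :: "nat \<Rightarrow> 'b set"
  assume N: "\<And>n. additive_subgroup (N n) M"
    and NT: "\<And>n t x. \<lbrakk>t \<in> T; x \<in> N n\<rbrakk> \<Longrightarrow> \<beta> t x \<in> N n"
    and dec: "\<And>m n. n \<le> m \<Longrightarrow> N m \<subseteq> N n"
  have Nc: "x \<in> carrier M" if "x \<in> N n" for x n
    using additive_subgroup.a_subset[OF N[of n]] that by blast
  have Nz: "\<zero>\<^bsub>M\<^esub> \<in> N n" for n by (rule additive_subgroup.zero_closed[OF N])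
  have Na: "x \<oplus>\<^bsub>M\<^esub> y \<in> N n" if "x \<in> N n" "y \<in> N n" for x y n
    by (rule additive_subgroup.a_closed[OF N that])
  have Ni: "\<ominus>\<^bsub>M\<^esub> x \<in> N n" if "x \<in> N n" for x n
    by (rule additive_subgroup.a_inv_closed[OF N that])
  have \<beta>0: "\<beta> t \<zero>\<^bsub>M\<^esub> = \<zero>\<^bsub>M\<^esub>" if "t \<in> T" for t
    using \<beta>_smult[OF that R.zero_closed M.zero_closed] \<alpha>[OF that] by (simp add: smult_r_null)
  have *: "\<exists>B. submodule B R M \<and> S \<subseteq> B \<and> (\<forall>t\<in>T. \<forall>x\<in>B. \<beta> t x \<in> B) \<and>
      (\<exists>n. \<forall>m\<ge>n. N n \<inter> B \<subseteq> N m)" if "finite S" "S \<subseteq> carrier M" for S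
    using that
  proof (induction S rule: finite_induct)
    case empty
    show ?case
      by (rule exI[of _ "{\<zero>\<^bsub>M\<^esub>}"]) (auto intro!: left_submoduleI simp: smult_r_null \<beta>0 Nz)
  next
    case (insert s S)
    then obtain B n where sub: "submodule B R M" and SB: "S \<subseteq> B"
      and Bt: "\<forall>t\<in>T. \<forall>x\<in>B. \<beta> t x \<in> B" and n: "\<forall>m\<ge>n. N n \<inter> B \<subseteq> N m"
      by auto
    note B = submodule_closed(1,2)[OF sub] and Ba = submodule_closed(3)[OF sub]
      and Bs = submodule_closed(4)[OF sub]
    have s: "s \<in> carrier M" using insert by auto
    have Bc: "x \<in> carrier M" if "x \<in> B" for x using B that by blast
    have Bi: "\<ominus>\<^bsub>M\<^esub> x \<in> B" if "x \<in> B" for x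
      using Bs[OF R.a_inv_closed[OF R.one_closed] that] Bc[OF that]
      by (simp add: smult_l_minus smult_one)
    note [simp] = s Bc Nc smult_closed Ba Bs Bt Bi \<alpha> \<beta>_add \<beta>_smult
    define B' where "B' = {b \<oplus>\<^bsub>M\<^esub> a \<odot>\<^bsub>M\<^esub> s | a b. a \<in> carrier R \<and> b \<in> B}"
    define I where "I i = {a \<in> carrier R. \<exists>b\<in>B. b \<oplus>\<^bsub>M\<^esub> a \<odot>\<^bsub>M\<^esub> s \<in> N i}" for i
    have swap: "(b \<oplus>\<^bsub>M\<^esub> a \<odot>\<^bsub>M\<^esub> s) \<oplus>\<^bsub>M\<^esub> (b' \<oplus>\<^bsub>M\<^esub> a' \<odot>\<^bsub>M\<^esub> s) = (b \<oplus>\<^bsub>M\<^esub> b') \<oplus>\<^bsub>M\<^esub> (a \<oplus> a') \<odot>\<^bsub>M\<^esub> s"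
      if "a \<in> carrier R" "a' \<in> carrier R" "b \<in> B" "b' \<in> B" for a a' b b'
      using that by (simp add: smult_l_distr M.a_ac)
    have "additive_subgroup (I i) R" for i
    proof (rule R.additive_subgroupI)
      show "\<zero> \<in> I i" unfolding I_def using B(2) by (auto intro!: bexI[of _ "\<zero>\<^bsub>M\<^esub>"] simp: smult_l_null Nz)
    next
      fix x y assume "x \<in> I i" "y \<in> I i"
      then obtain b b' where *: "x \<in> carrier R" "y \<in> carrier R" "b \<in> B" "b' \<in> B"
        "b \<oplus>\<^bsub>M\<^esub> x \<odot>\<^bsub>M\<^esub> s \<in> N i" "b' \<oplus>\<^bsub>M\<^esub> y \<odot>\<^bsub>M\<^esub> s \<in> N i" unfolding I_def by blast
      then show "x \<oplus> y \<in> I i"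
        using Na[OF *(5,6)] unfolding I_def by (auto simp: swap intro!: bexI[of _ "b \<oplus>\<^bsub>M\<^esub> b'"])
    next
      fix x assume "x \<in> I i"
      then obtain b where *: "x \<in> carrier R" "b \<in> B" "b \<oplus>\<^bsub>M\<^esub> x \<odot>\<^bsub>M\<^esub> s \<in> N i"
        unfolding I_def by blast
      then show "\<ominus> x \<in> I i"
        using Ni[OF *(3)] unfolding I_def
        by (auto simp: smult_l_minus M.minus_add intro!: bexI[of _ "\<ominus>\<^bsub>M\<^esub> b"])
    qed (auto simp: I_def)
    moreover have "\<alpha> t x \<in> I i" if t: "t \<in> T" and x: "x \<in> I i" for t x i
    proof -
      from x obtain b where *: "x \<in> carrier R" "b \<in> B" "b \<oplus>\<^bsub>M\<^esub> x \<odot>\<^bsub>M\<^esub> s \<in> N i"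
        unfolding I_def by blast
      then show ?thesis
        using NT[OF t *(3)] t unfolding I_def by (auto intro!: bexI[of _ "\<beta> t b"])
    qed
    moreover have "I (Suc i) \<subseteq> I i" for i
      using dec[of i "Suc i"] unfolding I_def by auto
    ultimately obtain k where k: "\<And>m. k \<le> m \<Longrightarrow> I m = I k"
      using op_artinianD[OF art, of I] by metis
    have "N (max n k) \<inter> B' \<subseteq> N m" if m: "max n k \<le> m" for m
    proof
      fix v assume "v \<in> N (max n k) \<inter> B'"
      then obtain a b where v: "v \<in> N (max n k)" "v = b \<oplus>\<^bsub>M\<^esub> a \<odot>\<^bsub>M\<^esub> s" "a \<in> carrier R" "b \<in> B"
        unfolding B'_def by auto
      then have "a \<in> I (max n k)" unfolding I_def by auto
      then have "a \<in> I m" using k[of m] k[of "max n k"] m by simp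
      then obtain b' where b': "b' \<in> B" "b' \<oplus>\<^bsub>M\<^esub> a \<odot>\<^bsub>M\<^esub> s \<in> N m" unfolding I_def by auto
      \<comment> \<open>The coefficient \<open>a\<close> of \<open>v\<close> also occurs in \<open>N m\<close>, with some \<open>b'\<close> in place of \<open>b\<close>; the
        difference lies in \<open>B\<close>, where the chain is already stationary.\<close>
      have eq: "v = (b \<oplus>\<^bsub>M\<^esub> \<ominus>\<^bsub>M\<^esub> b') \<oplus>\<^bsub>M\<^esub> (b' \<oplus>\<^bsub>M\<^esub> a \<odot>\<^bsub>M\<^esub> s)"
        using v b' by (simp add: M.a_assoc M.r_neg1)
      have "b' \<oplus>\<^bsub>M\<^esub> a \<odot>\<^bsub>M\<^esub> s \<in> N (max n k)" using dec[OF m] b'(2) by blast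
      then have "v \<oplus>\<^bsub>M\<^esub> \<ominus>\<^bsub>M\<^esub> (b' \<oplus>\<^bsub>M\<^esub> a \<odot>\<^bsub>M\<^esub> s) \<in> N (max n k)" using Na[OF v(1) Ni] by blast
      moreover have "v \<oplus>\<^bsub>M\<^esub> \<ominus>\<^bsub>M\<^esub> (b' \<oplus>\<^bsub>M\<^esub> a \<odot>\<^bsub>M\<^esub> s) = b \<oplus>\<^bsub>M\<^esub> \<ominus>\<^bsub>M\<^esub> b'"
        unfolding eq using v b' by (simp add: M.a_assoc M.r_neg)
      ultimately have "b \<oplus>\<^bsub>M\<^esub> \<ominus>\<^bsub>M\<^esub> b' \<in> N n" using dec[of n "max n k"] by auto
      moreover have "b \<oplus>\<^bsub>M\<^esub> \<ominus>\<^bsub>M\<^esub> b' \<in> B" using v b' by simp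
      moreover have "n \<le> m" using m by simp
      ultimately have "b \<oplus>\<^bsub>M\<^esub> \<ominus>\<^bsub>M\<^esub> b' \<in> N m" using n by blast
      then show "v \<in> N m" unfolding eq using b' Na by blast
    qed
    then have st: "\<exists>n. \<forall>m\<ge>n. N n \<inter> B' \<subseteq> N m" by blast
    have "s \<in> B'"
      unfolding B'_def using B(2) by (auto intro!: exI[of _ \<one>] exI[of _ "\<zero>\<^bsub>M\<^esub>"] simp: smult_one)
    have B_B': "b \<in> B'" if "b \<in> B" for b
      unfolding B'_def using that by (auto intro!: exI[of _ \<zero>] exI[of _ b] simp: smult_l_null)
    have "x \<oplus>\<^bsub>M\<^esub> y \<in> B'" if xy: "x \<in> B'" "y \<in> B'" for x y
    proof -
      obtain c b c' b' where *: "c \<in> carrier R" "b \<in> B" "x = b \<oplus>\<^bsub>M\<^esub> c \<odot>\<^bsub>M\<^esub> s"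
        "c' \<in> carrier R" "b' \<in> B" "y = b' \<oplus>\<^bsub>M\<^esub> c' \<odot>\<^bsub>M\<^esub> s"
        using xy unfolding B'_def mem_Collect_eq by (elim exE conjE) (rule that)
      have "x \<oplus>\<^bsub>M\<^esub> y = (b \<oplus>\<^bsub>M\<^esub> b') \<oplus>\<^bsub>M\<^esub> (c \<oplus> c') \<odot>\<^bsub>M\<^esub> s"
        using swap * by blast
      moreover have "b \<oplus>\<^bsub>M\<^esub> b' \<in> B" "c \<oplus> c' \<in> carrier R" using * by simp_all
      ultimately show ?thesis unfolding B'_def by blast
    qed
    moreover have "a \<odot>\<^bsub>M\<^esub> x \<in> B'" if a: "a \<in> carrier R" and x: "x \<in> B'" for a x
    proof -
      obtain c b where *: "c \<in> carrier R" "b \<in> B" "x = b \<oplus>\<^bsub>M\<^esub> c \<odot>\<^bsub>M\<^esub> s" using x unfolding B'_def by auto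
      show ?thesis unfolding B'_def using * a
        by (auto intro!: exI[of _ "a \<otimes> c"] exI[of _ "a \<odot>\<^bsub>M\<^esub> b"] simp: smult_r_distr smult_assoc1)
    qed
    moreover have "\<beta> t x \<in> B'" if t: "t \<in> T" and x: "x \<in> B'" for t x
    proof -
      obtain c b where *: "c \<in> carrier R" "b \<in> B" "x = b \<oplus>\<^bsub>M\<^esub> c \<odot>\<^bsub>M\<^esub> s" using x unfolding B'_def by auto
      show ?thesis unfolding B'_def using * t
        by (auto intro!: exI[of _ "\<alpha> t c"] exI[of _ "\<beta> t b"])
    qed
    moreover have "B' \<subseteq> carrier M" unfolding B'_def by auto
    moreover have "\<zero>\<^bsub>M\<^esub> \<in> B'" using B B_B' by auto
    ultimately have "submodule B' R M" "\<forall>t\<in>T. \<forall>x\<in>B'. \<beta> t x \<in> B'"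
      by (auto intro!: left_submoduleI)
    moreover have "insert s S \<subseteq> B'" using SB \<open>s \<in> B'\<close> B_B' by auto
    ultimately show ?case using st by blast
  qed
  obtain S where S: "finite S" "S \<subseteq> carrier M"
    and gen: "\<And>W. \<lbrakk>submodule W R M; S \<subseteq> W\<rbrakk> \<Longrightarrow> carrier M \<subseteq> W"
    using fg unfolding fin_gen_iff by blast
  from *[OF S] obtain B n where B: "submodule B R M" "S \<subseteq> B"
      and n: "\<forall>m\<ge>n. N n \<inter> B \<subseteq> N m" by blast
  have "carrier M \<subseteq> B" using gen B by blast
  then have "N n \<subseteq> B" using Nc by blast
  then show "\<exists>n. \<forall>m\<ge>n. N n \<subseteq> N m" using n by (intro exI[of _ n]) blast
qed

end

text \<open>Climb from \<open>R\<close> to the \<open>R\<close>-module \<open>\<Lambda>\<close> and from \<open>\<Lambda>\<close> to \<open>M\<close>, each time by \<open>fin_gen_op_artinian\<close>. The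
  scalar \<open>r \<in> R\<close> acts on \<open>R\<close> and \<open>\<Lambda>\<close> by multiplication and on \<open>M\<close> through the structure map
  \<open>r \<mapsto> r \<odot> \<one>\<close>.\<close>

lemma artin_algebra_op_artinian:
  fixes M :: "('a, 'b, 'm) module_scheme"
  assumes art: "artin_algebra R \<Lambda>" and M: "left_module \<Lambda> M" and fg: "fin_gen \<Lambda> M"
  shows "op_artinian (carrier R) (\<lambda>r m. (r \<odot>\<^bsub>\<Lambda>\<^esub> \<one>\<^bsub>\<Lambda>\<^esub>) \<odot>\<^bsub>M\<^esub> m) M"
proof -
  have R: "artinian_cring R" and "module R \<Lambda>" and "ring \<Lambda>" and fgL: "fin_gen R \<Lambda>"
    and assoc: "\<And>r a b. \<lbrakk>r \<in> carrier R; a \<in> carrier \<Lambda>; b \<in> carrier \<Lambda>\<rbrakk> \<Longrightarrow>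
        (r \<odot>\<^bsub>\<Lambda>\<^esub> a) \<otimes>\<^bsub>\<Lambda>\<^esub> b = r \<odot>\<^bsub>\<Lambda>\<^esub> (a \<otimes>\<^bsub>\<Lambda>\<^esub> b)"
    using art unfolding artin_algebra_def by auto
  have ringR: "ring R" using R unfolding artinian_cring_def by (simp add: cring.axioms)
  interpret \<Lambda>: module R \<Lambda> by fact
  interpret M: left_module \<Lambda> M by fact
  interpret L: left_module R \<Lambda>
    by unfold_locales (auto simp: \<Lambda>.smult_l_distr \<Lambda>.smult_r_distr \<Lambda>.smult_assoc1)
  have "op_artinian (carrier R) (\<lambda>r a. r \<otimes>\<^bsub>R\<^esub> a) R"
  proof (rule op_artinianI)
    fix I :: "nat \<Rightarrow> _" assume I: "\<And>n. additive_subgroup (I n) R"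
      "\<And>n t x. \<lbrakk>t \<in> carrier R; x \<in> I n\<rbrakk> \<Longrightarrow> t \<otimes>\<^bsub>R\<^esub> x \<in> I n"
      "\<And>m n. n \<le> m \<Longrightarrow> I m \<subseteq> I n"
    have "ideal (I n) R" for n
    proof (intro ideal.intro ideal_axioms.intro)
      show "additive_subgroup (I n) R" by (rule I)
      fix a x assume ax: "a \<in> I n" "x \<in> carrier R"
      then show "x \<otimes>\<^bsub>R\<^esub> a \<in> I n" by (simp add: I)
      then show "a \<otimes>\<^bsub>R\<^esub> x \<in> I n"
        using ax additive_subgroup.a_subset[OF I(1)[of n]] by (metis \<Lambda>.m_comm subsetD)
    qed (rule ringR)
    moreover have "I (Suc n) \<subseteq> I n" for n by (intro I) simp
    ultimately have "\<exists>n. \<forall>m\<ge>n. I m = I n"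
      using R unfolding artinian_cring_def by blast
    then show "\<exists>n. \<forall>m\<ge>n. I n \<subseteq> I m" by blast
  qed
  then have "op_artinian (carrier R) (\<lambda>r a. r \<odot>\<^bsub>\<Lambda>\<^esub> a) \<Lambda>"
    by (rule L.fin_gen_op_artinian[OF fgL]) (auto simp: \<Lambda>.smult_r_distr \<Lambda>.smult_assoc1)
  then show ?thesis
    by (rule M.fin_gen_op_artinian[OF fg])
      (auto simp: M.smult_r_distr M.smult_assoc1[symmetric] assoc M.smult_closed)
qed

section \<open>Fitting elements of an endomorphism ring\<close>

text \<open>Everything that commutes with whatever commutes with \<open>x\<close>. It is a commutative subring that contains
  \<open>x\<close> and the centre, so it can take the place of the polynomials in \<open>x\<close> with central coefficients
  while all closure properties are immediate.\<close>

definition bicommutant :: "('a, 'k) ring_scheme \<Rightarrow> 'a \<Rightarrow> 'a set" where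
  "bicommutant E x =
     {q \<in> carrier E. \<forall>a\<in>carrier E. a \<otimes>\<^bsub>E\<^esub> x = x \<otimes>\<^bsub>E\<^esub> a \<longrightarrow> a \<otimes>\<^bsub>E\<^esub> q = q \<otimes>\<^bsub>E\<^esub> a}"

context ring
begin

lemma bicommutant_closed: "q \<in> bicommutant R x \<Longrightarrow> q \<in> carrier R"
  by (simp add: bicommutant_def)

lemma bicommutant_commute:
  assumes x: "x \<in> carrier R" and p: "p \<in> bicommutant R x" and q: "q \<in> bicommutant R x"
  shows "p \<otimes> q = q \<otimes> p"
proof -
  have "p \<otimes> x = x \<otimes> p" using p x unfolding bicommutant_def by (simp add: eq_commute)
  then show ?thesis using p q unfolding bicommutant_def by blast
qed

lemma bicommutant_self: "x \<in> carrier R \<Longrightarrow> x \<in> bicommutant R x"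
  by (simp add: bicommutant_def)

lemma bicommutant_zero: "\<zero> \<in> bicommutant R x"
  by (simp add: bicommutant_def)

lemma bicommutant_one: "\<one> \<in> bicommutant R x"
  by (simp add: bicommutant_def)

lemma bicommutant_add:
  "\<lbrakk>p \<in> bicommutant R x; q \<in> bicommutant R x\<rbrakk> \<Longrightarrow> p \<oplus> q \<in> bicommutant R x"
  by (simp add: bicommutant_def l_distr r_distr)

lemma bicommutant_uminus: "p \<in> bicommutant R x \<Longrightarrow> \<ominus> p \<in> bicommutant R x"
  by (simp add: bicommutant_def l_minus r_minus)

lemma bicommutant_minus:
  "\<lbrakk>p \<in> bicommutant R x; q \<in> bicommutant R x\<rbrakk> \<Longrightarrow> p \<ominus> q \<in> bicommutant R x"
  by (simp add: a_minus_def bicommutant_add bicommutant_uminus)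

lemma bicommutant_mult:
  assumes "p \<in> bicommutant R x" "q \<in> bicommutant R x"
  shows "p \<otimes> q \<in> bicommutant R x"
proof -
  have "a \<otimes> (p \<otimes> q) = p \<otimes> q \<otimes> a" if a: "a \<in> carrier R" "a \<otimes> x = x \<otimes> a" for a
  proof -
    have "a \<otimes> p = p \<otimes> a" "a \<otimes> q = q \<otimes> a" "p \<in> carrier R" "q \<in> carrier R"
      using assms a unfolding bicommutant_def by blast+
    then show ?thesis using a by (metis m_assoc)
  qed
  then show ?thesis using assms unfolding bicommutant_def by simp
qed

lemma bicommutant_pow:
  "p \<in> bicommutant R x \<Longrightarrow> p [^] (n::nat) \<in> bicommutant R x"
  by (induction n) (simp_all add: bicommutant_one bicommutant_mult)

text \<open>If \<open>x\<close> has a Fitting decomposition, such an element can vanish: \<open>x\<^sup>n\<close> is zero on the nilpotent part,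
  and on the part where \<open>x\<close> is invertible \<open>q\<close> can be its inverse.\<close>

definition fitting_elements :: "'a \<Rightarrow> 'a set" where
  "fitting_elements x = {x [^] n \<otimes> (\<one> \<ominus> x \<otimes> q) | (n::nat) q. q \<in> bicommutant R x}"

lemma fitting_elements_bicommutant:
  assumes "x \<in> carrier R" "t \<in> fitting_elements x"
  shows "t \<in> bicommutant R x"
  using assms unfolding fitting_elements_def
  by (auto intro!: bicommutant_mult bicommutant_minus bicommutant_one bicommutant_pow bicommutant_self)

lemma one_fitting_elements: "x \<in> carrier R \<Longrightarrow> \<one> \<in> fitting_elements x"
  unfolding fitting_elements_def
  by (auto intro!: exI[of _ "0::nat"] exI[of _ \<zero>] simp: bicommutant_zero minus_eq)

text \<open>Factors commute, and \<open>(1 - x p) (1 - x q) = 1 - x (p + q - p x q)\<close>.\<close>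

lemma fitting_elements_mult:
  assumes x: "x \<in> carrier R" and s: "s \<in> fitting_elements x" and t: "t \<in> fitting_elements x"
  shows "s \<otimes> t \<in> fitting_elements x"
proof -
  obtain n p where s_eq: "s = x [^] (n::nat) \<otimes> (\<one> \<ominus> x \<otimes> p)" and p: "p \<in> bicommutant R x"
    using s unfolding fitting_elements_def by auto
  obtain m q where t_eq: "t = x [^] (m::nat) \<otimes> (\<one> \<ominus> x \<otimes> q)" and q: "q \<in> bicommutant R x"
    using t unfolding fitting_elements_def by auto
  note comm = bicommutant_commute[OF x] and bic = bicommutant_mult bicommutant_minus
    bicommutant_one bicommutant_pow bicommutant_self[OF x] bicommutant_add p q
  have pc: "p \<in> carrier R" and qc: "q \<in> carrier R" using p q by (auto dest: bicommutant_closed)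
  have "(\<one> \<ominus> x \<otimes> p) \<otimes> x [^] m = x [^] m \<otimes> (\<one> \<ominus> x \<otimes> p)"
    by (intro comm bic)
  then have "s \<otimes> t = x [^] (n + m) \<otimes> ((\<one> \<ominus> x \<otimes> p) \<otimes> (\<one> \<ominus> x \<otimes> q))"
    unfolding s_eq t_eq using x pc qc by (simp add: nat_pow_mult[symmetric] m_assoc) (metis m_assoc minus_closed m_closed nat_pow_closed one_closed)
  moreover have "(\<one> \<ominus> x \<otimes> p) \<otimes> (\<one> \<ominus> x \<otimes> q) = \<one> \<ominus> x \<otimes> (p \<oplus> q \<ominus> p \<otimes> (x \<otimes> q))"
    using x pc qc by (simp add: a_minus_def l_distr r_distr l_minus r_minus minus_add a_ac m_assoc)
  ultimately have "s \<otimes> t = x [^] (n + m) \<otimes> (\<one> \<ominus> x \<otimes> (p \<oplus> q \<ominus> p \<otimes> (x \<otimes> q)))" by simp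
  moreover have "p \<oplus> q \<ominus> p \<otimes> (x \<otimes> q) \<in> bicommutant R x" by (intro bic)
  ultimately show ?thesis unfolding fitting_elements_def by blast
qed

text \<open>The subgroups \<open>x\<^sup>n P m\<close>, with \<open>P\<close> the bicommutant of \<open>x\<close>, descend; where the chain is stationary,
  \<open>x\<^sup>n m = x\<^bsup>n+1\<^esup> q m\<close> for some \<open>q \<in> P\<close>.\<close>

lemma fitting_element_kills_point:
  fixes M :: "('a, 'c, 'm) module_scheme"
  assumes M: "left_module R M" and x: "x \<in> carrier R"
    and \<kappa>: "\<And>t. t \<in> T \<Longrightarrow> \<kappa> t \<in> bicommutant R x"
    and art: "op_artinian T (\<lambda>t m. \<kappa> t \<odot>\<^bsub>M\<^esub> m) M" and m: "m \<in> carrier M"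
  shows "\<exists>t\<in>fitting_elements x. t \<odot>\<^bsub>M\<^esub> m = \<zero>\<^bsub>M\<^esub>"
proof -
  interpret M: left_module R M by (rule M)
  define N where "N n = {(x [^] (n::nat) \<otimes> q) \<odot>\<^bsub>M\<^esub> m | q. q \<in> bicommutant R x}" for n
  have xn: "x [^] (n::nat) \<in> carrier R" for n using x by simp
  note bc = bicommutant_closed[of _ x]
  have sub: "additive_subgroup (N n) M" for n
  proof (rule M.M.additive_subgroupI)
    show "N n \<subseteq> carrier M" unfolding N_def using xn m by (auto intro!: M.smult_closed dest: bc)
    show "\<zero>\<^bsub>M\<^esub> \<in> N n" unfolding N_def using xn m
      by (auto intro!: exI[of _ \<zero>] simp: bicommutant_zero M.smult_l_null)
  next
    fix u v assume "u \<in> N n" "v \<in> N n"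
    then obtain p q where "p \<in> bicommutant R x" "u = (x [^] n \<otimes> p) \<odot>\<^bsub>M\<^esub> m"
      "q \<in> bicommutant R x" "v = (x [^] n \<otimes> q) \<odot>\<^bsub>M\<^esub> m" unfolding N_def by auto
    then show "u \<oplus>\<^bsub>M\<^esub> v \<in> N n" unfolding N_def using xn m
      by (auto intro!: exI[of _ "p \<oplus> q"] bicommutant_add simp: r_distr M.smult_l_distr bc)
  next
    fix u assume "u \<in> N n"
    then obtain p where "p \<in> bicommutant R x" "u = (x [^] n \<otimes> p) \<odot>\<^bsub>M\<^esub> m" unfolding N_def by auto
    then show "\<ominus>\<^bsub>M\<^esub> u \<in> N n" unfolding N_def using xn m
      by (auto intro!: exI[of _ "\<ominus> p"] bicommutant_uminus simp: r_minus M.smult_l_minus bc)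
  qed
  have stable: "\<kappa> t \<odot>\<^bsub>M\<^esub> u \<in> N n" if t: "t \<in> T" and u: "u \<in> N n" for t u n
  proof -
    obtain p where p: "p \<in> bicommutant R x" "u = (x [^] n \<otimes> p) \<odot>\<^bsub>M\<^esub> m"
      using u unfolding N_def by auto
    have "\<kappa> t \<otimes> (x [^] n \<otimes> p) = x [^] n \<otimes> (\<kappa> t \<otimes> p)"
      using bicommutant_commute[OF x \<kappa>[OF t] bicommutant_pow[OF bicommutant_self[OF x], of n]]
        bc[OF \<kappa>[OF t]] bc[OF p(1)] xn[of n] by (metis m_assoc)
    then have "\<kappa> t \<odot>\<^bsub>M\<^esub> u = (x [^] n \<otimes> (\<kappa> t \<otimes> p)) \<odot>\<^bsub>M\<^esub> m"
      using p xn m bc[OF \<kappa>[OF t]] bc[OF p(1)] by (simp add: M.smult_assoc1[symmetric])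
    then show ?thesis unfolding N_def using bicommutant_mult[OF \<kappa>[OF t] p(1)] by blast
  qed
  have dec: "N (Suc n) \<subseteq> N n" for n
  proof
    fix u assume "u \<in> N (Suc n)"
    then obtain p where p: "p \<in> bicommutant R x" "u = (x [^] Suc n \<otimes> p) \<odot>\<^bsub>M\<^esub> m"
      unfolding N_def by auto
    then have "u = (x [^] n \<otimes> (x \<otimes> p)) \<odot>\<^bsub>M\<^esub> m" using x by (simp add: m_assoc bc)
    then show "u \<in> N n" unfolding N_def
      using bicommutant_mult[OF bicommutant_self[OF x] p(1)] by blast
  qed
  obtain n where n: "\<And>k. n \<le> k \<Longrightarrow> N k = N n"
    using op_artinianD[where N = N, OF art sub stable dec] by blast
  have "(x [^] n \<otimes> \<one>) \<odot>\<^bsub>M\<^esub> m \<in> N n" unfolding N_def using bicommutant_one by blast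
  then have "(x [^] n \<otimes> \<one>) \<odot>\<^bsub>M\<^esub> m \<in> N (Suc n)" using n[of "Suc n"] by simp
  then obtain q where q: "q \<in> bicommutant R x"
    and eq: "(x [^] n \<otimes> \<one>) \<odot>\<^bsub>M\<^esub> m = (x [^] Suc n \<otimes> q) \<odot>\<^bsub>M\<^esub> m"
    unfolding N_def by blast
  have "x [^] n \<otimes> (\<one> \<ominus> x \<otimes> q) = x [^] n \<otimes> \<one> \<oplus> \<ominus> (x [^] Suc n \<otimes> q)"
    using x bc[OF q] by (simp add: a_minus_def r_distr r_minus m_assoc)
  then have "(x [^] n \<otimes> (\<one> \<ominus> x \<otimes> q)) \<odot>\<^bsub>M\<^esub> m
      = (x [^] n \<otimes> \<one>) \<odot>\<^bsub>M\<^esub> m \<oplus>\<^bsub>M\<^esub> \<ominus>\<^bsub>M\<^esub> ((x [^] Suc n \<otimes> q) \<odot>\<^bsub>M\<^esub> m)"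
    using x bc[OF q] m by (simp add: M.smult_l_distr M.smult_l_minus del: nat_pow_Suc)
  also have "\<dots> = \<zero>\<^bsub>M\<^esub>"
    unfolding eq using x bc[OF q] m by (intro M.M.r_neg M.smult_closed) auto
  finally show ?thesis unfolding fitting_elements_def using q by blast
qed

lemma fitting_element_kills_finite:
  fixes M :: "('a, 'c, 'm) module_scheme"
  assumes M: "left_module R M" and x: "x \<in> carrier R"
    and \<kappa>: "\<And>t. t \<in> T \<Longrightarrow> \<kappa> t \<in> bicommutant R x"
    and art: "op_artinian T (\<lambda>t m. \<kappa> t \<odot>\<^bsub>M\<^esub> m) M"
    and S: "finite S" "S \<subseteq> carrier M"
  shows "\<exists>t\<in>fitting_elements x. \<forall>s\<in>S. t \<odot>\<^bsub>M\<^esub> s = \<zero>\<^bsub>M\<^esub>"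
  using S
proof (induction S rule: finite_induct)
  case empty
  then show ?case using one_fitting_elements[OF x] by blast
next
  case (insert s S)
  interpret M: left_module R M by (rule M)
  obtain t where t: "t \<in> fitting_elements x" "\<forall>s\<in>S. t \<odot>\<^bsub>M\<^esub> s = \<zero>\<^bsub>M\<^esub>" using insert by auto
  obtain u where u: "u \<in> fitting_elements x" "u \<odot>\<^bsub>M\<^esub> s = \<zero>\<^bsub>M\<^esub>"
    using fitting_element_kills_point[OF M x \<kappa> art, of s] insert.prems by auto
  note bic = fitting_elements_bicommutant[OF x t(1)] fitting_elements_bicommutant[OF x u(1)]
  note c = bic[THEN bicommutant_closed]
  have "t \<otimes> u = u \<otimes> t" by (rule bicommutant_commute[OF x bic])
  then have "(t \<otimes> u) \<odot>\<^bsub>M\<^esub> s' = \<zero>\<^bsub>M\<^esub>" if "s' \<in> insert s S" for s'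
    using that t(2) u(2) c insert.prems
    by (auto simp: M.smult_assoc1 M.smult_r_null) (metis M.smult_assoc1 M.smult_r_null subsetD)
  then show ?case using fitting_elements_mult[OF x t(1) u(1)] by blast
qed

text \<open>The hypothesis says \<open>x\<^sup>n = x\<^bsup>n+1\<^esup> q\<close>. Iterating, \<open>x\<^sup>k = x\<^bsup>2k\<^esup> q\<^sup>k\<close> for \<open>k \<ge> n\<close>, so \<open>w = x\<^sup>k\<close> and
  \<open>y = q\<^sup>k\<close> satisfy \<open>w w y = w\<close>, whence \<open>(w y) (w y) = (w w y) y = w y\<close>.\<close>

lemma fitting_idempotent:
  assumes x: "x \<in> carrier R" and zero: "\<zero> \<in> fitting_elements x"
  shows "\<exists>k>0. \<exists>y\<in>carrier R. let w = x [^] (k::nat) in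
    (w \<otimes> y) \<otimes> (w \<otimes> y) = w \<otimes> y \<and> w \<otimes> (w \<otimes> y) = w"
proof -
  obtain n q where q: "q \<in> bicommutant R x" and z: "\<zero> = x [^] (n::nat) \<otimes> (\<one> \<ominus> x \<otimes> q)"
    using zero unfolding fitting_elements_def by auto
  have qc: "q \<in> carrier R" using q by (rule bicommutant_closed)
  have "x [^] n \<otimes> (\<one> \<ominus> x \<otimes> q) = x [^] n \<ominus> x [^] Suc n \<otimes> q"
    using x qc by (simp add: a_minus_def r_distr r_minus m_assoc)
  then have xn: "x [^] n = x [^] Suc n \<otimes> q"
    using z x qc minus_equality[of "x [^] n" "\<ominus> (x [^] Suc n \<otimes> q)"]
    by (simp add: a_minus_def del: nat_pow_Suc)
  have step: "x [^] (i + n) = x [^] (Suc (i + n)) \<otimes> q" for i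
  proof -
    have "x [^] (i + n) = x [^] i \<otimes> (x [^] Suc n \<otimes> q)"
      using xn x by (simp only: nat_pow_mult[symmetric])
    also have "\<dots> = x [^] (i + Suc n) \<otimes> q"
      using x qc by (simp only: nat_pow_mult[symmetric] m_assoc nat_pow_closed)
    finally show ?thesis by simp
  qed
  \<comment> \<open>The exponent has to be positive: \<open>x\<^sup>k\<close> stands for an endomorphism over an idempotent \<open>e\<close>, and
  \<open>e\<^sup>k = e\<close> fails for \<open>k = 0\<close>.\<close>
  define k where "k = Suc n"
  have "x [^] k = x [^] (k + j) \<otimes> q [^] j" for j
  proof (induction j)
    case (Suc j)
    have "x [^] (k + j) = x [^] (k + Suc j) \<otimes> q" using step[of "Suc j"] by (simp add: k_def add.commute)
    then show ?case using Suc x qc by (metis m_assoc nat_pow_Suc2 nat_pow_closed)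
  qed (use x in simp)
  from this[of k] have w: "x [^] k = x [^] k \<otimes> (x [^] k \<otimes> q [^] k)"
    using x qc by (simp add: nat_pow_mult[symmetric] m_assoc)
  define w y where "w = x [^] k" and "y = q [^] k"
  have wy: "w \<in> carrier R" "y \<in> carrier R" "w = w \<otimes> (w \<otimes> y)" using w x qc by (auto simp: w_def y_def)
  have "w \<otimes> y = y \<otimes> w"
    unfolding w_def y_def by (intro bicommutant_commute[OF x] bicommutant_pow bicommutant_self x q)
  then have "(w \<otimes> y) \<otimes> (w \<otimes> y) = (w \<otimes> (w \<otimes> y)) \<otimes> y"
    using wy(1,2) by (metis m_assoc m_closed)
  then have "(w \<otimes> y) \<otimes> (w \<otimes> y) = w \<otimes> y" using wy(3) by simp
  then show ?thesis
    using wy unfolding Let_def w_def by (intro exI[of _ k] conjI bexI[of _ y]) (auto simp: k_def)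
qed

end

section \<open>Preadditive categories, split idempotents and the category of maps\<close>

text \<open>The arrows of a category between fixed objects are elements of one type, so every law is relative to
  the objects.\<close>

locale category_laws =
  fixes C :: "('o, 'm) precat"
  assumes ident_closed: "X \<in> Ob C \<Longrightarrow> Ident C X \<in> arrows C X X"
    and comp_closed: "\<lbrakk>X \<in> Ob C; Y \<in> Ob C; Z \<in> Ob C; f \<in> arrows C X Y; g \<in> arrows C Y Z\<rbrakk> \<Longrightarrow>
      Comp C X g f \<in> arrows C X Z"
    and comp_assoc: "\<lbrakk>X \<in> Ob C; Y \<in> Ob C; Z \<in> Ob C; W \<in> Ob C;
      f \<in> arrows C X Y; g \<in> arrows C Y Z; h \<in> arrows C Z W\<rbrakk> \<Longrightarrow>
      Comp C X (Comp C Y h g) f = Comp C X h (Comp C X g f)"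
    and ident_left: "\<lbrakk>X \<in> Ob C; Y \<in> Ob C; f \<in> arrows C X Y\<rbrakk> \<Longrightarrow> Comp C X (Ident C Y) f = f"
    and ident_right: "\<lbrakk>X \<in> Ob C; Y \<in> Ob C; f \<in> arrows C X Y\<rbrakk> \<Longrightarrow> Comp C X f (Ident C X) = f"
begin

lemma isomorphic_trans:
  assumes X: "X \<in> Ob C" and Y: "Y \<in> Ob C" and Z: "Z \<in> Ob C"
    and XY: "isomorphic C X Y" and YZ: "isomorphic C Y Z"
  shows "isomorphic C X Z"
proof -
  obtain f g where f: "f \<in> arrows C X Y" and g: "g \<in> arrows C Y X"
    and gf: "Comp C X g f = Ident C X" and fg: "Comp C Y f g = Ident C Y"
    using XY unfolding isomorphic_def by blast
  obtain h k where h: "h \<in> arrows C Y Z" and k: "k \<in> arrows C Z Y"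
    and kh: "Comp C Y k h = Ident C Y" and hk: "Comp C Z h k = Ident C Z"
    using YZ unfolding isomorphic_def by blast
  have hf: "Comp C X h f \<in> arrows C X Z" and gk: "Comp C Z g k \<in> arrows C Z X"
    by (rule comp_closed[OF X Y Z f h], rule comp_closed[OF Z Y X k g])
  have "Comp C X (Comp C Z g k) (Comp C X h f) = Comp C X g (Comp C X (Comp C Y k h) f)"
    using comp_assoc[OF X Z Y X hf k g] comp_assoc[OF X Y Z Y f h k] by simp
  moreover have "Comp C Z (Comp C X h f) (Comp C Z g k) = Comp C Z h (Comp C Z (Comp C Y f g) k)"
    using comp_assoc[OF Z X Y Z gk f h] comp_assoc[OF Z Y X Y k g f] by simp
  ultimately show ?thesis
    unfolding isomorphic_def using hf gk kh fg gf hk ident_left[OF X Y f] ident_left[OF Z Y k]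
    by (intro bexI[of _ "Comp C X h f"] bexI[of _ "Comp C Z g k"]) auto
qed

end

locale preadditive = category_laws C for C :: "('o, 'm) precat" +
  assumes hom_comm_group: "\<lbrakk>X \<in> Ob C; Y \<in> Ob C\<rbrakk> \<Longrightarrow> comm_group (Hom C X Y)"
    and comp_hom_left: "\<lbrakk>X \<in> Ob C; Y \<in> Ob C; Z \<in> Ob C; g \<in> arrows C Y Z\<rbrakk> \<Longrightarrow>
      (\<lambda>f. Comp C X g f) \<in> hom (Hom C X Y) (Hom C X Z)"
    and comp_hom_right: "\<lbrakk>X \<in> Ob C; Y \<in> Ob C; Z \<in> Ob C; f \<in> arrows C X Y\<rbrakk> \<Longrightarrow>
      (\<lambda>g. Comp C X g f) \<in> hom (Hom C Y Z) (Hom C X Z)"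
begin

lemma comp_add_left:
  assumes "X \<in> Ob C" "Y \<in> Ob C" "Z \<in> Ob C" "g \<in> arrows C Y Z" "f \<in> arrows C X Y" "f' \<in> arrows C X Y"
  shows "Comp C X g (f \<otimes>\<^bsub>Hom C X Y\<^esub> f') = Comp C X g f \<otimes>\<^bsub>Hom C X Z\<^esub> Comp C X g f'"
  using hom_mult[OF comp_hom_left[OF assms(1-4)] assms(5,6)] .

lemma comp_add_right:
  assumes "X \<in> Ob C" "Y \<in> Ob C" "Z \<in> Ob C" "f \<in> arrows C X Y" "g \<in> arrows C Y Z" "g' \<in> arrows C Y Z"
  shows "Comp C X (g \<otimes>\<^bsub>Hom C Y Z\<^esub> g') f = Comp C X g f \<otimes>\<^bsub>Hom C X Z\<^esub> Comp C X g' f"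
  using hom_mult[OF comp_hom_right[OF assms(1-4)] assms(5,6)] .

lemma comp_zero_left:
  assumes "X \<in> Ob C" "Y \<in> Ob C" "Z \<in> Ob C" "f \<in> arrows C X Y"
  shows "Comp C X \<one>\<^bsub>Hom C Y Z\<^esub> f = \<one>\<^bsub>Hom C X Z\<^esub>"
  using hom_one[OF comp_hom_right[OF assms]] hom_comm_group assms comm_group.axioms(2) by blast

lemma comp_zero_right:
  assumes "X \<in> Ob C" "Y \<in> Ob C" "Z \<in> Ob C" "g \<in> arrows C Y Z"
  shows "Comp C X g \<one>\<^bsub>Hom C X Y\<^esub> = \<one>\<^bsub>Hom C X Z\<^esub>"
  using hom_one[OF comp_hom_left[OF assms]] hom_comm_group assms comm_group.axioms(2) by blast

end

text \<open>Composition as ring multiplication, which makes the facts about Fitting elements applicable to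
  endomorphisms.\<close>

definition end_ring :: "('o, 'm) precat \<Rightarrow> 'o \<Rightarrow> 'm ring" where
  "end_ring C X = \<lparr>carrier = arrows C X X, mult = Comp C X, one = Ident C X,
     zero = \<one>\<^bsub>Hom C X X\<^esub>, add = (\<lambda>f g. f \<otimes>\<^bsub>Hom C X X\<^esub> g)\<rparr>"

lemma end_ring_simps [simp]:
  "carrier (end_ring C X) = arrows C X X" "mult (end_ring C X) = Comp C X"
  "\<one>\<^bsub>end_ring C X\<^esub> = Ident C X" "\<zero>\<^bsub>end_ring C X\<^esub> = \<one>\<^bsub>Hom C X X\<^esub>"
  "f \<oplus>\<^bsub>end_ring C X\<^esub> g = f \<otimes>\<^bsub>Hom C X X\<^esub> g"
  by (simp_all add: end_ring_def)

lemma (in preadditive) ring_end_ring: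
  assumes X: "X \<in> Ob C"
  shows "ring (end_ring C X)"
proof -
  interpret H: comm_group "Hom C X X" by (rule hom_comm_group[OF X X])
  show ?thesis
  proof (rule ringI)
    show "abelian_group (end_ring C X)"
    proof (rule abelian_groupI)
      fix x assume "x \<in> carrier (end_ring C X)"
      then show "\<exists>y\<in>carrier (end_ring C X). y \<oplus>\<^bsub>end_ring C X\<^esub> x = \<zero>\<^bsub>end_ring C X\<^esub>"
        by (auto intro!: bexI[of _ "inv\<^bsub>Hom C X X\<^esub> x"])
    qed (auto simp: H.m_ac)
    show "monoid (end_ring C X)"
      using X by unfold_locales
        (auto simp: comp_assoc ident_left ident_right intro: ident_closed comp_closed)
  qed (use X in \<open>auto simp: comp_add_left comp_add_right\<close>)
qed

definition idempotents_split :: "('o, 'm) precat \<Rightarrow> bool" where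
  "idempotents_split C \<longleftrightarrow> (\<forall>A\<in>Ob C. \<forall>p\<in>arrows C A A. Comp C A p p = p \<longrightarrow>
     (\<exists>B\<in>Ob C. \<exists>i\<in>arrows C B A. \<exists>r\<in>arrows C A B. Comp C B r i = Ident C B \<and> Comp C A i r = p))"

text \<open>The complement of the image of \<open>p\<close> is the image of \<open>1 - p\<close>.\<close>

lemma (in preadditive) split_direct_summand:
  assumes split: "idempotents_split C" and A: "A \<in> Ob C" and p: "p \<in> arrows C A A" "Comp C A p p = p"
  shows "\<exists>B\<in>Ob C. \<exists>i\<in>arrows C B A. \<exists>r\<in>arrows C A B.
    Comp C B r i = Ident C B \<and> Comp C A i r = p \<and> direct_summand C B A"
proof -
  interpret E: ring "end_ring C A" by (rule ring_end_ring[OF A])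
  define q where "q = \<one>\<^bsub>end_ring C A\<^esub> \<ominus>\<^bsub>end_ring C A\<^esub> p"
  have p': "p \<in> carrier (end_ring C A)" "p \<otimes>\<^bsub>end_ring C A\<^esub> p = p" using p by auto
  have q': "q \<in> carrier (end_ring C A)" unfolding q_def using p' by (intro E.minus_closed E.one_closed)
  then have q: "q \<in> arrows C A A" by simp
  have "p \<otimes>\<^bsub>end_ring C A\<^esub> q = \<zero>\<^bsub>end_ring C A\<^esub>"
    unfolding q_def a_minus_def using p'
    by (simp only: E.r_distr E.r_minus E.one_closed E.a_inv_closed E.r_one E.r_neg)
  then have pq: "Comp C A p q = \<one>\<^bsub>Hom C A A\<^esub>" by simp
  have qp': "q \<otimes>\<^bsub>end_ring C A\<^esub> p = \<zero>\<^bsub>end_ring C A\<^esub>"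
    unfolding q_def a_minus_def using p'
    by (simp only: E.l_distr E.l_minus E.one_closed E.a_inv_closed E.l_one E.r_neg)
  then have qp: "Comp C A q p = \<one>\<^bsub>Hom C A A\<^esub>" by simp
  have sum': "p \<oplus>\<^bsub>end_ring C A\<^esub> q = \<one>\<^bsub>end_ring C A\<^esub>"
    unfolding q_def a_minus_def using p' E.one_closed by (metis E.a_comm E.a_inv_closed E.a_assoc E.l_neg E.r_zero)
  then have sum: "p \<otimes>\<^bsub>Hom C A A\<^esub> q = Ident C A" by simp
  have "q \<otimes>\<^bsub>end_ring C A\<^esub> (p \<oplus>\<^bsub>end_ring C A\<^esub> q) = q \<otimes>\<^bsub>end_ring C A\<^esub> q"
    using E.r_distr[OF p'(1) q' q'] qp' E.l_zero[OF E.m_closed[OF q' q']] by (simp only:)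
  then have "q \<otimes>\<^bsub>end_ring C A\<^esub> q = q"
    unfolding sum' using E.r_one[of q] q by simp
  then have qq: "Comp C A q q = q" by simp
  obtain B i r where B: "B \<in> Ob C" and i: "i \<in> arrows C B A" and r: "r \<in> arrows C A B"
    and ri: "Comp C B r i = Ident C B" and ir: "Comp C A i r = p"
    using split A p unfolding idempotents_split_def by blast
  obtain Z j s where Z: "Z \<in> Ob C" and j: "j \<in> arrows C Z A" and s: "s \<in> arrows C A Z"
    and sj: "Comp C Z s j = Ident C Z" and js: "Comp C A j s = q"
    using split A q qq unfolding idempotents_split_def by blast
  \<comment> \<open>The two mixed composites vanish for the same reason: \<open>t k = t (l t) (k m) k\<close>, and the two
    idempotents \<open>l t\<close> and \<open>k m\<close> are orthogonal.\<close>
  have orth: "Comp C U t k = \<one>\<^bsub>Hom C U V\<^esub>"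
    if U: "U \<in> Ob C" and V: "V \<in> Ob C" and k: "k \<in> arrows C U A" and t: "t \<in> arrows C A V"
      and l: "l \<in> arrows C V A" and tl: "Comp C V t l = Ident C V"
      and m: "m \<in> arrows C A U" and mk: "Comp C U m k = Ident C U"
      and zero: "Comp C A (Comp C A l t) (Comp C A k m) = \<one>\<^bsub>Hom C A A\<^esub>" for U V k t l m
  proof -
    have lt: "Comp C A l t \<in> arrows C A A" and km: "Comp C A k m \<in> arrows C A A"
      by (rule comp_closed[OF A V A t l], rule comp_closed[OF A U A m k])
    have "Comp C A (Comp C A l t) (Comp C A k m) \<in> arrows C A A" by (rule comp_closed[OF A A A km lt])
    have t_eq: "t = Comp C A t (Comp C A l t)"
      using comp_assoc[OF A V A V t l t] tl ident_left[OF A V t] by simp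
    have k_eq: "k = Comp C U (Comp C A k m) k"
      using comp_assoc[OF U A U A k m k] mk ident_right[OF U A k] by simp
    have "Comp C U t k = Comp C U (Comp C A t (Comp C A l t)) (Comp C U (Comp C A k m) k)"
      using t_eq k_eq by simp
    also have "\<dots> = Comp C U t (Comp C U (Comp C A (Comp C A l t) (Comp C A k m)) k)"
      using comp_assoc[OF U A A V comp_closed[OF U A A k km] lt t] comp_assoc[OF U A A A k km lt] by simp
    also have "\<dots> = \<one>\<^bsub>Hom C U V\<^esub>"
      unfolding zero using comp_zero_left[OF U A A k] comp_zero_right[OF U A V t] by simp
    finally show ?thesis .
  qed
  have "Comp C Z r j = \<one>\<^bsub>Hom C Z B\<^esub>"
    by (rule orth[OF Z B j r i ri s sj]) (simp add: ir js pq)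
  moreover have "Comp C B s i = \<one>\<^bsub>Hom C B Z\<^esub>"
    by (rule orth[OF B Z i s j sj r ri]) (simp add: ir js qp)
  ultimately have "direct_summand C B A"
    unfolding direct_summand_def using Z i r j s ri sj ir js sum
    by (intro bexI[of _ Z] bexI[of _ i] bexI[of _ r] bexI[of _ j] bexI[of _ s]) auto
  then show ?thesis using B i r ri ir by blast
qed

lemma maps_cat_simps [simp]:
  "(A1, A0, f) \<in> Ob (maps_cat C) \<longleftrightarrow> A1 \<in> Ob C \<and> A0 \<in> Ob C \<and> f \<in> arrows C A1 A0"
  "(u1, u0) \<in> arrows (maps_cat C) (A1, A0, f) (B1, B0, g) \<longleftrightarrow>
     u1 \<in> arrows C A1 B1 \<and> u0 \<in> arrows C A0 B0 \<and> Comp C A1 g u1 = Comp C A1 u0 f"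
  "(u1, u0) \<otimes>\<^bsub>Hom (maps_cat C) (A1, A0, f) (B1, B0, g)\<^esub> (v1, v0) =
     (u1 \<otimes>\<^bsub>Hom C A1 B1\<^esub> v1, u0 \<otimes>\<^bsub>Hom C A0 B0\<^esub> v0)"
  "\<one>\<^bsub>Hom (maps_cat C) (A1, A0, f) (B1, B0, g)\<^esub> = (\<one>\<^bsub>Hom C A1 B1\<^esub>, \<one>\<^bsub>Hom C A0 B0\<^esub>)"
  "Comp (maps_cat C) (A1, A0, f) (v1, v0) (u1, u0) = (Comp C A1 v1 u1, Comp C A0 v0 u0)"
  "Ident (maps_cat C) (A1, A0, f) = (Ident C A1, Ident C A0)"
  by (simp_all add: maps_cat_def)

context preadditive
begin

lemma category_maps_cat: "category_laws (maps_cat C)"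
proof
  fix X assume "X \<in> Ob (maps_cat C)"
  then show "Ident (maps_cat C) X \<in> arrows (maps_cat C) X X"
    by (cases X) (auto simp: ident_closed ident_left ident_right)
next
  fix X Y Z u v
  assume *: "X \<in> Ob (maps_cat C)" "Y \<in> Ob (maps_cat C)" "Z \<in> Ob (maps_cat C)"
    "u \<in> arrows (maps_cat C) X Y" "v \<in> arrows (maps_cat C) Y Z"
  obtain X1 X0 x Y1 Y0 y Z1 Z0 z u1 u0 v1 v0 where
    eq: "X = (X1, X0, x)" "Y = (Y1, Y0, y)" "Z = (Z1, Z0, z)" "u = (u1, u0)" "v = (v1, v0)"
    by (metis prod.exhaust)
  have h: "X1 \<in> Ob C" "X0 \<in> Ob C" "Y1 \<in> Ob C" "Y0 \<in> Ob C" "Z1 \<in> Ob C" "Z0 \<in> Ob C"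
    "x \<in> arrows C X1 X0" "y \<in> arrows C Y1 Y0" "z \<in> arrows C Z1 Z0"
    "u1 \<in> arrows C X1 Y1" "u0 \<in> arrows C X0 Y0" "v1 \<in> arrows C Y1 Z1" "v0 \<in> arrows C Y0 Z0"
    and sq: "Comp C X1 y u1 = Comp C X1 u0 x" "Comp C Y1 z v1 = Comp C Y1 v0 y"
    using * unfolding eq by auto
  have "Comp C X1 z (Comp C X1 v1 u1) = Comp C X1 (Comp C Y1 z v1) u1"
    using h by (intro comp_assoc[symmetric])
  also have "\<dots> = Comp C X1 v0 (Comp C X1 y u1)" unfolding sq(2) by (rule comp_assoc) (use h in auto)
  also have "\<dots> = Comp C X1 (Comp C X0 v0 u0) x"
    unfolding sq(1) using h by (intro comp_assoc[symmetric])
  finally show "Comp (maps_cat C) X v u \<in> arrows (maps_cat C) X Z"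
    unfolding eq using h comp_closed[OF h(1,3,5,10,12)] comp_closed[OF h(2,4,6,11,13)] by simp
next
  fix X Y Z W f g h
  assume "X \<in> Ob (maps_cat C)" "Y \<in> Ob (maps_cat C)" "Z \<in> Ob (maps_cat C)" "W \<in> Ob (maps_cat C)"
    "f \<in> arrows (maps_cat C) X Y" "g \<in> arrows (maps_cat C) Y Z" "h \<in> arrows (maps_cat C) Z W"
  then show "Comp (maps_cat C) X (Comp (maps_cat C) Y h g) f
      = Comp (maps_cat C) X h (Comp (maps_cat C) X g f)"
    by (cases X, cases Y, cases Z, cases W, cases f, cases g, cases h) (auto intro!: comp_assoc[rotated 4])
next
  fix X Y f assume *: "X \<in> Ob (maps_cat C)" "Y \<in> Ob (maps_cat C)" "f \<in> arrows (maps_cat C) X Y"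
  then show "Comp (maps_cat C) X (Ident (maps_cat C) Y) f = f"
    by (cases X, cases Y, cases f) (auto intro!: ident_left[rotated 2])
  show "Comp (maps_cat C) X f (Ident (maps_cat C) X) = f"
    using * by (cases X, cases Y, cases f) (auto intro!: ident_right[rotated 2])
qed

lemma maps_cat_hom_comm_group:
  assumes X: "X \<in> Ob (maps_cat C)" and Y: "Y \<in> Ob (maps_cat C)"
  shows "comm_group (Hom (maps_cat C) X Y)"
proof -
  obtain X1 X0 x Y1 Y0 y where eq: "X = (X1, X0, x)" "Y = (Y1, Y0, y)" by (metis prod.exhaust)
  have h: "X1 \<in> Ob C" "X0 \<in> Ob C" "Y1 \<in> Ob C" "Y0 \<in> Ob C" "x \<in> arrows C X1 X0" "y \<in> arrows C Y1 Y0"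
    using X Y unfolding eq by auto
  interpret H1: comm_group "Hom C X1 Y1" by (rule hom_comm_group[OF h(1,3)])
  interpret H0: comm_group "Hom C X0 Y0" by (rule hom_comm_group[OF h(2,4)])
  interpret H: comm_group "Hom C X1 Y0" by (rule hom_comm_group[OF h(1,4)])
  interpret L: group_hom "Hom C X1 Y1" "Hom C X1 Y0" "\<lambda>u. Comp C X1 y u"
    by (intro group_hom.intro group_hom_axioms.intro H1.is_group H.is_group comp_hom_left h)
  interpret R: group_hom "Hom C X0 Y0" "Hom C X1 Y0" "\<lambda>u. Comp C X1 u x"
    by (intro group_hom.intro group_hom_axioms.intro H0.is_group H.is_group comp_hom_right h)
  show ?thesis unfolding eq
  proof (rule comm_groupI)
    fix u assume "u \<in> arrows (maps_cat C) (X1, X0, x) (Y1, Y0, y)"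
    then show "\<exists>v\<in>arrows (maps_cat C) (X1, X0, x) (Y1, Y0, y).
        v \<otimes>\<^bsub>Hom (maps_cat C) (X1, X0, x) (Y1, Y0, y)\<^esub> u = \<one>\<^bsub>Hom (maps_cat C) (X1, X0, x) (Y1, Y0, y)\<^esub>"
      by (cases u) (auto intro!: bexI[of _ "(inv\<^bsub>Hom C X1 Y1\<^esub> fst u, inv\<^bsub>Hom C X0 Y0\<^esub> snd u)"])
  qed (auto simp: H1.m_ac H0.m_ac)
qed

lemma preadditive_maps_cat: "preadditive (maps_cat C)"
proof (intro preadditive.intro category_maps_cat preadditive_axioms.intro maps_cat_hom_comm_group)
  interpret M: category_laws "maps_cat C" by (rule category_maps_cat)
  fix X Y Z assume *: "X \<in> Ob (maps_cat C)" "Y \<in> Ob (maps_cat C)" "Z \<in> Ob (maps_cat C)"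
  {
    fix g assume g: "g \<in> arrows (maps_cat C) Y Z"
    have "Comp (maps_cat C) X g (f \<otimes>\<^bsub>Hom (maps_cat C) X Y\<^esub> f') =
      Comp (maps_cat C) X g f \<otimes>\<^bsub>Hom (maps_cat C) X Z\<^esub> Comp (maps_cat C) X g f'"
      if "f \<in> arrows (maps_cat C) X Y" "f' \<in> arrows (maps_cat C) X Y" for f f'
      using * g that
      by (cases X, cases Y, cases Z, cases f, cases f', cases g) (auto intro!: comp_add_left)
    then show "(\<lambda>f. Comp (maps_cat C) X g f) \<in> hom (Hom (maps_cat C) X Y) (Hom (maps_cat C) X Z)"
      using M.comp_closed[OF * _ g] by (auto simp: hom_def)
  next
    fix f assume f: "f \<in> arrows (maps_cat C) X Y"
    have "Comp (maps_cat C) X (g \<otimes>\<^bsub>Hom (maps_cat C) Y Z\<^esub> g') f =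
      Comp (maps_cat C) X g f \<otimes>\<^bsub>Hom (maps_cat C) X Z\<^esub> Comp (maps_cat C) X g' f"
      if "g \<in> arrows (maps_cat C) Y Z" "g' \<in> arrows (maps_cat C) Y Z" for g g'
      using * f that
      by (cases X, cases Y, cases Z, cases g, cases g', cases f) (auto intro!: comp_add_right)
    then show "(\<lambda>g. Comp (maps_cat C) X g f) \<in> hom (Hom (maps_cat C) Y Z) (Hom (maps_cat C) X Z)"
      using M.comp_closed[OF * f] by (auto simp: hom_def)
  }
qed

text \<open>Split both components; the images \<open>B1\<close> and \<open>B0\<close> are joined by the restriction \<open>r0 f i1\<close> of \<open>f\<close>.\<close>

lemma idempotents_split_maps_cat:
  assumes split: "idempotents_split C"
  shows "idempotents_split (maps_cat C)"
  unfolding idempotents_split_def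
proof (intro ballI impI)
  fix A p assume A: "A \<in> Ob (maps_cat C)" and p: "p \<in> arrows (maps_cat C) A A"
    and pp: "Comp (maps_cat C) A p p = p"
  obtain A1 A0 f p1 p0 where eq: "A = (A1, A0, f)" "p = (p1, p0)" by (metis prod.exhaust)
  have h: "A1 \<in> Ob C" "A0 \<in> Ob C" "f \<in> arrows C A1 A0" "p1 \<in> arrows C A1 A1" "p0 \<in> arrows C A0 A0"
    and sq: "Comp C A1 f p1 = Comp C A1 p0 f" and id: "Comp C A1 p1 p1 = p1" "Comp C A0 p0 p0 = p0"
    using A p pp unfolding eq by auto
  obtain B1 i1 r1 where B1: "B1 \<in> Ob C" and i1: "i1 \<in> arrows C B1 A1" and r1: "r1 \<in> arrows C A1 B1"
    and ri1: "Comp C B1 r1 i1 = Ident C B1" and ir1: "Comp C A1 i1 r1 = p1"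
    using split h(1,4) id(1) unfolding idempotents_split_def by blast
  obtain B0 i0 r0 where B0: "B0 \<in> Ob C" and i0: "i0 \<in> arrows C B0 A0" and r0: "r0 \<in> arrows C A0 B0"
    and ri0: "Comp C B0 r0 i0 = Ident C B0" and ir0: "Comp C A0 i0 r0 = p0"
    using split h(2,5) id(2) unfolding idempotents_split_def by blast
  have fi: "Comp C B1 f i1 \<in> arrows C B1 A0" and rf: "Comp C A1 r0 f \<in> arrows C A1 B0"
    by (rule comp_closed[OF B1 h(1,2) i1 h(3)], rule comp_closed[OF h(1,2) B0 h(3) r0])
  define g where "g = Comp C B1 r0 (Comp C B1 f i1)"
  have g: "g \<in> arrows C B1 B0" unfolding g_def by (rule comp_closed[OF B1 h(2) B0 fi r0])
  have "Comp C B1 i0 g = Comp C B1 p0 (Comp C B1 f i1)"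
    unfolding g_def using comp_assoc[OF B1 h(2) B0 h(2) fi r0 i0] ir0 by simp
  also have "\<dots> = Comp C B1 (Comp C A1 f p1) i1"
    unfolding sq using comp_assoc[OF B1 h(1,2,2) i1 h(3,5)] by simp
  also have "\<dots> = Comp C B1 f (Comp C B1 p1 i1)" by (rule comp_assoc[OF B1 h(1,1,2) i1 h(4,3)])
  also have "Comp C B1 p1 i1 = i1"
    unfolding ir1[symmetric] using comp_assoc[OF B1 h(1) B1 h(1) i1 r1 i1] ri1 ident_right[OF B1 h(1) i1] by simp
  finally have sqi: "Comp C B1 f i1 = Comp C B1 i0 g" by simp
  have "Comp C A1 g r1 = Comp C A1 r0 (Comp C A1 (Comp C B1 f i1) r1)"
    unfolding g_def by (rule comp_assoc[OF h(1) B1 h(2) B0 r1 fi r0])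
  also have "Comp C A1 (Comp C B1 f i1) r1 = Comp C A1 f p1"
    unfolding ir1[symmetric] by (rule comp_assoc[OF h(1) B1 h(1,2) r1 i1 h(3)])
  also have "Comp C A1 r0 (Comp C A1 f p1) = Comp C A1 (Comp C A0 r0 p0) f"
    unfolding sq by (rule comp_assoc[OF h(1,2,2) B0 h(3,5) r0, symmetric])
  also have "Comp C A0 r0 p0 = r0"
    unfolding ir0[symmetric] using comp_assoc[OF h(2) B0 h(2) B0 r0 i0 r0] ri0 ident_left[OF h(2) B0 r0] by simp
  finally have sqr: "Comp C A1 g r1 = Comp C A1 r0 f" .
  show "\<exists>B\<in>Ob (maps_cat C). \<exists>i\<in>arrows (maps_cat C) B A. \<exists>r\<in>arrows (maps_cat C) A B.
      Comp (maps_cat C) B r i = Ident (maps_cat C) B \<and> Comp (maps_cat C) A i r = p"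
    unfolding eq
    by (rule bexI[of _ "(B1, B0, g)"], rule bexI[of _ "(i1, i0)"], rule bexI[of _ "(r1, r0)"])
      (simp_all add: B1 B0 g i1 i0 r1 r0 ri1 ri0 ir1 ir0 sqi sqr)
qed

end

section \<open>Functors with a presentation\<close>

lemma nat_transI:
  assumes "\<And>X. X \<notin> Ob C \<Longrightarrow> \<eta> X = undefined"
    and "\<And>X x. \<lbrakk>X \<in> Ob C; x \<notin> carrier (val F X)\<rbrakk> \<Longrightarrow> \<eta> X x = undefined"
    and "\<And>X. X \<in> Ob C \<Longrightarrow> \<eta> X \<in> hom (val F X) (val G X)"
    and "\<And>X Y h y. \<lbrakk>X \<in> Ob C; Y \<in> Ob C; h \<in> arrows C X Y; y \<in> carrier (val F Y)\<rbrakk> \<Longrightarrow>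
       \<eta> X (act F X Y h y) = act G X Y h (\<eta> Y y)"
  shows "\<eta> \<in> nat_trans C F G"
  using assms unfolding nat_trans_def by (auto simp: PiE_def extensional_def)

lemma nat_trans_hom: "\<lbrakk>\<eta> \<in> nat_trans C F G; X \<in> Ob C\<rbrakk> \<Longrightarrow> \<eta> X \<in> hom (val F X) (val G X)"
  unfolding nat_trans_def by auto

lemma nat_trans_closed:
  "\<lbrakk>\<eta> \<in> nat_trans C F G; X \<in> Ob C; x \<in> carrier (val F X)\<rbrakk> \<Longrightarrow> \<eta> X x \<in> carrier (val G X)"
  using nat_trans_hom[of \<eta> C F G X] by (auto simp: hom_def)

lemma nat_trans_act:
  "\<lbrakk>\<eta> \<in> nat_trans C F G; X \<in> Ob C; Y \<in> Ob C; h \<in> arrows C X Y; y \<in> carrier (val F Y)\<rbrakk> \<Longrightarrow>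
    \<eta> X (act F X Y h y) = act G X Y h (\<eta> Y y)"
  unfolding nat_trans_def by blast

lemma nat_trans_eqI:
  assumes \<eta>: "\<eta> \<in> nat_trans C F G" and \<theta>: "\<theta> \<in> nat_trans C F G"
    and eq: "\<And>X x. \<lbrakk>X \<in> Ob C; x \<in> carrier (val F X)\<rbrakk> \<Longrightarrow> \<eta> X x = \<theta> X x"
  shows "\<eta> = \<theta>"
proof (rule PiE_ext)
  let ?S = "\<lambda>X. hom (val F X) (val G X) \<inter> extensional (carrier (val F X))"
  show "\<eta> \<in> (\<Pi>\<^sub>E X\<in>Ob C. ?S X)" "\<theta> \<in> (\<Pi>\<^sub>E X\<in>Ob C. ?S X)"
    using \<eta> \<theta> unfolding nat_trans_def by auto
  fix X assume X: "X \<in> Ob C"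
  have "\<eta> X \<in> extensional (carrier (val F X))" "\<theta> X \<in> extensional (carrier (val F X))"
    using \<eta> \<theta> X unfolding nat_trans_def by auto
  then show "\<eta> X = \<theta> X" using eq[OF X] by (rule extensionalityI)
qed

lemma contravariant_functor_act_closed:
  assumes "contravariant_functor C F" "X \<in> Ob C" "Y \<in> Ob C" "h \<in> arrows C X Y" "y \<in> carrier (val F Y)"
  shows "act F X Y h y \<in> carrier (val F X)"
proof -
  have "act F X Y h \<in> hom (val F Y) (val F X)"
    using assms unfolding contravariant_functor_def by blast
  then show ?thesis using assms(5) by (auto simp: hom_def)
qed

lemma contravariant_functor_comm_group:
  "\<lbrakk>contravariant_functor C F; X \<in> Ob C\<rbrakk> \<Longrightarrow> comm_group (val F X)"
  unfolding contravariant_functor_def by blast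

lemma nat_trans_comp:
  assumes F: "contravariant_functor C F"
    and \<eta>: "\<eta> \<in> nat_trans C F G" and \<theta>: "\<theta> \<in> nat_trans C G H"
  shows "(\<lambda>X\<in>Ob C. compose (carrier (val F X)) (\<theta> X) (\<eta> X)) \<in> nat_trans C F H"
proof (rule nat_transI)
  fix X assume X: "X \<in> Ob C"
  have "compose (carrier (val F X)) (\<theta> X) (\<eta> X) \<in> hom (val F X) (val H X)"
    by (rule group.hom_compose[OF comm_group.axioms(2)[OF contravariant_functor_comm_group[OF F X]]
      nat_trans_hom[OF \<eta> X] nat_trans_hom[OF \<theta> X]])
  then show "(\<lambda>X\<in>Ob C. compose (carrier (val F X)) (\<theta> X) (\<eta> X)) X \<in> hom (val F X) (val H X)"
    using X by simp
next
  fix X Y h y assume *: "X \<in> Ob C" "Y \<in> Ob C" "h \<in> arrows C X Y" "y \<in> carrier (val F Y)"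
  then show "(\<lambda>X\<in>Ob C. compose (carrier (val F X)) (\<theta> X) (\<eta> X)) X (act F X Y h y) =
      act H X Y h ((\<lambda>X\<in>Ob C. compose (carrier (val F X)) (\<theta> X) (\<eta> X)) Y y)"
    using contravariant_functor_act_closed[OF F *] nat_trans_act[OF \<eta> *]
      nat_trans_act[OF \<theta> *(1-3) nat_trans_closed[OF \<eta> *(2,4)]]
    by (simp add: compose_def)
qed (auto simp: compose_def)

lemma nat_trans_ident:
  assumes F: "contravariant_functor C F"
  shows "(\<lambda>X\<in>Ob C. \<lambda>x\<in>carrier (val F X). x) \<in> nat_trans C F F"
proof (rule nat_transI)
  fix X assume X: "X \<in> Ob C"
  interpret comm_group "val F X" by (rule contravariant_functor_comm_group[OF F X])
  show "(\<lambda>X\<in>Ob C. \<lambda>x\<in>carrier (val F X). x) X \<in> hom (val F X) (val F X)"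
    using X by (auto simp: hom_def)
qed (auto simp: contravariant_functor_act_closed[OF F])

lemma fp_cat_simps [simp]:
  "Ob (fp_cat C) = {F. finitely_presented C F}"
  "arrows (fp_cat C) F G = nat_trans C F G"
  "Comp (fp_cat C) F \<theta> \<eta> = (\<lambda>X\<in>Ob C. compose (carrier (val F X)) (\<theta> X) (\<eta> X))"
  "Ident (fp_cat C) F = (\<lambda>X\<in>Ob C. \<lambda>x\<in>carrier (val F X). x)"
  by (simp_all add: fp_cat_def)

lemma finitely_presented_functor: "finitely_presented C F \<Longrightarrow> contravariant_functor C F"
  unfolding finitely_presented_def by (rule conjunct1)

lemma category_fp_cat: "category_laws (fp_cat C)"
proof
  fix F assume "F \<in> Ob (fp_cat C)"
  then show "Ident (fp_cat C) F \<in> arrows (fp_cat C) F F"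
    by (simp add: nat_trans_ident finitely_presented_functor)
next
  fix F G H \<eta> \<theta>
  assume "F \<in> Ob (fp_cat C)" "\<eta> \<in> arrows (fp_cat C) F G" "\<theta> \<in> arrows (fp_cat C) G H"
  then show "Comp (fp_cat C) F \<theta> \<eta> \<in> arrows (fp_cat C) F H"
    by (simp add: nat_trans_comp finitely_presented_functor)
next
  fix F G H K \<eta> \<theta> \<zeta>
  assume "\<eta> \<in> arrows (fp_cat C) F G"
  then show "Comp (fp_cat C) F (Comp (fp_cat C) G \<zeta> \<theta>) \<eta> = Comp (fp_cat C) F \<zeta> (Comp (fp_cat C) F \<theta> \<eta>)"
    by (auto simp: compose_def nat_trans_closed fun_eq_iff)
next
  fix F G \<eta> assume \<eta>: "F \<in> Ob (fp_cat C)" "G \<in> Ob (fp_cat C)" "\<eta> \<in> arrows (fp_cat C) F G"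
  have "Comp (fp_cat C) F (Ident (fp_cat C) G) \<eta> \<in> nat_trans C F G"
    using \<eta> unfolding fp_cat_simps mem_Collect_eq
    by (blast intro: nat_trans_comp nat_trans_ident finitely_presented_functor)
  then show "Comp (fp_cat C) F (Ident (fp_cat C) G) \<eta> = \<eta>"
    by (rule nat_trans_eqI) (use \<eta> in \<open>auto simp: compose_def nat_trans_closed\<close>)
  have "Comp (fp_cat C) F \<eta> (Ident (fp_cat C) F) \<in> nat_trans C F G"
    using \<eta> unfolding fp_cat_simps mem_Collect_eq
    by (blast intro: nat_trans_comp nat_trans_ident finitely_presented_functor)
  then show "Comp (fp_cat C) F \<eta> (Ident (fp_cat C) F) = \<eta>"
    by (rule nat_trans_eqI) (use \<eta> in \<open>auto simp: compose_def\<close>)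
qed

text \<open>\<open>F\<close> together with an exact sequence \<open>(-, A1) \<rightarrow> (-, A0) \<rightarrow> F \<rightarrow> 0\<close> whose first map is given by \<open>f\<close>.
  This says \<open>F \<cong> \<Phi>(A1, A0, f)\<close> in a form that allows to argue with arrows into \<open>A0\<close> instead of
  cosets.\<close>

locale presented_functor = preadditive C
  for C :: "('o, 'm) precat" and A1 A0 :: 'o and f :: 'm
    and F :: "('o, 'm, 'g) cfunctor" and \<epsilon> :: "'o \<Rightarrow> 'm \<Rightarrow> 'g" +
  assumes A1: "A1 \<in> Ob C" and A0: "A0 \<in> Ob C" and f: "f \<in> arrows C A1 A0"
    and functor_F: "contravariant_functor C F"
    and \<epsilon>: "\<epsilon> \<in> nat_trans C (rep C A0) F"
    and surj: "X \<in> Ob C \<Longrightarrow> \<epsilon> X ` arrows C X A0 = carrier (val F X)"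
    and ker: "\<lbrakk>X \<in> Ob C; g \<in> arrows C X A0\<rbrakk> \<Longrightarrow>
      \<epsilon> X g = \<one>\<^bsub>val F X\<^esub> \<longleftrightarrow> (\<exists>h\<in>arrows C X A1. g = Comp C X f h)"
begin

lemma comm_group_val: "X \<in> Ob C \<Longrightarrow> comm_group (val F X)"
  using functor_F by (rule contravariant_functor_comm_group)

lemma eps_hom: "X \<in> Ob C \<Longrightarrow> \<epsilon> X \<in> hom (Hom C X A0) (val F X)"
  using nat_trans_hom[OF \<epsilon>] by (simp add: rep_def)

lemma eps_closed: "\<lbrakk>X \<in> Ob C; g \<in> arrows C X A0\<rbrakk> \<Longrightarrow> \<epsilon> X g \<in> carrier (val F X)"
  using eps_hom by (auto simp: hom_def)

lemma eps_natural:
  "\<lbrakk>X \<in> Ob C; Y \<in> Ob C; h \<in> arrows C X Y; g \<in> arrows C Y A0\<rbrakk> \<Longrightarrow>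
    \<epsilon> X (Comp C X g h) = act F X Y h (\<epsilon> Y g)"
  using nat_trans_act[OF \<epsilon>, of X Y h g] by (simp add: rep_def)

lemma eps_lift:
  assumes "X \<in> Ob C" "x \<in> carrier (val F X)"
  obtains g where "g \<in> arrows C X A0" "\<epsilon> X g = x"
proof -
  have "x \<in> \<epsilon> X ` arrows C X A0" using surj[OF assms(1)] assms(2) by simp
  then show ?thesis using that by blast
qed

lemma eps_kernel: "\<lbrakk>X \<in> Ob C; h \<in> arrows C X A1\<rbrakk> \<Longrightarrow> \<epsilon> X (Comp C X f h) = \<one>\<^bsub>val F X\<^esub>"
  using ker comp_closed[OF _ A1 A0 _ f] by blast

lemma nat_trans_eq_on_eps:
  assumes \<theta>: "\<theta> \<in> nat_trans C F G" "\<theta>' \<in> nat_trans C F G"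
    and eq: "\<And>X g. \<lbrakk>X \<in> Ob C; g \<in> arrows C X A0\<rbrakk> \<Longrightarrow> \<theta> X (\<epsilon> X g) = \<theta>' X (\<epsilon> X g)"
  shows "\<theta> = \<theta>'"
  using \<theta>
proof (rule nat_trans_eqI)
  fix X x assume X: "X \<in> Ob C" and "x \<in> carrier (val F X)"
  then obtain g where "g \<in> arrows C X A0" "\<epsilon> X g = x" by (rule eps_lift)
  then show "\<theta> X x = \<theta>' X x" using eq[OF X] by blast
qed

lemma finitely_presented: "finitely_presented C F"
proof -
  have "rep_map C A1 f \<in> nat_trans C (rep C A1) (rep C A0)"
  proof (rule nat_transI)
    fix X assume X: "X \<in> Ob C"
    show "rep_map C A1 f X \<in> hom (val (rep C A1) X) (val (rep C A0) X)"
      using X hom_mult[OF comp_hom_left[OF X A1 A0 f]] comp_closed[OF X A1 A0 _ f] hom_comm_group[OF X A1]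
      by (auto simp: rep_map_def rep_def hom_def comm_group_def group.is_monoid monoid.m_closed)
  next
    fix X Y h y assume *: "X \<in> Ob C" "Y \<in> Ob C" "h \<in> arrows C X Y" "y \<in> carrier (val (rep C A1) Y)"
    then have y: "y \<in> arrows C Y A1" by (simp add: rep_def)
    show "rep_map C A1 f X (act (rep C A1) X Y h y) = act (rep C A0) X Y h (rep_map C A1 f Y y)"
      using * y comp_closed[OF *(1,2) A1 *(3) y] comp_assoc[OF *(1,2) A1 A0 *(3) y f]
      by (simp add: rep_map_def rep_def)
  qed (auto simp: rep_map_def rep_def)
  moreover have "rep_map C A1 f X ` carrier (val (rep C A1) X) = kernel (val (rep C A0) X) (val F X) (\<epsilon> X)"
    if X: "X \<in> Ob C" for X
    using X ker[OF X] comp_closed[OF X A1 A0 _ f] by (auto simp: rep_map_def rep_def kernel_def)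
  moreover have "\<epsilon> X ` carrier (val (rep C A0) X) = carrier (val F X)" if X: "X \<in> Ob C" for X
    using surj[OF X] by (simp add: rep_def)
  ultimately show ?thesis
    unfolding finitely_presented_def using functor_F A1 A0 \<epsilon> by blast
qed

end

context preadditive
begin

text \<open>By the Yoneda lemma the map \<open>\<eta> : (-, A1) \<rightarrow> (-, A0)\<close> is composition with \<open>\<eta>(1)\<close>.\<close>

lemma finitely_presented_presented:
  assumes F: "finitely_presented C F"
  obtains A1 A0 f \<epsilon> where "presented_functor C A1 A0 f F \<epsilon>"
proof -
  obtain A1 A0 \<eta> \<epsilon> where A1: "A1 \<in> Ob C" and A0: "A0 \<in> Ob C"
    and \<eta>: "\<eta> \<in> nat_trans C (rep C A1) (rep C A0)" and \<epsilon>: "\<epsilon> \<in> nat_trans C (rep C A0) F"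
    and all: "\<forall>X\<in>Ob C.
      \<eta> X ` carrier (val (rep C A1) X) = kernel (val (rep C A0) X) (val F X) (\<epsilon> X) \<and>
      \<epsilon> X ` carrier (val (rep C A0) X) = carrier (val F X)"
    using F unfolding finitely_presented_def by (elim conjE bexE) (rule that)
  define f where "f = \<eta> A1 (Ident C A1)"
  have f: "f \<in> arrows C A1 A0"
    using nat_trans_closed[OF \<eta> A1, of "Ident C A1"] ident_closed[OF A1] by (simp add: f_def rep_def)
  have \<eta>_eq: "\<eta> X h = Comp C X f h" if X: "X \<in> Ob C" and h: "h \<in> arrows C X A1" for X h
    using nat_trans_act[OF \<eta> X A1 h, of "Ident C A1"] ident_closed[OF A1] ident_left[OF X A1 h]
    by (simp add: f_def rep_def)
  have "presented_functor C A1 A0 f F \<epsilon>"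
  proof
    fix X assume X: "X \<in> Ob C"
    show "\<epsilon> X ` arrows C X A0 = carrier (val F X)"
      using bspec[OF all X] by (simp add: rep_def)
    fix g assume g: "g \<in> arrows C X A0"
    have "\<eta> X ` arrows C X A1 = kernel (Hom C X A0) (val F X) (\<epsilon> X)"
      using bspec[OF all X] by (simp add: rep_def)
    moreover have "\<eta> X ` arrows C X A1 = (\<lambda>h. Comp C X f h) ` arrows C X A1"
      using \<eta>_eq[OF X] by auto
    ultimately show "\<epsilon> X g = \<one>\<^bsub>val F X\<^esub> \<longleftrightarrow> (\<exists>h\<in>arrows C X A1. g = Comp C X f h)"
      using g by (auto simp: kernel_def)
  qed (use A1 A0 f \<epsilon> F in \<open>auto simp: finitely_presented_functor\<close>)
  then show ?thesis by (rule that)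
qed

text \<open>The projection onto cosets presents the cokernel.\<close>

lemma Phi_presented:
  assumes A1: "A1 \<in> Ob C" and A0: "A0 \<in> Ob C" and f: "f \<in> arrows C A1 A0"
  shows "presented_functor C A1 A0 f (Phi C (A1, A0, f))
    (\<lambda>X\<in>Ob C. \<lambda>g\<in>arrows C X A0. (Comp C X f ` arrows C X A1) #>\<^bsub>Hom C X A0\<^esub> g)"
proof -
  define N where "N X = Comp C X f ` arrows C X A1" for X
  define \<pi> where "\<pi> = (\<lambda>X\<in>Ob C. \<lambda>g\<in>arrows C X A0. N X #>\<^bsub>Hom C X A0\<^esub> g)"
  let ?F = "Phi C (A1, A0, f)"
  have im: "rep_map C A1 f X ` carrier (val (rep C A1) X) = N X" if "X \<in> Ob C" for X
    using that by (auto simp: rep_map_def rep_def N_def)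
  have val_F: "val ?F X = Hom C X A0 Mod N X" if "X \<in> Ob C" for X
    using im[OF that] by (simp add: Phi_def coker_def rep_def)
  have act_F: "act ?F X Y h c = (\<Union>g\<in>c. N X #>\<^bsub>Hom C X A0\<^esub> Comp C X g h)" if "X \<in> Ob C" for X Y h c
    using im[OF that] by (simp add: Phi_def coker_def rep_def)
  have subN: "subgroup (N X) (Hom C X A0)" if X: "X \<in> Ob C" for X
  proof -
    interpret H1: comm_group "Hom C X A1" by (rule hom_comm_group[OF X A1])
    interpret H0: comm_group "Hom C X A0" by (rule hom_comm_group[OF X A0])
    interpret group_hom "Hom C X A1" "Hom C X A0" "\<lambda>h. Comp C X f h"
      by (intro group_hom.intro group_hom_axioms.intro H1.is_group H0.is_group comp_hom_left X A1 A0 f)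
    show ?thesis unfolding N_def by (rule img_is_subgroup)
  qed
  have normal: "N X \<lhd> Hom C X A0" if X: "X \<in> Ob C" for X
    by (rule comm_group.subgroup_imp_normal[OF hom_comm_group[OF X A0] subN[OF X]])
  have carr: "carrier (val ?F X) = \<pi> X ` arrows C X A0" if "X \<in> Ob C" for X
    using that by (auto simp: val_F FactGroup_def RCOSETS_def \<pi>_def)
  have \<pi>_hom: "\<pi> X \<in> hom (Hom C X A0) (val ?F X)" if X: "X \<in> Ob C" for X
  proof -
    interpret comm_group "Hom C X A0" by (rule hom_comm_group[OF X A0])
    show ?thesis
      using normal.r_coset_hom_Mod[OF normal[OF X]] X by (auto simp: val_F \<pi>_def hom_def)
  qed
  have \<pi>_eq: "\<pi> X g = \<pi> X g'"
    if X: "X \<in> Ob C" and g: "g \<in> arrows C X A0" "g' \<in> arrows C X A0" and "g' \<in> N X #>\<^bsub>Hom C X A0\<^esub> g" for X g g'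
    using group.repr_independence[OF comm_group.axioms(2)[OF hom_comm_group[OF X A0]] that(4) g(1) subN[OF X]] X g
    by (simp add: \<pi>_def)
  have act_\<pi>: "act ?F X Y h (\<pi> Y g) = \<pi> X (Comp C X g h)"
    if X: "X \<in> Ob C" and Y: "Y \<in> Ob C" and h: "h \<in> arrows C X Y" and g: "g \<in> arrows C Y A0" for X Y h g
  proof -
    interpret HY: comm_group "Hom C Y A0" by (rule hom_comm_group[OF Y A0])
    have gh: "Comp C X g h \<in> arrows C X A0" by (rule comp_closed[OF X Y A0 h g])
    have "N X #>\<^bsub>Hom C X A0\<^esub> Comp C X g' h = \<pi> X (Comp C X g h)" if g': "g' \<in> \<pi> Y g" for g'
    proof -
      obtain k where k: "k \<in> arrows C Y A1" "g' = Comp C Y f k \<otimes>\<^bsub>Hom C Y A0\<^esub> g"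
        using g' Y g by (auto simp: \<pi>_def N_def r_coset_def)
      have fk: "Comp C Y f k \<in> arrows C Y A0" by (rule comp_closed[OF Y A1 A0 k(1) f])
      have kh: "Comp C X k h \<in> arrows C X A1" by (rule comp_closed[OF X Y A1 h k(1)])
      have g'c: "g' \<in> arrows C Y A0" using k(2) fk g by simp
      have "Comp C X g' h = Comp C X f (Comp C X k h) \<otimes>\<^bsub>Hom C X A0\<^esub> Comp C X g h"
        unfolding k(2) using comp_add_right[OF X Y A0 h fk g] comp_assoc[OF X Y A1 A0 h k(1) f] by simp
      then have "Comp C X g' h \<in> N X #>\<^bsub>Hom C X A0\<^esub> Comp C X g h"
        using kh by (auto simp: N_def r_coset_def)
      then have "\<pi> X (Comp C X g h) = \<pi> X (Comp C X g' h)"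
        using \<pi>_eq[OF X gh comp_closed[OF X Y A0 h g'c]] by simp
      then show ?thesis using comp_closed[OF X Y A0 h g'c] X by (simp add: \<pi>_def)
    qed
    moreover have "g \<in> \<pi> Y g"
      using group.rcos_self[OF HY.is_group g subN[OF Y]] g Y by (simp add: \<pi>_def)
    ultimately show ?thesis unfolding act_F[OF X] by blast
  qed
  have "contravariant_functor C ?F"
    unfolding contravariant_functor_def
  proof (intro conjI ballI)
    fix X assume X: "X \<in> Ob C"
    show "comm_group (val ?F X)"
      unfolding val_F[OF X] by (rule comm_group.abelian_FactGroup[OF hom_comm_group[OF X A0] subN[OF X]])
  next
    fix X Y h assume *: "X \<in> Ob C" "Y \<in> Ob C" "h \<in> arrows C X Y"
    interpret HY: comm_group "Hom C Y A0" by (rule hom_comm_group[OF *(2) A0])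
    show "act ?F X Y h \<in> hom (val ?F Y) (val ?F X)"
    proof (rule homI)
      fix c assume "c \<in> carrier (val ?F Y)"
      then show "act ?F X Y h c \<in> carrier (val ?F X)"
        using * act_\<pi>[OF *] comp_closed[OF *(1,2) A0 *(3)] by (auto simp: carr)
    next
      fix c d assume "c \<in> carrier (val ?F Y)" "d \<in> carrier (val ?F Y)"
      then obtain a b where ab: "a \<in> arrows C Y A0" "b \<in> arrows C Y A0" "c = \<pi> Y a" "d = \<pi> Y b"
        using carr[OF *(2)] by auto
      note ca = comp_closed[OF *(1,2) A0 *(3) ab(1)] comp_closed[OF *(1,2) A0 *(3) ab(2)]
      have "act ?F X Y h (c \<otimes>\<^bsub>val ?F Y\<^esub> d) = act ?F X Y h (\<pi> Y (a \<otimes>\<^bsub>Hom C Y A0\<^esub> b))"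
        using hom_mult[OF \<pi>_hom[OF *(2)] ab(1,2)] ab by simp
      also have "\<dots> = \<pi> X (Comp C X a h \<otimes>\<^bsub>Hom C X A0\<^esub> Comp C X b h)"
        using act_\<pi>[OF *] comp_add_right[OF *(1,2) A0 *(3) ab(1,2)] ab by simp
      also have "\<dots> = act ?F X Y h c \<otimes>\<^bsub>val ?F X\<^esub> act ?F X Y h d"
        using hom_mult[OF \<pi>_hom[OF *(1)] ca] act_\<pi>[OF *] ab by simp
      finally show "act ?F X Y h (c \<otimes>\<^bsub>val ?F Y\<^esub> d) = act ?F X Y h c \<otimes>\<^bsub>val ?F X\<^esub> act ?F X Y h d" .
    qed
  next
    fix X c assume "X \<in> Ob C" "c \<in> carrier (val ?F X)"
    then show "act ?F X X (Ident C X) c = c"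
      using act_\<pi> ident_right[OF _ A0] ident_closed by (auto simp: carr)
  next
    fix X Y Z h k c assume *: "X \<in> Ob C" "Y \<in> Ob C" "Z \<in> Ob C"
      "h \<in> arrows C X Y" "k \<in> arrows C Y Z" "c \<in> carrier (val ?F Z)"
    then obtain a where a: "a \<in> arrows C Z A0" "c = \<pi> Z a" using carr by auto
    show "act ?F X Z (Comp C X k h) c = act ?F X Y h (act ?F Y Z k c)"
      using act_\<pi>[OF *(1,3) comp_closed[OF *(1-5)] a(1)] act_\<pi>[OF *(2,3,5) a(1)]
        act_\<pi>[OF *(1,2,4) comp_closed[OF *(2,3) A0 *(5) a(1)]]
        comp_assoc[OF *(1-3) A0 *(4,5) a(1)] a(2) by simp
  qed
  moreover have "\<pi> \<in> nat_trans C (rep C A0) ?F"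
  proof (rule nat_transI)
    fix X assume "X \<in> Ob C"
    then show "\<pi> X \<in> hom (val (rep C A0) X) (val ?F X)" using \<pi>_hom by (simp add: rep_def)
  qed (auto simp: rep_def act_\<pi>, auto simp: \<pi>_def)
  moreover have "\<pi> X g = \<one>\<^bsub>val ?F X\<^esub> \<longleftrightarrow> (\<exists>h\<in>arrows C X A1. g = Comp C X f h)"
    if X: "X \<in> Ob C" and g: "g \<in> arrows C X A0" for X g
  proof -
    interpret group "Hom C X A0" by (rule comm_group.axioms(2)[OF hom_comm_group[OF X A0]])
    have "\<pi> X g = \<one>\<^bsub>val ?F X\<^esub> \<longleftrightarrow> N X #>\<^bsub>Hom C X A0\<^esub> g = N X"
      using X g by (simp add: \<pi>_def val_F FactGroup_def)
    also have "\<dots> \<longleftrightarrow> g \<in> N X"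
      using coset_join1[OF _ g subN[OF X]] coset_join2[OF g subN[OF X]] by blast
    finally show ?thesis by (auto simp: N_def)
  qed
  ultimately have "presented_functor C A1 A0 f ?F \<pi>"
    by unfold_locales (use A1 A0 f carr in simp_all)
  then show ?thesis unfolding \<pi>_def N_def .
qed

end

text \<open>A square \<open>(u1, u0)\<close> lies over \<open>\<theta>\<close>. This is a condition on \<open>u0\<close>, because \<open>F\<close> and \<open>G\<close> are quotients
  of \<open>(-, A0)\<close> and \<open>(-, B0)\<close>; the component \<open>u1\<close> certifies that \<open>u0\<close> respects the kernels.\<close>

definition induces ::
  "('o, 'm) precat \<Rightarrow> 'o \<Rightarrow> ('o \<Rightarrow> 'm \<Rightarrow> 'g) \<Rightarrow> ('o \<Rightarrow> 'm \<Rightarrow> 'h) \<Rightarrow> 'm \<Rightarrow> ('o \<Rightarrow> 'g \<Rightarrow> 'h) \<Rightarrow> bool" where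
  "induces C A0 \<epsilon> \<delta> u0 \<theta> \<longleftrightarrow>
     (\<forall>X\<in>Ob C. \<forall>g\<in>arrows C X A0. \<theta> X (\<epsilon> X g) = \<delta> X (Comp C X u0 g))"

context preadditive
begin

text \<open>Lift an element of \<open>F X\<close> to an arrow \<open>X \<rightarrow> A0\<close> and compose with \<open>u0\<close>. Two lifts differ by an arrow
  \<open>f h\<close>, which \<open>u0\<close> sends to \<open>b u1 h\<close>, an element of the kernel of \<open>\<delta>\<close>.\<close>

lemma induced_nat_trans:
  assumes P: "presented_functor C A1 A0 f F \<epsilon>" and Q: "presented_functor C B1 B0 b G \<delta>"
    and u1: "u1 \<in> arrows C A1 B1" and u0: "u0 \<in> arrows C A0 B0"
    and sq: "Comp C A1 b u1 = Comp C A1 u0 f"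
  obtains \<theta> where "\<theta> \<in> nat_trans C F G" "induces C A0 \<epsilon> \<delta> u0 \<theta>"
proof -
  interpret P: presented_functor C A1 A0 f F \<epsilon> by (rule P)
  interpret Q: presented_functor C B1 B0 b G \<delta> by (rule Q)
  define \<theta> where "\<theta> = (\<lambda>X\<in>Ob C. \<lambda>x\<in>carrier (val F X).
     \<delta> X (Comp C X u0 (SOME g. g \<in> arrows C X A0 \<and> \<epsilon> X g = x)))"
  have wd: "\<delta> X (Comp C X u0 g) = \<delta> X (Comp C X u0 g')"
    if X: "X \<in> Ob C" and g: "g \<in> arrows C X A0" and g': "g' \<in> arrows C X A0" and eq: "\<epsilon> X g = \<epsilon> X g'" for X g g'
  proof -
    interpret HA: comm_group "Hom C X A0" by (rule hom_comm_group[OF X P.A0])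
    interpret HB: comm_group "Hom C X B0" by (rule hom_comm_group[OF X Q.A0])
    interpret VF: comm_group "val F X" by (rule P.comm_group_val[OF X])
    interpret VG: comm_group "val G X" by (rule Q.comm_group_val[OF X])
    interpret E: group_hom "Hom C X A0" "val F X" "\<epsilon> X"
      by (intro group_hom.intro group_hom_axioms.intro HA.is_group VF.is_group P.eps_hom X)
    interpret D: group_hom "Hom C X B0" "val G X" "\<delta> X"
      by (intro group_hom.intro group_hom_axioms.intro HB.is_group VG.is_group Q.eps_hom X)
    have "\<epsilon> X (g \<otimes>\<^bsub>Hom C X A0\<^esub> inv\<^bsub>Hom C X A0\<^esub> g') = \<one>\<^bsub>val F X\<^esub>"
      using g g' eq by simp
    then obtain h where h: "h \<in> arrows C X A1" "g \<otimes>\<^bsub>Hom C X A0\<^esub> inv\<^bsub>Hom C X A0\<^esub> g' = Comp C X f h"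
      using P.ker[OF X, of "g \<otimes>\<^bsub>Hom C X A0\<^esub> inv\<^bsub>Hom C X A0\<^esub> g'"] g g' by auto
    have fh: "Comp C X f h \<in> arrows C X A0" by (rule comp_closed[OF X P.A1 P.A0 h(1) P.f])
    have g_eq: "g = Comp C X f h \<otimes>\<^bsub>Hom C X A0\<^esub> g'"
      unfolding h(2)[symmetric] using g g' by (simp add: HA.m_assoc)
    have "Comp C X u0 (Comp C X f h) = Comp C X b (Comp C X u1 h)"
      using comp_assoc[OF X P.A1 P.A0 Q.A0 h(1) P.f u0] comp_assoc[OF X P.A1 Q.A1 Q.A0 h(1) u1 Q.f] sq by simp
    then have "Comp C X u0 g = Comp C X b (Comp C X u1 h) \<otimes>\<^bsub>Hom C X B0\<^esub> Comp C X u0 g'"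
      unfolding g_eq using comp_add_left[OF X P.A0 Q.A0 u0 fh g'] by simp
    then have "\<delta> X (Comp C X u0 g) = \<delta> X (Comp C X b (Comp C X u1 h)) \<otimes>\<^bsub>val G X\<^esub> \<delta> X (Comp C X u0 g')"
      using comp_closed[OF X P.A1 Q.A1 h(1) u1] comp_closed[OF X Q.A1 Q.A0 _ Q.f] comp_closed[OF X P.A0 Q.A0 g' u0] by simp
    then show ?thesis
      using Q.eps_kernel[OF X comp_closed[OF X P.A1 Q.A1 h(1) u1]] Q.eps_closed[OF X comp_closed[OF X P.A0 Q.A0 g' u0]]
      by simp
  qed
  have \<theta>_eps: "\<theta> X (\<epsilon> X g) = \<delta> X (Comp C X u0 g)" if X: "X \<in> Ob C" and g: "g \<in> arrows C X A0" for X g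
  proof -
    have "(SOME g'. g' \<in> arrows C X A0 \<and> \<epsilon> X g' = \<epsilon> X g) \<in> arrows C X A0 \<and>
        \<epsilon> X (SOME g'. g' \<in> arrows C X A0 \<and> \<epsilon> X g' = \<epsilon> X g) = \<epsilon> X g"
      by (rule someI[of _ g]) (use g in simp)
    then show ?thesis using wd[OF X _ g] X P.eps_closed[OF X g] by (simp add: \<theta>_def)
  qed
  have "\<theta> \<in> nat_trans C F G"
  proof (rule nat_transI)
    fix X assume X: "X \<in> Ob C"
    interpret HA: comm_group "Hom C X A0" by (rule hom_comm_group[OF X P.A0])
    show "\<theta> X \<in> hom (val F X) (val G X)"
    proof (rule homI)
      fix x assume "x \<in> carrier (val F X)"
      then obtain g where "g \<in> arrows C X A0" "\<epsilon> X g = x" using P.eps_lift[OF X] by blast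
      then show "\<theta> X x \<in> carrier (val G X)"
        using \<theta>_eps[OF X] Q.eps_closed[OF X] comp_closed[OF X P.A0 Q.A0 _ u0] by auto
    next
      fix x y assume "x \<in> carrier (val F X)" "y \<in> carrier (val F X)"
      then obtain g h where g: "g \<in> arrows C X A0" "\<epsilon> X g = x" and h: "h \<in> arrows C X A0" "\<epsilon> X h = y"
        using P.eps_lift[OF X] by metis
      note c = comp_closed[OF X P.A0 Q.A0 g(1) u0] comp_closed[OF X P.A0 Q.A0 h(1) u0]
      have "\<theta> X (x \<otimes>\<^bsub>val F X\<^esub> y) = \<theta> X (\<epsilon> X (g \<otimes>\<^bsub>Hom C X A0\<^esub> h))"
        using hom_mult[OF P.eps_hom[OF X] g(1) h(1)] g h by simp
      also have "\<dots> = \<delta> X (Comp C X u0 g \<otimes>\<^bsub>Hom C X B0\<^esub> Comp C X u0 h)"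
        using \<theta>_eps[OF X] comp_add_left[OF X P.A0 Q.A0 u0 g(1) h(1)] g h by simp
      also have "\<dots> = \<theta> X x \<otimes>\<^bsub>val G X\<^esub> \<theta> X y"
        using hom_mult[OF Q.eps_hom[OF X] c] \<theta>_eps[OF X] g h by auto
      finally show "\<theta> X (x \<otimes>\<^bsub>val F X\<^esub> y) = \<theta> X x \<otimes>\<^bsub>val G X\<^esub> \<theta> X y" .
    qed
  next
    fix X Y h y assume *: "X \<in> Ob C" "Y \<in> Ob C" "h \<in> arrows C X Y" "y \<in> carrier (val F Y)"
    obtain g where g: "g \<in> arrows C Y A0" "\<epsilon> Y g = y" using P.eps_lift[OF *(2,4)] by blast
    have "\<theta> X (act F X Y h y) = \<delta> X (Comp C X u0 (Comp C X g h))"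
      using P.eps_natural[OF *(1-3) g(1)] \<theta>_eps[OF *(1) comp_closed[OF *(1,2) P.A0 *(3) g(1)]] g(2) by simp
    also have "\<dots> = act G X Y h (\<delta> Y (Comp C Y u0 g))"
      using comp_assoc[OF *(1,2) P.A0 Q.A0 *(3) g(1) u0]
        Q.eps_natural[OF *(1-3) comp_closed[OF *(2) P.A0 Q.A0 g(1) u0]] by simp
    finally show "\<theta> X (act F X Y h y) = act G X Y h (\<theta> Y y)"
      using \<theta>_eps[OF *(2) g(1)] g(2) by simp
  qed (auto simp: \<theta>_def)
  then show ?thesis using \<theta>_eps by (intro that) (auto simp: induces_def)
qed

text \<open>Projectivity of representable functors, in the form of the Yoneda lemma: \<open>u0\<close> is any lift of the image
  of the universal element \<open>\<epsilon>(1)\<close>. Since \<open>u0 f\<close> dies in \<open>G A1\<close>, it factors through \<open>b\<close>, which yields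
  \<open>u1\<close>.\<close>

lemma nat_trans_lift:
  assumes P: "presented_functor C A1 A0 f F \<epsilon>" and Q: "presented_functor C B1 B0 b G \<delta>"
    and \<theta>: "\<theta> \<in> nat_trans C F G"
  obtains u1 u0 where "u1 \<in> arrows C A1 B1" "u0 \<in> arrows C A0 B0"
    "Comp C A1 b u1 = Comp C A1 u0 f" "induces C A0 \<epsilon> \<delta> u0 \<theta>"
proof -
  interpret P: presented_functor C A1 A0 f F \<epsilon> by (rule P)
  interpret Q: presented_functor C B1 B0 b G \<delta> by (rule Q)
  have id: "Ident C A0 \<in> arrows C A0 A0" by (rule ident_closed[OF P.A0])
  have ec: "\<epsilon> A0 (Ident C A0) \<in> carrier (val F A0)" by (rule P.eps_closed[OF P.A0 id])
  obtain u0 where u0: "u0 \<in> arrows C A0 B0" and u0_eq: "\<delta> A0 u0 = \<theta> A0 (\<epsilon> A0 (Ident C A0))"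
    using Q.eps_lift[OF P.A0 nat_trans_closed[OF \<theta> P.A0 ec]] by blast
  have ind: "\<theta> X (\<epsilon> X g) = \<delta> X (Comp C X u0 g)" if X: "X \<in> Ob C" and g: "g \<in> arrows C X A0" for X g
  proof -
    have "\<theta> X (\<epsilon> X g) = \<theta> X (act F X A0 g (\<epsilon> A0 (Ident C A0)))"
      using P.eps_natural[OF X P.A0 g id] ident_left[OF X P.A0 g] by simp
    also have "\<dots> = act G X A0 g (\<delta> A0 u0)"
      unfolding u0_eq by (rule nat_trans_act[OF \<theta> X P.A0 g ec])
    also have "\<dots> = \<delta> X (Comp C X u0 g)" by (rule Q.eps_natural[OF X P.A0 g u0, symmetric])
    finally show ?thesis .
  qed
  have uf: "Comp C A1 u0 f \<in> arrows C A1 B0" by (rule comp_closed[OF P.A1 P.A0 Q.A0 P.f u0])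
  have "\<epsilon> A1 f = \<one>\<^bsub>val F A1\<^esub>"
    using P.eps_kernel[OF P.A1 ident_closed[OF P.A1]] ident_right[OF P.A1 P.A0 P.f] by simp
  then have "\<delta> A1 (Comp C A1 u0 f) = \<theta> A1 \<one>\<^bsub>val F A1\<^esub>" using ind[OF P.A1 P.f] by simp
  also have "\<dots> = \<one>\<^bsub>val G A1\<^esub>"
    by (rule hom_one[OF nat_trans_hom[OF \<theta> P.A1]])
      (simp_all add: comm_group.axioms(2) P.comm_group_val P.A1 Q.comm_group_val)
  finally obtain u1 where "u1 \<in> arrows C A1 B1" "Comp C A1 u0 f = Comp C A1 b u1"
    using Q.ker[OF P.A1 uf] by auto
  then show ?thesis using u0 ind by (intro that[of u1 u0]) (auto simp: induces_def)
qed

lemma induces_ident: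
  assumes P: "presented_functor C A1 A0 f F \<epsilon>"
  shows "induces C A0 \<epsilon> \<epsilon> (Ident C A0) (Ident (fp_cat C) F)"
proof -
  interpret P: presented_functor C A1 A0 f F \<epsilon> by (rule P)
  show ?thesis using ident_left[OF _ P.A0] P.eps_closed by (auto simp: induces_def)
qed

lemma induces_comp:
  assumes P: "presented_functor C A1 A0 f F \<epsilon>" and Q: "presented_functor C B1 B0 b G \<delta>"
    and D0: "D0 \<in> Ob C"
    and u0: "u0 \<in> arrows C A0 B0" and v0: "v0 \<in> arrows C B0 D0"
    and \<theta>: "induces C A0 \<epsilon> \<delta> u0 \<theta>" and \<phi>: "induces C B0 \<delta> \<gamma> v0 \<phi>"
  shows "induces C A0 \<epsilon> \<gamma> (Comp C A0 v0 u0) (Comp (fp_cat C) F \<phi> \<theta>)"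
  unfolding induces_def
proof (intro ballI)
  interpret P: presented_functor C A1 A0 f F \<epsilon> by (rule P)
  interpret Q: presented_functor C B1 B0 b G \<delta> by (rule Q)
  fix X g assume X: "X \<in> Ob C" and g: "g \<in> arrows C X A0"
  show "Comp (fp_cat C) F \<phi> \<theta> X (\<epsilon> X g) = \<gamma> X (Comp C X (Comp C A0 v0 u0) g)"
    using X g \<theta> \<phi> comp_closed[OF X P.A0 Q.A0 g u0] comp_assoc[OF X P.A0 Q.A0 D0 g u0 v0] P.eps_closed[OF X g]
    by (simp add: induces_def compose_def)
qed

text \<open>A transformation out of \<open>F\<close> is determined on the image of \<open>\<epsilon>\<close>.\<close>

lemma induces_unique:
  assumes P: "presented_functor C A1 A0 f F \<epsilon>"
    and "\<theta> \<in> nat_trans C F G" "\<theta>' \<in> nat_trans C F G"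
    and "induces C A0 \<epsilon> \<delta> u0 \<theta>" "induces C A0 \<epsilon> \<delta> u0 \<theta>'"
  shows "\<theta> = \<theta>'"
  by (rule presented_functor.nat_trans_eq_on_eps[OF P assms(2,3)]) (use assms(4,5) in \<open>simp add: induces_def\<close>)

end

section \<open>The image of \<open>\<Phi>\<close>\<close>

text \<open>Every endomorphism \<open>x\<close> has a positive power \<open>w\<close> that is absorbed by an idempotent \<open>w y\<close>, which is the
  projection onto the stable image in Fitting's lemma.\<close>

definition fitting_category :: "('o, 'm) precat \<Rightarrow> bool" where
  "fitting_category C \<longleftrightarrow> (\<forall>A\<in>Ob C. \<forall>x\<in>arrows C A A. \<exists>k>0. \<exists>y\<in>arrows C A A.
     let w = x [^]\<^bsub>end_ring C A\<^esub> (k::nat) in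
       Comp C A (Comp C A w y) (Comp C A w y) = Comp C A w y \<and> Comp C A w (Comp C A w y) = w)"

context preadditive
begin

text \<open>The identity square induces both isomorphisms.\<close>

lemma presented_isomorphic:
  assumes P: "presented_functor C A1 A0 f F \<epsilon>" and Q: "presented_functor C A1 A0 f G \<delta>"
  shows "isomorphic (fp_cat C) F G"
proof -
  interpret P: presented_functor C A1 A0 f F \<epsilon> by (rule P)
  interpret Q: presented_functor C A1 A0 f G \<delta> by (rule Q)
  interpret fp: category_laws "fp_cat C" by (rule category_fp_cat)
  have i1: "Ident C A1 \<in> arrows C A1 A1" and i0: "Ident C A0 \<in> arrows C A0 A0"
    by (simp_all add: ident_closed P.A1 P.A0)
  have sq: "Comp C A1 f (Ident C A1) = Comp C A1 (Ident C A0) f"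
    by (simp add: ident_left[OF P.A1 P.A0 P.f] ident_right[OF P.A1 P.A0 P.f])
  have i00: "Comp C A0 (Ident C A0) (Ident C A0) = Ident C A0" by (rule ident_left[OF P.A0 P.A0 i0])
  obtain \<theta> where \<theta>: "\<theta> \<in> nat_trans C F G" "induces C A0 \<epsilon> \<delta> (Ident C A0) \<theta>"
    by (rule induced_nat_trans[OF P Q i1 i0 sq])
  obtain \<phi> where \<phi>: "\<phi> \<in> nat_trans C G F" "induces C A0 \<delta> \<epsilon> (Ident C A0) \<phi>"
    by (rule induced_nat_trans[OF Q P i1 i0 sq])
  have Ob: "F \<in> Ob (fp_cat C)" "G \<in> Ob (fp_cat C)"
    using P.finitely_presented Q.finitely_presented by simp_all
  have \<theta>a: "\<theta> \<in> arrows (fp_cat C) F G" and \<phi>a: "\<phi> \<in> arrows (fp_cat C) G F" using \<theta> \<phi> by simp_all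
  have "Comp (fp_cat C) F \<phi> \<theta> = Ident (fp_cat C) F"
    by (rule induces_unique[OF P _ _ induces_comp[OF P Q P.A0 i0 i0 \<theta>(2) \<phi>(2), unfolded i00] induces_ident[OF P]])
      (use fp.comp_closed[OF Ob Ob(1) \<theta>a \<phi>a] fp.ident_closed[OF Ob(1)] in \<open>simp_all only: fp_cat_simps(2)\<close>)
  moreover have "Comp (fp_cat C) G \<theta> \<phi> = Ident (fp_cat C) G"
    by (rule induces_unique[OF Q _ _ induces_comp[OF Q P P.A0 i0 i0 \<phi>(2) \<theta>(2), unfolded i00] induces_ident[OF Q]])
      (use fp.comp_closed[OF Ob(2,1,2) \<phi>a \<theta>a] fp.ident_closed[OF Ob(2)] in \<open>simp_all only: fp_cat_simps(2)\<close>)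
  ultimately show ?thesis unfolding isomorphic_def using \<theta>a \<phi>a by blast
qed

lemma presented_transport:
  assumes P: "presented_functor C A1 A0 f G \<epsilon>" and F: "finitely_presented C F"
    and iso: "isomorphic (fp_cat C) F G"
  obtains \<delta> where "presented_functor C A1 A0 f F \<delta>"
proof -
  interpret P: presented_functor C A1 A0 f G \<epsilon> by (rule P)
  obtain i j where i: "i \<in> nat_trans C F G" and j: "j \<in> nat_trans C G F"
    and ji: "Comp (fp_cat C) F j i = Ident (fp_cat C) F" and ij: "Comp (fp_cat C) G i j = Ident (fp_cat C) G"
    using iso unfolding isomorphic_def by (auto simp del: fp_cat_simps(3,4))
  have ji': "j X (i X x) = x" if "X \<in> Ob C" "x \<in> carrier (val F X)" for X x
    using fun_cong[OF fun_cong[OF ji], of X x] that by (simp add: compose_def)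
  have ij': "i X (j X x) = x" if "X \<in> Ob C" "x \<in> carrier (val G X)" for X x
    using fun_cong[OF fun_cong[OF ij], of X x] that by (simp add: compose_def)
  have cF: "contravariant_functor C F" using F by (rule finitely_presented_functor)
  have "contravariant_functor C (rep C A0)"
    unfolding contravariant_functor_def
    using P.A0 by (auto simp: rep_def hom_comm_group ident_right comp_hom_right comp_assoc)
  note \<delta> = nat_trans_comp[OF this P.\<epsilon> j]
  have "presented_functor C A1 A0 f F (\<lambda>X\<in>Ob C. compose (carrier (val (rep C A0) X)) (j X) (\<epsilon> X))"
  proof
    fix X assume X: "X \<in> Ob C"
    have "j X ` carrier (val G X) = carrier (val F X)"
      using nat_trans_closed[OF j X] nat_trans_closed[OF i X] ji'[OF X] by force
    then show "(\<lambda>X\<in>Ob C. compose (carrier (val (rep C A0) X)) (j X) (\<epsilon> X)) X ` arrows C X A0 = carrier (val F X)"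
      using X P.surj[OF X, symmetric] by (simp add: rep_def compose_def image_image cong: image_cong_simp)
    fix g assume g: "g \<in> arrows C X A0"
    have one: "j X \<one>\<^bsub>val G X\<^esub> = \<one>\<^bsub>val F X\<^esub>"
      by (rule hom_one[OF nat_trans_hom[OF j X]])
        (simp_all add: comm_group.axioms(2) P.comm_group_val X contravariant_functor_comm_group[OF cF])
    interpret GX: comm_group "val G X" by (rule P.comm_group_val[OF X])
    have "j X (\<epsilon> X g) = \<one>\<^bsub>val F X\<^esub> \<longleftrightarrow> \<epsilon> X g = \<one>\<^bsub>val G X\<^esub>"
      using one ij'[OF X P.eps_closed[OF X g]] ij'[OF X GX.one_closed] by metis
    then show "(\<lambda>X\<in>Ob C. compose (carrier (val (rep C A0) X)) (j X) (\<epsilon> X)) X g = \<one>\<^bsub>val F X\<^esub>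
        \<longleftrightarrow> (\<exists>h\<in>arrows C X A1. g = Comp C X f h)"
      using X g P.ker[OF X g] by (simp add: rep_def compose_def)
  qed (use P.A1 P.A0 P.f cF \<delta> in simp_all)
  then show ?thesis by (rule that)
qed

lemma Phi_image_iff:
  assumes \<C>: "\<C> \<subseteq> Ob (maps_cat C)"
  shows "F \<in> Phi_image C \<C> \<longleftrightarrow>
    (\<exists>A1 A0 f \<epsilon>. (A1, A0, f) \<in> \<C> \<and> presented_functor C A1 A0 f F \<epsilon>)"
proof
  assume "F \<in> Phi_image C \<C>"
  then obtain A1 A0 f where A: "(A1, A0, f) \<in> \<C>" and F: "finitely_presented C F"
    and iso: "isomorphic (fp_cat C) F (Phi C (A1, A0, f))"
    unfolding Phi_image_def by auto
  have "(A1, A0, f) \<in> Ob (maps_cat C)" using A \<C> by blast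
  then have "A1 \<in> Ob C" "A0 \<in> Ob C" "f \<in> arrows C A1 A0" by simp_all
  then show "\<exists>A1 A0 f \<epsilon>. (A1, A0, f) \<in> \<C> \<and> presented_functor C A1 A0 f F \<epsilon>"
    using presented_transport[OF Phi_presented F iso] A by metis
next
  assume "\<exists>A1 A0 f \<epsilon>. (A1, A0, f) \<in> \<C> \<and> presented_functor C A1 A0 f F \<epsilon>"
  then obtain A1 A0 f \<epsilon> where A: "(A1, A0, f) \<in> \<C>" and P: "presented_functor C A1 A0 f F \<epsilon>" by blast
  interpret P: presented_functor C A1 A0 f F \<epsilon> by (rule P)
  show "F \<in> Phi_image C \<C>"
    unfolding Phi_image_def using A P.finitely_presented
      presented_isomorphic[OF P Phi_presented[OF P.A1 P.A0 P.f]] by (auto simp del: fp_cat_simps(2-))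
qed

lemma contravariantly_finite_Phi_image:
  assumes \<C>: "\<C> \<subseteq> Ob (maps_cat C)" and fin: "contravariantly_finite (maps_cat C) \<C>"
  shows "contravariantly_finite (fp_cat C) (Phi_image C \<C>)"
  unfolding contravariantly_finite_def
proof
  interpret fp: category_laws "fp_cat C" by (rule category_fp_cat)
  fix M assume M: "M \<in> Ob (fp_cat C)"
  then have "finitely_presented C M" by simp
  then obtain B1 B0 b \<delta> where Q: "presented_functor C B1 B0 b M \<delta>" by (rule finitely_presented_presented)
  interpret Q: presented_functor C B1 B0 b M \<delta> by (rule Q)
  have B: "(B1, B0, b) \<in> Ob (maps_cat C)" using Q.A1 Q.A0 Q.f by simp
  obtain A u where "right_approximation (maps_cat C) \<C> (B1, B0, b) A u"
    using fin B unfolding contravariantly_finite_def by blast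
  moreover obtain A1 A0 f u1 u0 where eq: "A = (A1, A0, f)" "u = (u1, u0)" by (metis prod.exhaust)
  ultimately have A: "(A1, A0, f) \<in> \<C>" and u: "(u1, u0) \<in> arrows (maps_cat C) (A1, A0, f) (B1, B0, b)"
    and fac: "\<And>D v. \<lbrakk>D \<in> \<C>; v \<in> arrows (maps_cat C) D (B1, B0, b)\<rbrakk> \<Longrightarrow>
      \<exists>w\<in>arrows (maps_cat C) D (A1, A0, f). v = Comp (maps_cat C) D (u1, u0) w"
    unfolding right_approximation_def by blast+
  have A': "A1 \<in> Ob C" "A0 \<in> Ob C" "f \<in> arrows C A1 A0" using subsetD[OF \<C> A] by simp_all
  obtain F \<epsilon> where P: "presented_functor C A1 A0 f F \<epsilon>" and "F = Phi C (A1, A0, f)"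
    using Phi_presented[OF A'] by blast
  interpret P: presented_functor C A1 A0 f F \<epsilon> by (rule P)
  have F: "F \<in> Ob (fp_cat C)" using P.finitely_presented by simp
  have u': "u1 \<in> arrows C A1 B1" "u0 \<in> arrows C A0 B0" "Comp C A1 b u1 = Comp C A1 u0 f" using u by simp_all
  obtain \<theta> where \<theta>: "\<theta> \<in> nat_trans C F M" "induces C A0 \<epsilon> \<delta> u0 \<theta>"
    by (rule induced_nat_trans[OF P Q u'])
  have "\<exists>h\<in>arrows (fp_cat C) G F. g = Comp (fp_cat C) G \<theta> h"
    if G: "G \<in> Phi_image C \<C>" and g: "g \<in> arrows (fp_cat C) G M" for G g
  proof -
    obtain D1 D0 d \<gamma> where D: "(D1, D0, d) \<in> \<C>" and S: "presented_functor C D1 D0 d G \<gamma>"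
      using G unfolding Phi_image_iff[OF \<C>] by blast
    interpret S: presented_functor C D1 D0 d G \<gamma> by (rule S)
    have G': "G \<in> Ob (fp_cat C)" using S.finitely_presented by simp
    have "g \<in> nat_trans C G M" using g by simp
    then obtain v1 v0 where v: "v1 \<in> arrows C D1 B1" "v0 \<in> arrows C D0 B0" "Comp C D1 b v1 = Comp C D1 v0 d"
      and gv: "induces C D0 \<gamma> \<delta> v0 g" by (rule nat_trans_lift[OF S Q])
    have "(v1, v0) \<in> arrows (maps_cat C) (D1, D0, d) (B1, B0, b)" using v by simp
    from fac[OF D this] obtain w1 w0 where w: "w1 \<in> arrows C D1 A1" "w0 \<in> arrows C D0 A0"
        "Comp C D1 f w1 = Comp C D1 w0 d"
      and vw: "v0 = Comp C D0 u0 w0" by auto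
    obtain h where h: "h \<in> nat_trans C G F" "induces C D0 \<gamma> \<epsilon> w0 h"
      by (rule induced_nat_trans[OF S P w])
    have "Comp (fp_cat C) G \<theta> h \<in> arrows (fp_cat C) G M"
      by (rule fp.comp_closed[OF G' F M]) (use h \<theta> in simp_all)
    then have "g = Comp (fp_cat C) G \<theta> h"
      using induces_unique[OF S _ _ gv[unfolded vw] induces_comp[OF S P Q.A0 w(2) u'(2) h(2) \<theta>(2)]] g
      by (simp only: fp_cat_simps(2))
    then show ?thesis using h(1) by (auto simp only: fp_cat_simps(2))
  qed
  moreover have "F \<in> Phi_image C \<C>" unfolding Phi_image_iff[OF \<C>] using A P by blast
  ultimately show "\<exists>X f. right_approximation (fp_cat C) (Phi_image C \<C>) M X f"
    unfolding right_approximation_def using \<theta>(1) unfolding fp_cat_simps(2) by blast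
qed

lemma covariantly_finite_Phi_image:
  assumes \<C>: "\<C> \<subseteq> Ob (maps_cat C)" and fin: "covariantly_finite (maps_cat C) \<C>"
  shows "covariantly_finite (fp_cat C) (Phi_image C \<C>)"
  unfolding covariantly_finite_def
proof
  interpret fp: category_laws "fp_cat C" by (rule category_fp_cat)
  fix M assume M: "M \<in> Ob (fp_cat C)"
  then have "finitely_presented C M" by simp
  then obtain B1 B0 b \<delta> where Q: "presented_functor C B1 B0 b M \<delta>" by (rule finitely_presented_presented)
  interpret Q: presented_functor C B1 B0 b M \<delta> by (rule Q)
  have B: "(B1, B0, b) \<in> Ob (maps_cat C)" using Q.A1 Q.A0 Q.f by simp
  obtain A u where "left_approximation (maps_cat C) \<C> (B1, B0, b) A u"
    using fin B unfolding covariantly_finite_def by blast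
  moreover obtain A1 A0 f u1 u0 where eq: "A = (A1, A0, f)" "u = (u1, u0)" by (metis prod.exhaust)
  ultimately have A: "(A1, A0, f) \<in> \<C>" and u: "(u1, u0) \<in> arrows (maps_cat C) (B1, B0, b) (A1, A0, f)"
    and fac: "\<And>D v. \<lbrakk>D \<in> \<C>; v \<in> arrows (maps_cat C) (B1, B0, b) D\<rbrakk> \<Longrightarrow>
      \<exists>w\<in>arrows (maps_cat C) (A1, A0, f) D. v = Comp (maps_cat C) (B1, B0, b) w (u1, u0)"
    unfolding left_approximation_def by blast+
  have A': "A1 \<in> Ob C" "A0 \<in> Ob C" "f \<in> arrows C A1 A0" using subsetD[OF \<C> A] by simp_all
  obtain F \<epsilon> where P: "presented_functor C A1 A0 f F \<epsilon>" and "F = Phi C (A1, A0, f)"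
    using Phi_presented[OF A'] by blast
  interpret P: presented_functor C A1 A0 f F \<epsilon> by (rule P)
  have F: "F \<in> Ob (fp_cat C)" using P.finitely_presented by simp
  have u': "u1 \<in> arrows C B1 A1" "u0 \<in> arrows C B0 A0" "Comp C B1 f u1 = Comp C B1 u0 b" using u by simp_all
  obtain \<theta> where \<theta>: "\<theta> \<in> nat_trans C M F" "induces C B0 \<delta> \<epsilon> u0 \<theta>"
    by (rule induced_nat_trans[OF Q P u'])
  have "\<exists>h\<in>arrows (fp_cat C) F G. g = Comp (fp_cat C) M h \<theta>"
    if G: "G \<in> Phi_image C \<C>" and g: "g \<in> arrows (fp_cat C) M G" for G g
  proof -
    obtain D1 D0 d \<gamma> where D: "(D1, D0, d) \<in> \<C>" and S: "presented_functor C D1 D0 d G \<gamma>"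
      using G unfolding Phi_image_iff[OF \<C>] by blast
    interpret S: presented_functor C D1 D0 d G \<gamma> by (rule S)
    have G': "G \<in> Ob (fp_cat C)" using S.finitely_presented by simp
    have "g \<in> nat_trans C M G" using g by simp
    then obtain v1 v0 where v: "v1 \<in> arrows C B1 D1" "v0 \<in> arrows C B0 D0" "Comp C B1 d v1 = Comp C B1 v0 b"
      and gv: "induces C B0 \<delta> \<gamma> v0 g" by (rule nat_trans_lift[OF Q S])
    have "(v1, v0) \<in> arrows (maps_cat C) (B1, B0, b) (D1, D0, d)" using v by simp
    from fac[OF D this] obtain w1 w0 where w: "w1 \<in> arrows C A1 D1" "w0 \<in> arrows C A0 D0"
        "Comp C A1 d w1 = Comp C A1 w0 f"
      and vw: "v0 = Comp C B0 w0 u0" by auto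
    obtain h where h: "h \<in> nat_trans C F G" "induces C A0 \<epsilon> \<gamma> w0 h"
      by (rule induced_nat_trans[OF P S w])
    have "Comp (fp_cat C) M h \<theta> \<in> arrows (fp_cat C) M G"
      by (rule fp.comp_closed[OF M F G']) (use h \<theta> in simp_all)
    then have "g = Comp (fp_cat C) M h \<theta>"
      using induces_unique[OF Q _ _ gv[unfolded vw] induces_comp[OF Q P S.A0 u'(2) w(2) \<theta>(2) h(2)]] g
      by (simp only: fp_cat_simps(2))
    then show ?thesis using h(1) by (auto simp only: fp_cat_simps(2))
  qed
  moreover have "F \<in> Phi_image C \<C>" unfolding Phi_image_iff[OF \<C>] using A P by blast
  ultimately show "\<exists>X f. left_approximation (fp_cat C) (Phi_image C \<C>) M X f"
    unfolding left_approximation_def using \<theta>(1) unfolding fp_cat_simps(2) by blast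
qed

text \<open>If \<open>x\<close> lies over \<open>e\<close>, so does every positive power \<open>w\<close>. With \<open>\<eta>\<close> below \<open>y\<close>, the idempotent \<open>p = w y\<close>
  lies over \<open>e \<eta>\<close>, and \<open>w = w p\<close> lies over \<open>e (e \<eta>) = e \<eta>\<close> as well as over \<open>e\<close>. Hence
  \<open>e \<eta> = e\<close>.\<close>

lemma idempotent_lifts:
  assumes fit: "fitting_category (maps_cat C)"
    and P: "presented_functor C A1 A0 f F \<epsilon>"
    and e: "e \<in> arrows (fp_cat C) F F" and ee: "Comp (fp_cat C) F e e = e"
  obtains p where "p \<in> arrows (maps_cat C) (A1, A0, f) (A1, A0, f)"
    "Comp (maps_cat C) (A1, A0, f) p p = p" "induces C A0 \<epsilon> \<epsilon> (snd p) e"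
proof -
  interpret P: presented_functor C A1 A0 f F \<epsilon> by (rule P)
  interpret fp: category_laws "fp_cat C" by (rule category_fp_cat)
  interpret M: preadditive "maps_cat C" by (rule preadditive_maps_cat)
  let ?A = "(A1, A0, f)" and ?E = "end_ring (maps_cat C) (A1, A0, f)"
  have A: "?A \<in> Ob (maps_cat C)" using P.A1 P.A0 P.f by simp
  interpret E: ring ?E by (rule M.ring_end_ring[OF A])
  have F: "F \<in> Ob (fp_cat C)" using P.finitely_presented by simp
  have comp: "induces C A0 \<epsilon> \<epsilon> (snd (Comp (maps_cat C) ?A v u)) (Comp (fp_cat C) F \<phi> \<theta>)"
    if "u \<in> arrows (maps_cat C) ?A ?A" "v \<in> arrows (maps_cat C) ?A ?A"
      "induces C A0 \<epsilon> \<epsilon> (snd u) \<theta>" "induces C A0 \<epsilon> \<epsilon> (snd v) \<phi>" for u v \<theta> \<phi>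
    using that by (cases u, cases v) (auto simp del: fp_cat_simps intro!: induces_comp[OF P P P.A0])
  have "e \<in> nat_trans C F F" using e by simp
  then obtain x1 x0 where "x1 \<in> arrows C A1 A1" "x0 \<in> arrows C A0 A0" "Comp C A1 f x1 = Comp C A1 x0 f"
    and x0: "induces C A0 \<epsilon> \<epsilon> x0 e" by (rule nat_trans_lift[OF P P])
  then have x: "(x1, x0) \<in> arrows (maps_cat C) ?A ?A" by simp
  define x where "x = (x1, x0)"
  have x: "x \<in> arrows (maps_cat C) ?A ?A" and xe: "induces C A0 \<epsilon> \<epsilon> (snd x) e"
    using x x0 by (simp_all add: x_def)
  have pow: "x [^]\<^bsub>?E\<^esub> (n::nat) \<in> arrows (maps_cat C) ?A ?A" for n
    using E.nat_pow_closed[of x n] x by simp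
  have pow_e: "induces C A0 \<epsilon> \<epsilon> (snd (x [^]\<^bsub>?E\<^esub> Suc n)) e" for n
  proof (induction n)
    case 0
    have "x [^]\<^bsub>?E\<^esub> Suc 0 = x" using E.l_one[of x] x by simp
    then show ?case using xe by simp
  next
    case (Suc n)
    have "x [^]\<^bsub>?E\<^esub> Suc (Suc n) = Comp (maps_cat C) ?A (x [^]\<^bsub>?E\<^esub> Suc n) x" by simp
    then show ?case using comp[OF x pow[of "Suc n"] xe Suc] ee by (simp only:)
  qed
  obtain k y where "k > 0" and y: "y \<in> arrows (maps_cat C) ?A ?A"
    and "let w = x [^]\<^bsub>?E\<^esub> (k::nat) in
       Comp (maps_cat C) ?A (Comp (maps_cat C) ?A w y) (Comp (maps_cat C) ?A w y) = Comp (maps_cat C) ?A w y \<and>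
       Comp (maps_cat C) ?A w (Comp (maps_cat C) ?A w y) = w"
    using fit A x unfolding fitting_category_def by blast
  moreover define w where "w = x [^]\<^bsub>?E\<^esub> k"
  ultimately have pp: "Comp (maps_cat C) ?A (Comp (maps_cat C) ?A w y) (Comp (maps_cat C) ?A w y) = Comp (maps_cat C) ?A w y"
    and wp: "Comp (maps_cat C) ?A w (Comp (maps_cat C) ?A w y) = w" by (simp_all add: Let_def)
  have w: "w \<in> arrows (maps_cat C) ?A ?A" unfolding w_def by (rule pow)
  have we: "induces C A0 \<epsilon> \<epsilon> (snd w) e"
    using pow_e[of "k - 1"] \<open>k > 0\<close> by (simp add: w_def del: nat_pow_Suc)
  define p where "p = Comp (maps_cat C) ?A w y"
  have p: "p \<in> arrows (maps_cat C) ?A ?A" unfolding p_def by (rule M.comp_closed[OF A A A y w])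
  obtain y1 y0 where y_eq: "y = (y1, y0)" by (cases y)
  have y': "y1 \<in> arrows C A1 A1" "y0 \<in> arrows C A0 A0" "Comp C A1 f y1 = Comp C A1 y0 f" using y y_eq by simp_all
  obtain \<eta> where \<eta>: "\<eta> \<in> nat_trans C F F" "induces C A0 \<epsilon> \<epsilon> y0 \<eta>"
    by (rule induced_nat_trans[OF P P y'])
  have \<eta>a: "\<eta> \<in> arrows (fp_cat C) F F" using \<eta> by simp
  have e\<eta>: "Comp (fp_cat C) F e \<eta> \<in> arrows (fp_cat C) F F" by (rule fp.comp_closed[OF F F F \<eta>a e])
  have pe: "induces C A0 \<epsilon> \<epsilon> (snd p) (Comp (fp_cat C) F e \<eta>)"
    unfolding p_def by (rule comp[OF y w _ we]) (use \<eta> y_eq in simp)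
  have "induces C A0 \<epsilon> \<epsilon> (snd w) (Comp (fp_cat C) F e (Comp (fp_cat C) F e \<eta>))"
    using comp[OF p w pe we] wp by (simp add: p_def del: fp_cat_simps)
  moreover have "Comp (fp_cat C) F e (Comp (fp_cat C) F e \<eta>) = Comp (fp_cat C) F e \<eta>"
    using fp.comp_assoc[OF F F F F \<eta>a e e] unfolding ee by (rule sym)
  ultimately have "Comp (fp_cat C) F e \<eta> = e"
    using induces_unique[OF P _ _ _ we] e\<eta> e by (simp only: fp_cat_simps(2))
  then have "induces C A0 \<epsilon> \<epsilon> (snd p) e" using pe by (simp only:)
  then show ?thesis using p pp unfolding p_def by (intro that)
qed

text \<open>For summands: if \<open>q i = 1\<close> exhibits \<open>Y\<close> as a summand of \<open>X\<close>, lift \<open>e = i q\<close> to an idempotent \<open>p = j r\<close>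
  that splits through a summand \<open>B\<close> of \<open>A\<close>. Then \<open>\<Phi>(r) i\<close> and \<open>q \<Phi>(j)\<close> are inverse isomorphisms
  between \<open>Y\<close> and \<open>\<Phi>(B)\<close>.\<close>

lemma subcategory_Phi_image:
  assumes split: "idempotents_split C" and fit: "fitting_category (maps_cat C)"
    and sub: "subcategory (maps_cat C) \<C>"
  shows "subcategory (fp_cat C) (Phi_image C \<C>)"
  unfolding subcategory_def
proof (intro conjI ballI impI)
  interpret fp: category_laws "fp_cat C" by (rule category_fp_cat)
  interpret M: preadditive "maps_cat C" by (rule preadditive_maps_cat)
  have \<C>: "\<C> \<subseteq> Ob (maps_cat C)" using sub unfolding subcategory_def by blast
  show "Phi_image C \<C> \<subseteq> Ob (fp_cat C)" unfolding Phi_image_def by blast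
  {
    fix X Y assume X: "X \<in> Phi_image C \<C>" and Y: "Y \<in> Ob (fp_cat C)" and iso: "isomorphic (fp_cat C) Y X"
    obtain A where A: "A \<in> \<C>" "isomorphic (fp_cat C) X (Phi C A)" and X': "X \<in> Ob (fp_cat C)"
      using X unfolding Phi_image_def by blast
    obtain A1 A0 f where eq: "A = (A1, A0, f)" by (metis prod.exhaust)
    have "presented_functor C A1 A0 f (Phi C A)
       (\<lambda>X\<in>Ob C. \<lambda>g\<in>arrows C X A0. (Comp C X f ` arrows C X A1) #>\<^bsub>Hom C X A0\<^esub> g)"
      unfolding eq using subsetD[OF \<C> A(1)] eq by (intro Phi_presented) simp_all
    then have "Phi C A \<in> Ob (fp_cat C)" using presented_functor.finitely_presented by fastforce
    then have "isomorphic (fp_cat C) Y (Phi C A)" by (rule fp.isomorphic_trans[OF Y X' _ iso A(2)])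
    then show "Y \<in> Phi_image C \<C>" unfolding Phi_image_def using Y A(1) by blast
  next
    fix X Y assume X: "X \<in> Phi_image C \<C>" and Y: "Y \<in> Ob (fp_cat C)"
      and summand: "direct_summand (fp_cat C) Y X"
    obtain A1 A0 f \<epsilon> where A: "(A1, A0, f) \<in> \<C>" and P: "presented_functor C A1 A0 f X \<epsilon>"
      using X unfolding Phi_image_iff[OF \<C>] by blast
    interpret P: presented_functor C A1 A0 f X \<epsilon> by (rule P)
    let ?A = "(A1, A0, f)"
    have A': "?A \<in> Ob (maps_cat C)" using A \<C> by blast
    have X': "X \<in> Ob (fp_cat C)" using P.finitely_presented by simp
    obtain i q where i: "i \<in> arrows (fp_cat C) Y X" and q: "q \<in> arrows (fp_cat C) X Y"
      and qi: "Comp (fp_cat C) Y q i = Ident (fp_cat C) Y"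
      using summand unfolding direct_summand_def by blast
    define e where "e = Comp (fp_cat C) X i q"
    have e: "e \<in> arrows (fp_cat C) X X" unfolding e_def by (rule fp.comp_closed[OF X' Y X' q i])
    have qe: "Comp (fp_cat C) X q e = q"
      unfolding e_def using fp.comp_assoc[OF X' Y X' Y q i q] qi fp.ident_left[OF X' Y q] by (simp only:)
    have ee: "Comp (fp_cat C) X e e = e"
      using fp.comp_assoc[OF X' X' Y X' e q i] unfolding e_def[symmetric] qe .
    obtain p where p: "p \<in> arrows (maps_cat C) ?A ?A" "Comp (maps_cat C) ?A p p = p"
      and pe: "induces C A0 \<epsilon> \<epsilon> (snd p) e" by (rule idempotent_lifts[OF fit P e ee])
    obtain B j r where B: "B \<in> Ob (maps_cat C)" and j: "j \<in> arrows (maps_cat C) B ?A"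
      and r: "r \<in> arrows (maps_cat C) ?A B" and rj: "Comp (maps_cat C) B r j = Ident (maps_cat C) B"
      and jr: "Comp (maps_cat C) ?A j r = p" and BA: "direct_summand (maps_cat C) B ?A"
      using M.split_direct_summand[OF idempotents_split_maps_cat[OF split] A' p] by blast
    have BC: "B \<in> \<C>" using sub A B BA unfolding subcategory_def by blast
    obtain B1 B0 b j1 j0 r1 r0 where eq: "B = (B1, B0, b)" "j = (j1, j0)" "r = (r1, r0)" by (metis prod.exhaust)
    have h: "B1 \<in> Ob C" "B0 \<in> Ob C" "b \<in> arrows C B1 B0" using B unfolding eq by simp_all
    have j': "j1 \<in> arrows C B1 A1" "j0 \<in> arrows C B0 A0" "Comp C B1 f j1 = Comp C B1 j0 b"
      and r': "r1 \<in> arrows C A1 B1" "r0 \<in> arrows C A0 B0" "Comp C A1 b r1 = Comp C A1 r0 f"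
      and rj': "Comp C B0 r0 j0 = Ident C B0" and jr': "Comp C A0 j0 r0 = snd p"
      using j r rj jr unfolding eq by auto
    obtain G \<delta> where Q: "presented_functor C B1 B0 b G \<delta>" and G_eq: "G = Phi C B"
      using Phi_presented[OF h] eq by blast
    interpret Q: presented_functor C B1 B0 b G \<delta> by (rule Q)
    have G: "G \<in> Ob (fp_cat C)" using Q.finitely_presented by simp
    obtain \<theta> where \<theta>: "\<theta> \<in> nat_trans C G X" "induces C B0 \<delta> \<epsilon> j0 \<theta>"
      by (rule induced_nat_trans[OF Q P j'])
    obtain \<rho> where \<rho>: "\<rho> \<in> nat_trans C X G" "induces C A0 \<epsilon> \<delta> r0 \<rho>"
      by (rule induced_nat_trans[OF P Q r'])
    have \<theta>a: "\<theta> \<in> arrows (fp_cat C) G X" and \<rho>a: "\<rho> \<in> arrows (fp_cat C) X G" using \<theta> \<rho> by simp_all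
    have \<theta>\<rho>: "Comp (fp_cat C) X \<theta> \<rho> = e"
      using induces_unique[OF P _ _ _ pe] induces_comp[OF P Q P.A0 r'(2) j'(2) \<rho>(2) \<theta>(2), unfolded jr']
        fp.comp_closed[OF X' G X' \<rho>a \<theta>a] e by (simp only: fp_cat_simps(2))
    have \<rho>\<theta>: "Comp (fp_cat C) G \<rho> \<theta> = Ident (fp_cat C) G"
      using induces_unique[OF Q _ _ _ induces_ident[OF Q]]
        induces_comp[OF Q P Q.A0 j'(2) r'(2) \<theta>(2) \<rho>(2), unfolded rj']
        fp.comp_closed[OF G X' G \<theta>a \<rho>a] fp.ident_closed[OF G] by (simp only: fp_cat_simps(2))
    define s where "s = Comp (fp_cat C) Y \<rho> i"
    define t where "t = Comp (fp_cat C) G q \<theta>"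
    have s: "s \<in> arrows (fp_cat C) Y G" unfolding s_def by (rule fp.comp_closed[OF Y X' G i \<rho>a])
    have t: "t \<in> arrows (fp_cat C) G Y" unfolding t_def by (rule fp.comp_closed[OF G X' Y \<theta>a q])
    have "Comp (fp_cat C) Y t s = Comp (fp_cat C) Y q (Comp (fp_cat C) Y \<theta> s)"
      unfolding t_def by (rule fp.comp_assoc[OF Y G X' Y s \<theta>a q])
    also have "Comp (fp_cat C) Y \<theta> s = Comp (fp_cat C) Y e i"
      unfolding s_def \<theta>\<rho>[symmetric] by (rule fp.comp_assoc[OF Y X' G X' i \<rho>a \<theta>a, symmetric])
    also have "Comp (fp_cat C) Y q (Comp (fp_cat C) Y e i) = Comp (fp_cat C) Y (Comp (fp_cat C) X q e) i"
      by (rule fp.comp_assoc[OF Y X' X' Y i e q, symmetric])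
    finally have ts: "Comp (fp_cat C) Y t s = Ident (fp_cat C) Y" unfolding qe qi .
    have "Comp (fp_cat C) G s t = Comp (fp_cat C) G \<rho> (Comp (fp_cat C) G i t)"
      unfolding s_def by (rule fp.comp_assoc[OF G Y X' G t i \<rho>a])
    also have "Comp (fp_cat C) G i t = Comp (fp_cat C) G e \<theta>"
      unfolding t_def e_def by (rule fp.comp_assoc[OF G X' Y X' \<theta>a q i, symmetric])
    also have "\<dots> = Comp (fp_cat C) G \<theta> (Comp (fp_cat C) G \<rho> \<theta>)"
      unfolding \<theta>\<rho>[symmetric] by (rule fp.comp_assoc[OF G X' G X' \<theta>a \<rho>a \<theta>a])
    also have "\<dots> = \<theta>" unfolding \<rho>\<theta> by (rule fp.ident_right[OF G X' \<theta>a])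
    finally have st: "Comp (fp_cat C) G s t = Ident (fp_cat C) G" unfolding \<rho>\<theta> .
    have "isomorphic (fp_cat C) Y (Phi C B)"
      unfolding isomorphic_def G_eq[symmetric] using s t ts st by blast
    then show "Y \<in> Phi_image C \<C>" unfolding Phi_image_def using Y BC by blast
  }
qed

end

section \<open>Finitely generated modules over an artin algebra\<close>

lemma hom_moduleI:
  assumes "\<And>x. x \<in> carrier M \<Longrightarrow> f x \<in> carrier N" "f \<in> extensional (carrier M)"
    and "\<And>x y. \<lbrakk>x \<in> carrier M; y \<in> carrier M\<rbrakk> \<Longrightarrow> f (x \<oplus>\<^bsub>M\<^esub> y) = f x \<oplus>\<^bsub>N\<^esub> f y"
    and "\<And>a x. \<lbrakk>a \<in> carrier R; x \<in> carrier M\<rbrakk> \<Longrightarrow> f (a \<odot>\<^bsub>M\<^esub> x) = a \<odot>\<^bsub>N\<^esub> f x"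
  shows "f \<in> hom_module R M N"
  using assms by (auto simp: hom_module_def hom_def)

lemma hom_moduleD:
  assumes "f \<in> hom_module R M N"
  shows "x \<in> carrier M \<Longrightarrow> f x \<in> carrier N" "f \<in> extensional (carrier M)"
    and "\<lbrakk>x \<in> carrier M; y \<in> carrier M\<rbrakk> \<Longrightarrow> f (x \<oplus>\<^bsub>M\<^esub> y) = f x \<oplus>\<^bsub>N\<^esub> f y"
    and "\<lbrakk>a \<in> carrier R; x \<in> carrier M\<rbrakk> \<Longrightarrow> f (a \<odot>\<^bsub>M\<^esub> x) = a \<odot>\<^bsub>N\<^esub> f x"
  using assms by (auto simp: hom_module_def hom_def)

lemma hom_module_zero:
  assumes "left_module R M" "left_module R N" "f \<in> hom_module R M N"
  shows "f \<zero>\<^bsub>M\<^esub> = \<zero>\<^bsub>N\<^esub>"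
proof -
  interpret M: left_module R M by fact
  interpret N: left_module R N by fact
  have "f \<zero>\<^bsub>M\<^esub> = f (\<zero>\<^bsub>R\<^esub> \<odot>\<^bsub>M\<^esub> \<zero>\<^bsub>M\<^esub>)" by (simp add: M.smult_l_null)
  also have "\<dots> = \<zero>\<^bsub>R\<^esub> \<odot>\<^bsub>N\<^esub> f \<zero>\<^bsub>M\<^esub>" by (rule hom_moduleD(4)[OF assms(3)]) simp_all
  also have "\<dots> = \<zero>\<^bsub>N\<^esub>" by (simp add: N.smult_l_null hom_moduleD(1)[OF assms(3)])
  finally show ?thesis .
qed

lemma mod_cat_simps [simp]:
  "M \<in> Ob (mod_cat \<Lambda>) \<longleftrightarrow> left_module \<Lambda> M \<and> fin_gen \<Lambda> M"
  "arrows (mod_cat \<Lambda>) M N = hom_module \<Lambda> M N"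
  "f \<otimes>\<^bsub>Hom (mod_cat \<Lambda>) M N\<^esub> g = (\<lambda>x\<in>carrier M. f x \<oplus>\<^bsub>N\<^esub> g x)"
  "\<one>\<^bsub>Hom (mod_cat \<Lambda>) M N\<^esub> = (\<lambda>x\<in>carrier M. \<zero>\<^bsub>N\<^esub>)"
  "Comp (mod_cat \<Lambda>) M g f = compose (carrier M) g f"
  "Ident (mod_cat \<Lambda>) M = (\<lambda>x\<in>carrier M. x)"
  by (simp_all add: mod_cat_def)

lemma hom_module_compose:
  assumes "f \<in> hom_module R M N" "g \<in> hom_module R N P" and "left_module R M"
  shows "compose (carrier M) g f \<in> hom_module R M P"
proof -
  interpret M: left_module R M by fact
  show ?thesis
    by (rule hom_moduleI) (auto simp: compose_def hom_moduleD[OF assms(1)] hom_moduleD[OF assms(2)] M.smult_closed)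
qed

lemma preadditive_mod_cat: "preadditive (mod_cat \<Lambda>)"
proof (intro preadditive.intro category_laws.intro preadditive_axioms.intro)
  fix M :: "('a, 'a elt) module" assume "M \<in> Ob (mod_cat \<Lambda>)"
  then interpret M: left_module \<Lambda> M by simp
  show "Ident (mod_cat \<Lambda>) M \<in> arrows (mod_cat \<Lambda>) M M"
    by (auto intro!: hom_moduleI simp: M.smult_closed)
next
  fix M N :: "('a, 'a elt) module" assume *: "M \<in> Ob (mod_cat \<Lambda>)" "N \<in> Ob (mod_cat \<Lambda>)"
  interpret M: left_module \<Lambda> M using * by simp
  interpret N: left_module \<Lambda> N using * by simp
  note D = hom_moduleD
  show "comm_group (Hom (mod_cat \<Lambda>) M N)"
  proof (rule comm_groupI)
    fix f assume "f \<in> arrows (mod_cat \<Lambda>) M N"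
    then have f: "f \<in> hom_module \<Lambda> M N" by simp
    have "(\<lambda>x\<in>carrier M. \<ominus>\<^bsub>N\<^esub> f x) \<in> hom_module \<Lambda> M N"
    proof (rule hom_moduleI)
      fix a x assume "a \<in> carrier \<Lambda>" "x \<in> carrier M"
      moreover have "(\<ominus>\<^bsub>\<Lambda>\<^esub> \<one>\<^bsub>\<Lambda>\<^esub>) \<odot>\<^bsub>N\<^esub> y = \<ominus>\<^bsub>N\<^esub> y" if "y \<in> carrier N" for y
        using that by (simp add: N.smult_l_minus N.smult_one)
      moreover have "a \<odot>\<^bsub>N\<^esub> (\<ominus>\<^bsub>N\<^esub> y) = \<ominus>\<^bsub>N\<^esub> (a \<odot>\<^bsub>N\<^esub> y)" if "a \<in> carrier \<Lambda>" "y \<in> carrier N" for a y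
        using that N.smult_r_distr[of a "\<ominus>\<^bsub>N\<^esub> y" y]
        by (intro N.M.minus_equality[symmetric]) (simp_all add: N.smult_closed N.smult_r_null N.M.l_neg)
      ultimately show "(\<lambda>x\<in>carrier M. \<ominus>\<^bsub>N\<^esub> f x) (a \<odot>\<^bsub>M\<^esub> x) = a \<odot>\<^bsub>N\<^esub> (\<lambda>x\<in>carrier M. \<ominus>\<^bsub>N\<^esub> f x) x"
        by (simp add: M.smult_closed D[OF f])
    qed (auto simp: D[OF f] N.M.minus_add)
    moreover have "(\<lambda>x\<in>carrier M. \<ominus>\<^bsub>N\<^esub> f x) \<otimes>\<^bsub>Hom (mod_cat \<Lambda>) M N\<^esub> f = \<one>\<^bsub>Hom (mod_cat \<Lambda>) M N\<^esub>"
      by (simp add: fun_eq_iff D[OF f] N.M.l_neg)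
    ultimately show "\<exists>g\<in>arrows (mod_cat \<Lambda>) M N. g \<otimes>\<^bsub>Hom (mod_cat \<Lambda>) M N\<^esub> f = \<one>\<^bsub>Hom (mod_cat \<Lambda>) M N\<^esub>"
      unfolding mod_cat_simps(2) by blast
  next
    fix f assume "f \<in> arrows (mod_cat \<Lambda>) M N"
    then have f: "f \<in> hom_module \<Lambda> M N" by simp
    show "\<one>\<^bsub>Hom (mod_cat \<Lambda>) M N\<^esub> \<otimes>\<^bsub>Hom (mod_cat \<Lambda>) M N\<^esub> f = f"
      using D(2)[OF f] by (simp add: fun_eq_iff D[OF f] extensional_def)
  qed (auto intro!: hom_moduleI restrict_ext
      simp: D M.smult_closed N.smult_closed N.smult_r_distr N.smult_r_null N.M.a_ac)
next
  fix M N P :: "('a, 'a elt) module" and f g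
  assume *: "M \<in> Ob (mod_cat \<Lambda>)" "f \<in> arrows (mod_cat \<Lambda>) M N" "g \<in> arrows (mod_cat \<Lambda>) N P"
  then show "Comp (mod_cat \<Lambda>) M g f \<in> arrows (mod_cat \<Lambda>) M P" by (simp add: hom_module_compose)
next
  fix M N P Q :: "('a, 'a elt) module" and f g h
  assume *: "f \<in> arrows (mod_cat \<Lambda>) M N"
  then show "Comp (mod_cat \<Lambda>) M (Comp (mod_cat \<Lambda>) N h g) f = Comp (mod_cat \<Lambda>) M h (Comp (mod_cat \<Lambda>) M g f)"
    by (auto simp: compose_def fun_eq_iff hom_moduleD)
next
  fix M N :: "('a, 'a elt) module" and f assume "f \<in> arrows (mod_cat \<Lambda>) M N"
  then have f: "f \<in> hom_module \<Lambda> M N" by simp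
  then show "Comp (mod_cat \<Lambda>) M (Ident (mod_cat \<Lambda>) N) f = f"
    using hom_moduleD(2)[OF f] by (auto simp: compose_def hom_moduleD extensional_def fun_eq_iff)
  show "Comp (mod_cat \<Lambda>) M f (Ident (mod_cat \<Lambda>) M) = f"
    using hom_moduleD(2)[OF f] by (auto simp: compose_def extensional_def fun_eq_iff)
next
  fix M N P :: "('a, 'a elt) module"
  assume *: "M \<in> Ob (mod_cat \<Lambda>)" "N \<in> Ob (mod_cat \<Lambda>)" "P \<in> Ob (mod_cat \<Lambda>)"
  interpret M: left_module \<Lambda> M using * by simp
  {
    fix g assume "g \<in> arrows (mod_cat \<Lambda>) N P"
    then show "(\<lambda>f. Comp (mod_cat \<Lambda>) M g f) \<in> hom (Hom (mod_cat \<Lambda>) M N) (Hom (mod_cat \<Lambda>) M P)"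
      using * by (auto intro!: homI hom_module_compose)
        (auto simp: fun_eq_iff compose_def hom_moduleD)
  next
    fix f assume "f \<in> arrows (mod_cat \<Lambda>) M N"
    then show "(\<lambda>g. Comp (mod_cat \<Lambda>) M g f) \<in> hom (Hom (mod_cat \<Lambda>) N P) (Hom (mod_cat \<Lambda>) M P)"
      using * by (auto intro!: homI hom_module_compose)
        (auto simp: fun_eq_iff compose_def hom_moduleD)
  }
qed

text \<open>The image of \<open>p\<close> is generated by the images of generators of \<open>A\<close>.\<close>

lemma idempotents_split_mod_cat: "idempotents_split (mod_cat \<Lambda>)"
  unfolding idempotents_split_def
proof (intro ballI impI)
  fix A :: "('a, 'a elt) module" and p
  assume A: "A \<in> Ob (mod_cat \<Lambda>)" and p': "p \<in> arrows (mod_cat \<Lambda>) A A"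
    and pp': "Comp (mod_cat \<Lambda>) A p p = p"
  interpret A: left_module \<Lambda> A using A by simp
  have p: "p \<in> hom_module \<Lambda> A A" using p' by simp
  note D = hom_moduleD[OF p]
  have pp: "p (p x) = p x" if "x \<in> carrier A" for x
    using fun_cong[OF pp', of x] that by (simp add: compose_def)
  have p0: "p \<zero>\<^bsub>A\<^esub> = \<zero>\<^bsub>A\<^esub>" by (rule hom_module_zero[OF _ _ p]) (use A in simp_all)
  define B where "B = A\<lparr>carrier := p ` carrier A\<rparr>"
  have [simp]: "carrier B = p ` carrier A" "x \<oplus>\<^bsub>B\<^esub> y = x \<oplus>\<^bsub>A\<^esub> y" "\<zero>\<^bsub>B\<^esub> = \<zero>\<^bsub>A\<^esub>" "a \<odot>\<^bsub>B\<^esub> x = a \<odot>\<^bsub>A\<^esub> x" for x y a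
    by (simp_all add: B_def)
  have add: "p x \<oplus>\<^bsub>A\<^esub> p y \<in> p ` carrier A" if "x \<in> carrier A" "y \<in> carrier A" for x y
    using D(3)[OF that] that by (metis A.M.a_closed imageI)
  have smult: "a \<odot>\<^bsub>A\<^esub> p x \<in> p ` carrier A" if "a \<in> carrier \<Lambda>" "x \<in> carrier A" for x a
    using D(4)[OF that] that by (metis A.smult_closed imageI)
  have zero: "\<zero>\<^bsub>A\<^esub> \<in> p ` carrier A" using p0 by (metis A.M.zero_closed imageI)
  have "submodule (p ` carrier A) \<Lambda> A"
    using add zero smult D(1) by (intro A.left_submoduleI) blast+
  then have B: "left_module \<Lambda> B" unfolding B_def by (rule A.submodule_left_module)
  interpret B: left_module \<Lambda> B by (rule B)
  obtain S where S: "finite S" "S \<subseteq> carrier A"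
    and gen: "\<And>W. \<lbrakk>submodule W \<Lambda> A; S \<subseteq> W\<rbrakk> \<Longrightarrow> carrier A \<subseteq> W"
    using A unfolding mod_cat_simps A.fin_gen_iff by blast
  have "fin_gen \<Lambda> B"
    unfolding B.fin_gen_iff
  proof (intro exI[of _ "p ` S"] conjI allI impI)
    fix W assume W: "submodule W \<Lambda> B" and "p ` S \<subseteq> W"
    note W' = B.submodule_closed[OF W]
    have "submodule {x \<in> carrier A. p x \<in> W} \<Lambda> A"
      using W' by (intro A.left_submoduleI) (auto simp: D p0 A.smult_closed)
    moreover have "S \<subseteq> {x \<in> carrier A. p x \<in> W}" using \<open>p ` S \<subseteq> W\<close> S(2) by blast
    ultimately have "carrier A \<subseteq> {x \<in> carrier A. p x \<in> W}" by (rule gen)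
    then show "carrier B \<subseteq> W" by auto
  qed (use S in auto)
  with B have "B \<in> Ob (mod_cat \<Lambda>)" by simp
  moreover have "(\<lambda>x\<in>carrier B. x) \<in> hom_module \<Lambda> B A"
    by (rule hom_moduleI) (auto simp: D add smult)
  moreover have "p \<in> hom_module \<Lambda> A B" by (rule hom_moduleI) (auto simp: D)
  moreover have "compose (carrier B) p (\<lambda>x\<in>carrier B. x) = (\<lambda>x\<in>carrier B. x)"
    by (auto simp: compose_def pp fun_eq_iff)
  moreover have "compose (carrier A) (\<lambda>x\<in>carrier B. x) p = p"
    using D(2) by (auto simp: compose_def extensional_def fun_eq_iff)
  ultimately show "\<exists>B\<in>Ob (mod_cat \<Lambda>). \<exists>i\<in>arrows (mod_cat \<Lambda>) B A. \<exists>r\<in>arrows (mod_cat \<Lambda>) A B.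
      Comp (mod_cat \<Lambda>) B r i = Ident (mod_cat \<Lambda>) B \<and> Comp (mod_cat \<Lambda>) A i r = p"
    unfolding mod_cat_simps(2,5,6) by blast
qed

lemma op_artinian_cong:
  assumes eq: "carrier M = carrier N" "add M = add N" "\<zero>\<^bsub>M\<^esub> = \<zero>\<^bsub>N\<^esub>"
    and "\<And>t x. \<lbrakk>t \<in> T; x \<in> carrier M\<rbrakk> \<Longrightarrow> \<beta> t x = \<gamma> t x"
    and art: "op_artinian T \<beta> M"
  shows "op_artinian T \<gamma> N"
  unfolding op_artinian_def
proof (intro allI impI)
  fix I assume I: "\<forall>n::nat. additive_subgroup (I n) N \<and> (\<forall>t\<in>T. \<forall>x\<in>I n. \<gamma> t x \<in> I n) \<and> I (Suc n) \<subseteq> I n"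
  have sub: "additive_subgroup (I n) M" for n
    using I eq by (simp add: additive_subgroup_def subgroup_def m_inv_def)
  have "\<beta> t x \<in> I n" if "t \<in> T" "x \<in> I n" for t x n
    using I that assms(4)[of t x] additive_subgroup.a_subset[OF sub[of n]] by auto
  then show "\<exists>n. \<forall>m\<ge>n. I m = I n"
    using op_artinianD[where N = I, OF art sub] I by (metis (no_types))
qed

text \<open>Turns an action \<open>\<rho>\<close> of a ring on the group \<open>M\<close> into a module over that ring, to which the facts
  about Fitting elements apply.\<close>

definition endo_module :: "('a, 'b, 'l) module_scheme \<Rightarrow> ('e \<Rightarrow> 'b \<Rightarrow> 'b) \<Rightarrow> ('e, 'b) module" where
  "endo_module M \<rho> = \<lparr>carrier = carrier M, mult = undefined, one = undefined,
     zero = \<zero>\<^bsub>M\<^esub>, add = add M, smult = \<rho>\<rparr>"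

lemma endo_module_simps [simp]:
  "carrier (endo_module M \<rho>) = carrier M" "\<zero>\<^bsub>endo_module M \<rho>\<^esub> = \<zero>\<^bsub>M\<^esub>"
  "add (endo_module M \<rho>) = add M" "smult (endo_module M \<rho>) = \<rho>"
  by (simp_all add: endo_module_def)

text \<open>\<open>E\<close> acts on \<open>M\<close> by \<open>\<Lambda>\<close>-linear maps \<open>\<rho> t\<close>, and \<open>\<kappa> r \<in> E\<close> acts as the scalar \<open>r \<in> R\<close>. The chain
  condition gives a Fitting element that kills finitely many generators of \<open>M\<close>; by linearity it
  annihilates \<open>M\<close>.\<close>

lemma fitting_element_annihilates:
  fixes E :: "('e, 'k) ring_scheme" and \<Lambda> :: "('r, 'a, 'l) module_scheme"
  assumes art: "artin_algebra R \<Lambda>" and M: "left_module \<Lambda> M" and fg: "fin_gen \<Lambda> M"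
    and E: "ring E" and x: "x \<in> carrier E"
    and \<rho>: "\<And>t. t \<in> carrier E \<Longrightarrow> \<rho> t \<in> hom_module \<Lambda> M M"
    and \<rho>_add: "\<And>s t m. \<lbrakk>s \<in> carrier E; t \<in> carrier E; m \<in> carrier M\<rbrakk> \<Longrightarrow> \<rho> (s \<oplus>\<^bsub>E\<^esub> t) m = \<rho> s m \<oplus>\<^bsub>M\<^esub> \<rho> t m"
    and \<rho>_mult: "\<And>s t m. \<lbrakk>s \<in> carrier E; t \<in> carrier E; m \<in> carrier M\<rbrakk> \<Longrightarrow> \<rho> (s \<otimes>\<^bsub>E\<^esub> t) m = \<rho> s (\<rho> t m)"
    and \<rho>_one: "\<And>m. m \<in> carrier M \<Longrightarrow> \<rho> \<one>\<^bsub>E\<^esub> m = m"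
    and \<kappa>: "\<And>r. r \<in> carrier R \<Longrightarrow> \<kappa> r \<in> bicommutant E x"
    and \<rho>_\<kappa>: "\<And>r m. \<lbrakk>r \<in> carrier R; m \<in> carrier M\<rbrakk> \<Longrightarrow> \<rho> (\<kappa> r) m = (r \<odot>\<^bsub>\<Lambda>\<^esub> \<one>\<^bsub>\<Lambda>\<^esub>) \<odot>\<^bsub>M\<^esub> m"
  shows "\<exists>t\<in>ring.fitting_elements E x. \<forall>m\<in>carrier M. \<rho> t m = \<zero>\<^bsub>M\<^esub>"
proof -
  interpret M: left_module \<Lambda> M by (rule M)
  interpret E: ring E by (rule E)
  have "abelian_group (endo_module M \<rho>)"
  proof (rule abelian_groupI)
    fix x assume "x \<in> carrier (endo_module M \<rho>)"
    then show "\<exists>y\<in>carrier (endo_module M \<rho>). y \<oplus>\<^bsub>endo_module M \<rho>\<^esub> x = \<zero>\<^bsub>endo_module M \<rho>\<^esub>"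
      by (auto intro!: bexI[of _ "\<ominus>\<^bsub>M\<^esub> x"] simp: M.M.l_neg)
  qed (auto simp: M.M.a_ac)
  then have EM: "left_module E (endo_module M \<rho>)"
    by (intro left_module.intro left_module_axioms.intro E)
      (auto simp: \<rho>_add \<rho>_mult \<rho>_one hom_moduleD[OF \<rho>])
  have "op_artinian (carrier R) (\<lambda>r m. \<kappa> r \<odot>\<^bsub>endo_module M \<rho>\<^esub> m) (endo_module M \<rho>)"
    by (rule op_artinian_cong[OF _ _ _ _ artin_algebra_op_artinian[OF art M fg]]) (simp_all add: \<rho>_\<kappa>)
  note kill = E.fitting_element_kills_finite[OF EM x \<kappa> this]
  obtain S where S: "finite S" "S \<subseteq> carrier M"
    and gen: "\<And>W. \<lbrakk>submodule W \<Lambda> M; S \<subseteq> W\<rbrakk> \<Longrightarrow> carrier M \<subseteq> W"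
    using fg unfolding M.fin_gen_iff by blast
  obtain t where t: "t \<in> E.fitting_elements x" and kt: "\<forall>s\<in>S. \<rho> t s = \<zero>\<^bsub>M\<^esub>"
    using kill[of S] S by auto
  have "t \<in> carrier E" by (rule E.bicommutant_closed[OF E.fitting_elements_bicommutant[OF x t]])
  note T = \<rho>[OF this]
  have "submodule {m \<in> carrier M. \<rho> t m = \<zero>\<^bsub>M\<^esub>} \<Lambda> M"
    by (rule M.left_submoduleI)
      (auto simp: hom_moduleD[OF T] hom_module_zero[OF M M T] M.smult_closed M.smult_r_null)
  then have "carrier M \<subseteq> {m \<in> carrier M. \<rho> t m = \<zero>\<^bsub>M\<^esub>}" by (rule gen) (use S kt in auto)
  then show ?thesis using t by blast
qed

text \<open>The endomorphism ring \<open>E\<close> of \<open>A1 \<rightarrow> A0\<close> acts on \<open>A1\<close> and on \<open>A0\<close>. The product of a Fitting element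
  that annihilates \<open>A1\<close> and one that annihilates \<open>A0\<close> is a Fitting element equal to zero.\<close>

lemma fitting_category_maps_mod_cat:
  fixes \<Lambda> :: "('r, 'a, 'l) module_scheme"
  assumes art: "artin_algebra R \<Lambda>"
  shows "fitting_category (maps_cat (mod_cat \<Lambda>))"
  unfolding fitting_category_def
proof (intro ballI)
  let ?C = "maps_cat (mod_cat \<Lambda>)"
  interpret C: preadditive "mod_cat \<Lambda>" by (rule preadditive_mod_cat)
  interpret M: preadditive ?C by (rule C.preadditive_maps_cat)
  fix A x assume A: "A \<in> Ob ?C" and x': "x \<in> arrows ?C A A"
  obtain A1 A0 f where eq: "A = (A1, A0, f)" by (metis prod.exhaust)
  have A1: "left_module \<Lambda> A1" "fin_gen \<Lambda> A1" and A0: "left_module \<Lambda> A0" "fin_gen \<Lambda> A0"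
    and f: "f \<in> hom_module \<Lambda> A1 A0" using A unfolding eq by simp_all
  let ?E = "end_ring ?C A"
  interpret E: ring ?E by (rule M.ring_end_ring[OF A])
  interpret A1: left_module \<Lambda> A1 by (rule A1)
  interpret A0: left_module \<Lambda> A0 by (rule A0)
  have x: "x \<in> carrier ?E" using x' by simp
  have EI: "u \<in> carrier ?E \<longleftrightarrow> fst u \<in> hom_module \<Lambda> A1 A1 \<and> snd u \<in> hom_module \<Lambda> A0 A0 \<and>
      (\<forall>m\<in>carrier A1. f (fst u m) = snd u (f m))" for u
  proof -
    have "compose (carrier A1) f (fst u) = compose (carrier A1) (snd u) f \<longleftrightarrow>
        (\<forall>m\<in>carrier A1. f (fst u m) = snd u (f m))"
      by (auto simp: compose_def fun_eq_iff)
    then show ?thesis unfolding eq by (cases u) simp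
  qed
  have E_simps: "fst (u \<otimes>\<^bsub>?E\<^esub> v) = compose (carrier A1) (fst u) (fst v)"
    "snd (u \<otimes>\<^bsub>?E\<^esub> v) = compose (carrier A0) (snd u) (snd v)"
    "fst (u \<oplus>\<^bsub>?E\<^esub> v) = (\<lambda>m\<in>carrier A1. fst u m \<oplus>\<^bsub>A1\<^esub> fst v m)"
    "snd (u \<oplus>\<^bsub>?E\<^esub> v) = (\<lambda>m\<in>carrier A0. snd u m \<oplus>\<^bsub>A0\<^esub> snd v m)"
    "\<one>\<^bsub>?E\<^esub> = (\<lambda>m\<in>carrier A1. m, \<lambda>m\<in>carrier A0. m)"
    "\<zero>\<^bsub>?E\<^esub> = (\<lambda>m\<in>carrier A1. \<zero>\<^bsub>A1\<^esub>, \<lambda>m\<in>carrier A0. \<zero>\<^bsub>A0\<^esub>)" for u v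
    unfolding eq by (cases u, cases v, simp)+
  have "module R \<Lambda>" "ring \<Lambda>"
    and assoc: "\<And>r a b. \<lbrakk>r \<in> carrier R; a \<in> carrier \<Lambda>; b \<in> carrier \<Lambda>\<rbrakk> \<Longrightarrow>
        (r \<odot>\<^bsub>\<Lambda>\<^esub> a) \<otimes>\<^bsub>\<Lambda>\<^esub> b = r \<odot>\<^bsub>\<Lambda>\<^esub> (a \<otimes>\<^bsub>\<Lambda>\<^esub> b) \<and> a \<otimes>\<^bsub>\<Lambda>\<^esub> (r \<odot>\<^bsub>\<Lambda>\<^esub> b) = r \<odot>\<^bsub>\<Lambda>\<^esub> (a \<otimes>\<^bsub>\<Lambda>\<^esub> b)"
    using art unfolding artin_algebra_def by auto
  interpret L: module R \<Lambda> by fact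
  define \<zeta> where "\<zeta> r = r \<odot>\<^bsub>\<Lambda>\<^esub> \<one>\<^bsub>\<Lambda>\<^esub>" for r
  have \<zeta>: "\<zeta> r \<in> carrier \<Lambda>" and central: "\<And>a. a \<in> carrier \<Lambda> \<Longrightarrow> \<zeta> r \<otimes>\<^bsub>\<Lambda>\<^esub> a = a \<otimes>\<^bsub>\<Lambda>\<^esub> \<zeta> r"
    if "r \<in> carrier R" for r
    using that assoc[OF that A1.R.one_closed] assoc[OF that _ A1.R.one_closed] by (auto simp: \<zeta>_def)
  have scalar_hom: "(\<lambda>m\<in>carrier M. \<zeta> r \<odot>\<^bsub>M\<^esub> m) \<in> hom_module \<Lambda> M M"
    if r: "r \<in> carrier R" and M: "left_module \<Lambda> M" for r and M :: "('a, 'a elt) module"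
  proof -
    interpret M: left_module \<Lambda> M by (rule M)
    show ?thesis
      using \<zeta>[OF r] by (intro hom_moduleI)
        (auto simp: M.smult_closed M.smult_r_distr M.smult_assoc1[symmetric] central[OF r])
  qed
  \<comment> \<open>Scalars from \<open>R\<close> act by central elements of \<open>\<Lambda>\<close>, hence by endomorphisms of \<open>A\<close> that commute
    with all others.\<close>
  define \<kappa> where "\<kappa> r = (\<lambda>m\<in>carrier A1. \<zeta> r \<odot>\<^bsub>A1\<^esub> m, \<lambda>m\<in>carrier A0. \<zeta> r \<odot>\<^bsub>A0\<^esub> m)" for r
  have \<kappa>: "\<kappa> r \<in> bicommutant ?E x" if r: "r \<in> carrier R" for r
  proof -
    have "\<kappa> r \<in> carrier ?E"
      unfolding EI \<kappa>_def using scalar_hom[OF r A1(1)] scalar_hom[OF r A0(1)] \<zeta>[OF r]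
      by (auto simp: hom_moduleD[OF f])
    moreover have "a \<otimes>\<^bsub>?E\<^esub> \<kappa> r = \<kappa> r \<otimes>\<^bsub>?E\<^esub> a" if "a \<in> carrier ?E" for a
    proof (rule prod_eqI)
      have a: "fst a \<in> hom_module \<Lambda> A1 A1" "snd a \<in> hom_module \<Lambda> A0 A0" using that EI by simp_all
      show "fst (a \<otimes>\<^bsub>?E\<^esub> \<kappa> r) = fst (\<kappa> r \<otimes>\<^bsub>?E\<^esub> a)" "snd (a \<otimes>\<^bsub>?E\<^esub> \<kappa> r) = snd (\<kappa> r \<otimes>\<^bsub>?E\<^esub> a)"
        unfolding E_simps using \<zeta>[OF r]
        by (auto simp: \<kappa>_def compose_def fun_eq_iff hom_moduleD[OF a(1)] hom_moduleD[OF a(2)])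
    qed
    ultimately show ?thesis unfolding bicommutant_def by simp
  qed
  have "\<exists>t\<in>E.fitting_elements x. \<forall>m\<in>carrier A1. fst t m = \<zero>\<^bsub>A1\<^esub>"
    by (rule fitting_element_annihilates[OF art A1 E.ring_axioms x _ _ _ _ \<kappa>])
      (auto simp: EI E_simps compose_def \<kappa>_def \<zeta>_def simp del: end_ring_simps)
  then obtain s where s: "s \<in> E.fitting_elements x" "\<And>m. m \<in> carrier A1 \<Longrightarrow> fst s m = \<zero>\<^bsub>A1\<^esub>" by blast
  have "\<exists>t\<in>E.fitting_elements x. \<forall>m\<in>carrier A0. snd t m = \<zero>\<^bsub>A0\<^esub>"
    by (rule fitting_element_annihilates[OF art A0 E.ring_axioms x _ _ _ _ \<kappa>])
      (auto simp: EI E_simps compose_def \<kappa>_def \<zeta>_def simp del: end_ring_simps)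
  then obtain t where t: "t \<in> E.fitting_elements x" "\<And>m. m \<in> carrier A0 \<Longrightarrow> snd t m = \<zero>\<^bsub>A0\<^esub>" by blast
  have "s \<in> carrier ?E" "t \<in> carrier ?E"
    using E.fitting_elements_bicommutant[OF x] s(1) t(1) E.bicommutant_closed by blast+
  then have h: "fst t \<in> hom_module \<Lambda> A1 A1" "snd s \<in> hom_module \<Lambda> A0 A0" using EI by simp_all
  have "s \<otimes>\<^bsub>?E\<^esub> t = \<zero>\<^bsub>?E\<^esub>"
  proof (rule prod_eqI)
    show "fst (s \<otimes>\<^bsub>?E\<^esub> t) = fst \<zero>\<^bsub>?E\<^esub>" "snd (s \<otimes>\<^bsub>?E\<^esub> t) = snd \<zero>\<^bsub>?E\<^esub>"
      unfolding E_simps using s(2) t(2) hom_moduleD(1)[OF h(1)] hom_module_zero[OF A0(1) A0(1) h(2)]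
      by (auto simp: compose_def fun_eq_iff)
  qed
  then have "\<zero>\<^bsub>?E\<^esub> \<in> E.fitting_elements x" using E.fitting_elements_mult[OF x s(1) t(1)] by simp
  from E.fitting_idempotent[OF x this]
  show "\<exists>k>0. \<exists>y\<in>arrows ?C A A. let w = x [^]\<^bsub>end_ring ?C A\<^esub> (k::nat) in
       Comp ?C A (Comp ?C A w y) (Comp ?C A w y) = Comp ?C A w y \<and> Comp ?C A w (Comp ?C A w y) = w"
    unfolding end_ring_simps by simp
qed

theorem theorem3p8:
  fixes R :: "('r, 'k) ring_scheme"
    and \<Lambda> :: "('r, 'a, 'l) module_scheme"
    and \<C> :: "(('a, 'a elt) module \<times> ('a, 'a elt) module \<times> ('a elt \<Rightarrow> 'a elt)) set"
  assumes "artin_algebra R \<Lambda>"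
    and "subcategory (maps_cat (mod_cat \<Lambda>)) \<C>"
  shows "(contravariantly_finite (maps_cat (mod_cat \<Lambda>)) \<C> \<longrightarrow>
           subcategory (fp_cat (mod_cat \<Lambda>)) (Phi_image (mod_cat \<Lambda>) \<C>) \<and>
           contravariantly_finite (fp_cat (mod_cat \<Lambda>)) (Phi_image (mod_cat \<Lambda>) \<C>)) \<and>
         (covariantly_finite (maps_cat (mod_cat \<Lambda>)) \<C> \<longrightarrow>
           subcategory (fp_cat (mod_cat \<Lambda>)) (Phi_image (mod_cat \<Lambda>) \<C>) \<and>
           covariantly_finite (fp_cat (mod_cat \<Lambda>)) (Phi_image (mod_cat \<Lambda>) \<C>)) \<and>
         (functorially_finite (maps_cat (mod_cat \<Lambda>)) \<C> \<longrightarrow>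
           subcategory (fp_cat (mod_cat \<Lambda>)) (Phi_image (mod_cat \<Lambda>) \<C>) \<and>
           functorially_finite (fp_cat (mod_cat \<Lambda>)) (Phi_image (mod_cat \<Lambda>) \<C>))"
proof -
  interpret preadditive "mod_cat \<Lambda>" by (rule preadditive_mod_cat)
  have sub: "subcategory (fp_cat (mod_cat \<Lambda>)) (Phi_image (mod_cat \<Lambda>) \<C>)"
    by (rule subcategory_Phi_image[OF idempotents_split_mod_cat fitting_category_maps_mod_cat[OF assms(1)] assms(2)])
  have \<C>: "\<C> \<subseteq> Ob (maps_cat (mod_cat \<Lambda>))"
    using assms(2) unfolding subcategory_def by (rule conjunct1)
  show ?thesis
    unfolding functorially_finite_def
    using sub contravariantly_finite_Phi_image[OF \<C>] covariantly_finite_Phi_image[OF \<C>] by blast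
qed

end
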